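(* Let $I\subset \mathscr{O}_{\mathbb{C}^n,0}$ be an ideal. Then $I$ is a Tjurina ideal (that is, $I=T(f)$ for some $f\in\mathscr{O}_{\mathbb{C}^n,0}$) if and only if $I$ is $T$-full and the ideal $\Delta(I)$ is $T$-dependent.
   Context: Fix $n\geqslant 1$. $\mathscr{O}_{\mathbb{C}^n,0}=\mathbb{C}\{x_1,\ldots,x_n\}$ is the ring of germs at $0\in\mathbb{C}^n$ of holomorphic functions, with maximal ideal $\mathfrak{m}=\langle x_1,\ldots,x_n\rangle$. For $f\in\mathscr{O}_{\mathbb{C}^n,0}$, its Tjurina ideal is $T(f)=\langle f,\frac{\partial f}{\partial x_1},\ldots,\frac{\partial f}{\partial x_n}\rangle$. For an ideal $J=\langle g_1,\ldots,g_q\rangle$, put $T(J)=T(g_1)+\cdots+T(g_q)$; this ideal does not depend on the choice of generators of $J$. For an ideal $I$, the ideal of antiderivatives of $I$ is $\Delta(I)=\{f\in\mathscr{O}_{\mathbb{C}^n,0}\mid T(f)\subseteq I\}$ (it is an ideal, and $T(\Delta(I))\subseteq I$ always). The ideal $I$ is $T$-full if $I=T(\Delta(I))$. $T$-dependence. Let $J\subset\mathscr{O}_{\mathbb{C}^n,0}$ be any ideal, given by generators $J=\langle g_1,\ldots,g_q\rangle$. Let $S=\mathscr{O}_{\mathbb{C}^n,0}[\alpha_1,\ldots,\alpha_q]$ be the polynomial ring graded by $\deg\alpha_i=1$, let $\mathbb{P}^{q-1}=\mathrm{Proj}(S)$, and let $\pi:\mathbb{P}^{q-1}\to\mathrm{Spec}\,\mathscr{O}_{\mathbb{C}^n,0}$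 be the natural morphism. Put $\sigma=\sum_{i=1}^q g_i\alpha_i$, and let $\mathscr{T}(\sigma)$ be the ideal sheaf on $\mathbb{P}^{q-1}$ associated to the homogeneous ideal $\langle\sigma,\frac{\partial\sigma}{\partial x_1},\ldots,\frac{\partial\sigma}{\partial x_n}\rangle$ of $S$ (the $\alpha_i$ are treated as constants in $\frac{\partial}{\partial x_j}$). Let $\pi^*(T(J))$ be the ideal sheaf associated to $T(J)S$; it contains $\mathscr{T}(\sigma)$. Put $\mathscr{F}=\pi^*(T(J))/\mathscr{T}(\sigma)$, whose support is the closed subscheme of $\mathbb{P}^{q-1}$ given by the vanishing of the colon ideal $\big(\mathscr{T}(\sigma):\pi^*(T(J))\big)$. The ideal $J$ is called $T$-dependent if $\pi^{-1}(\mathfrak{m})\not\subset\mathrm{Supp}\,\mathscr{F}$; equivalently, if $\big(\mathscr{T}(\sigma):\pi^*(T(J))\big)\not\subset\mathfrak{m}S$. The condition is formulated with an arbitrary given generating system $g_1,\ldots,g_q$ of $J$, and the author of the theorem asserts, as a separate lemma, that it does not depend on the choice of generators of $J$.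
   Formalization: T-dependence of Δ(I) is taken to mean that the condition holds for some finite generating system, since it can depend on the choice of generators: for J=⟨g,h⟩ in disjoint variables, g,h not in their Jacobian ideals, u a further variable, it fails for (g,h) but holds for (g,h,ug). *)

theory Defs
  imports "HOL-Complex_Analysis.Cauchy_Integral_Formula" "HOL-Algebra.QuotRing" "HOL-Library.Poly_Mapping"
begin

section \<open>Germs of holomorphic functions at the origin\<close>

text \<open>A function on \<open>\<complex>\<^sup>n\<close> is holomorphic on an open set if it is totally complex differentiable at
  every point of it, i.e. if its (real) Frechet derivative is complex linear there.\<close>

definition cdifferentiable_at :: "(complex^'n \<Rightarrow> complex) \<Rightarrow> complex^'n \<Rightarrow> bool" where
  "cdifferentiable_at f x \<longleftrightarrow>
     (\<exists>A. (f has_derivative A) (at x) \<and> (\<forall>c v. A (c *s v) = c * A v))"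

definition holomorphic_near_0 :: "(complex^'n \<Rightarrow> complex) \<Rightarrow> bool" where
  "holomorphic_near_0 f \<longleftrightarrow> (\<exists>U. open U \<and> 0 \<in> U \<and> (\<forall>x\<in>U. cdifferentiable_at f x))"

definition germ_eq :: "(complex^'n \<Rightarrow> complex) \<Rightarrow> (complex^'n \<Rightarrow> complex) \<Rightarrow> bool" where
  "germ_eq f g \<longleftrightarrow>
     holomorphic_near_0 f \<and> holomorphic_near_0 g \<and> eventually (\<lambda>x. f x = g x) (nhds 0)"

definition pderiv_at :: "'n \<Rightarrow> (complex^'n \<Rightarrow> complex) \<Rightarrow> complex^'n \<Rightarrow> complex" where
  "pderiv_at j f x = deriv (\<lambda>z. f (x + z *s axis j 1)) 0"

lemma norm_vector_smult: "norm (c *s (v::complex^'n)) = cmod c * norm v"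
  by (simp add: norm_vec_def norm_mult L2_set_right_distrib)

lemma bounded_linear_smult_left: "bounded_linear (\<lambda>z. z *s (v::complex^'n))"
proof (rule bounded_linear_intro[where K="norm v"])
  show "(x + y) *s v = x *s v + y *s v" for x y by (simp add: vec_eq_iff algebra_simps)
  show "(r *\<^sub>R x) *s v = r *\<^sub>R (x *s v)" for r x by (simp add: vec_eq_iff)
qed (simp add: norm_vector_smult)

lemma line_has_field_derivative:
  fixes f :: "complex^'n \<Rightarrow> complex"
  assumes "(f has_derivative A) (at (x + z *s v))" "\<And>c v. A (c *s v) = c * A v"
  shows "((\<lambda>z. f (x + z *s v)) has_field_derivative A v) (at z)"
proof -
  have "((\<lambda>z. x + z *s v) has_derivative (\<lambda>z. z *s v)) (at z)"
    using bounded_linear_imp_has_derivative[OF bounded_linear_smult_left]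
    by (auto intro!: derivative_eq_intros)
  from has_derivative_compose[OF this assms(1)] show ?thesis
    by (simp add: has_field_derivative_def assms(2) mult_commute_abs)
qed

lemma pderiv_at_eq:
  assumes "(f has_derivative A) (at x)" "\<And>c v. A (c *s v) = c * A v"
  shows "pderiv_at j f x = A (axis j 1)"
  unfolding pderiv_at_def
  by (rule DERIV_imp_deriv, rule line_has_field_derivative) (use assms in auto)

lemma Taylor2_bound:
  fixes f :: "complex^'n \<Rightarrow> complex"
  assumes D: "\<And>y. y \<in> cball x (3*r) \<Longrightarrow> (f has_derivative D y) (at y)"
    and lin: "\<And>y c v. y \<in> cball x (3*r) \<Longrightarrow> D y (c *s v) = c * D y v"
    and M: "\<And>y. y \<in> cball x (3*r) \<Longrightarrow> cmod (f y) \<le> M" and r: "r > 0" and h: "norm h \<le> r"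
  shows "cmod (f (x+h) - f x - D x h) \<le> 2 * M / r^2 * norm h ^ 2"
proof (cases "h = 0")
  case True
  have "D x 0 = 0" using lin[of x 0 0] r by simp
  with True show ?thesis by simp
next
  case False
  define p where "p = (\<lambda>z. f (x + z *s h))"
  define R where "R = r / norm h"
  have nh: "norm h > 0" using False by simp
  have R1: "R \<ge> 1" unfolding R_def using nh h by simp
  have inb: "x + z *s h \<in> cball x (3*r)" if "cmod z \<le> 3*R" for z
  proof -
    have "norm (z *s h) \<le> 3*R * norm h" unfolding norm_vector_smult using that nh by simp
    also have "\<dots> = 3*r" using nh by (simp add: R_def)
    finally show ?thesis by (simp add: dist_norm)
  qed
  have dp: "(p has_field_derivative D (x + z *s h) h) (at z)" if "cmod z \<le> 3*R" for z
    unfolding p_def by (rule line_has_field_derivative) (use inb[OF that] D lin in auto)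
  have hol: "p holomorphic_on ball 0 (3*R)"
    unfolding holomorphic_on_open[OF open_ball] using dp by (metis less_imp_le mem_ball_0)
  have d2: "cmod ((deriv ^^ 2) p z) \<le> 2 * M / R^2" if "z \<in> cball 0 1" for z
  proof -
    have sub: "cball z R \<subseteq> ball 0 (3*R)"
    proof
      fix w assume "w \<in> cball z R"
      then have "cmod (z - w) \<le> R" by (simp add: dist_norm)
      then have "cmod w \<le> R + 1" using that norm_triangle_ineq4[of z "z-w"] by simp
      then show "w \<in> ball 0 (3*R)" using R1 by simp
    qed
    have "cmod ((deriv ^^ 2) p z) \<le> fact 2 * M / R^2"
    proof (rule Cauchy_inequality)
      show "p holomorphic_on ball z R" using hol sub ball_subset_cball holomorphic_on_subset by blast
      show "continuous_on (cball z R) p" using hol sub holomorphic_on_imp_continuous_on continuous_on_subset by blast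
      show "0 < R" using R1 by simp
      fix w assume "cmod (z - w) = R"
      then have "w \<in> cball z R" by (simp add: dist_norm)
      then have "cmod w \<le> 3*R" using sub by force
      then show "cmod (p w) \<le> M" unfolding p_def using M inb by blast
    qed
    then show ?thesis by (simp add: fact_2)
  qed
  have "cmod ((deriv ^^ 0) p 1 - (\<Sum>i\<le>1. (deriv ^^ i) p 0 * (1 - 0) ^ i / fact i))
        \<le> 2*M/R^2 * cmod (1 - 0) ^ Suc 1 / fact 1"
  proof (rule complex_Taylor[where S="cball 0 1" and f="\<lambda>i. (deriv ^^ i) p"])
    fix i z assume "z \<in> cball (0::complex) 1" "i \<le> (1::nat)"
    then have "z \<in> ball 0 (3*R)" using R1 by simp
    then have "((deriv ^^ i) p has_field_derivative (deriv ^^ Suc i) p z) (at z)"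
      using has_field_derivative_higher_deriv[OF hol] by auto
    then show "((deriv ^^ i) p has_field_derivative (deriv ^^ Suc i) p z) (at z within cball 0 1)"
      by (rule has_field_derivative_at_within)
  qed (use d2 in \<open>auto simp: numeral_2_eq_2\<close>)
  moreover have "deriv p 0 = D x h" using dp[of 0] R1 by (intro DERIV_imp_deriv) simp
  moreover have "p 1 = f (x+h)" "p 0 = f x" by (auto simp: p_def)
  moreover have "2*M/R^2 = 2*M/r^2 * norm h^2" by (simp add: R_def power_divide)
  ultimately show ?thesis by (simp add: algebra_simps)
qed

lemma cdifferentiable_pderiv_at:
  fixes f :: "complex^'n \<Rightarrow> complex"
  assumes U: "open U" and f: "\<And>x. x \<in> U \<Longrightarrow> cdifferentiable_at f x" and x0: "x0 \<in> U"
  shows "cdifferentiable_at (pderiv_at j f) x0"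
proof -
  obtain e where e: "e > 0" "cball x0 e \<subseteq> U" using U x0 open_contains_cball by blast
  define r where "r = e / 6"
  have r: "r > 0" and rU: "cball x0 (6*r) \<subseteq> U" using e by (auto simp: r_def)
  from f obtain D where D: "\<And>x. x \<in> U \<Longrightarrow> (f has_derivative D x) (at x)"
      and lin: "\<And>x c v. x \<in> U \<Longrightarrow> D x (c *s v) = c * D x v"
    unfolding cdifferentiable_at_def by metis
  have "continuous_on (cball x0 (6*r)) f"
    using D rU by (meson continuous_at_imp_continuous_on has_derivative_continuous subsetD)
  then have "bounded (f ` cball x0 (6*r))"
    by (intro compact_imp_bounded compact_continuous_image) auto
  then obtain M where M: "\<And>y. y \<in> cball x0 (6*r) \<Longrightarrow> cmod (f y) \<le> M"
    unfolding bounded_iff by (metis imageI)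
  have M0: "M \<ge> 0" using M[of x0] r norm_ge_zero[of "f x0"] by (smt (verit) centre_in_cball)
  define C where "C = 2*M/r^2"
  have C0: "C \<ge> 0" using M0 by (simp add: C_def)
  define v :: "complex^'n" where "v = axis j 1"
  have nv: "norm v = 1" by (simp add: v_def)
  have inU: "y \<in> U" if "y \<in> cball x0 (6*r)" for y using that rU by auto
  have T: "cmod (f (x+h) - f x - D x h) \<le> C * norm h ^ 2"
    if "x \<in> cball x0 (3*r)" "norm h \<le> r" for x h
  proof -
    have sub: "cball x (3*r) \<subseteq> cball x0 (6*r)"
    proof
      fix y assume "y \<in> cball x (3*r)"
      then show "y \<in> cball x0 (6*r)" using that(1) dist_triangle[of x0 y x] by simp
    qed
    show ?thesis unfolding C_def
      by (rule Taylor2_bound) (use sub inU D lin M r that in blast)+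
  qed
  have zin: "x0 + z *s v \<in> cball x0 s" if "cmod z \<le> s" for z s
    using that by (simp add: dist_norm norm_vector_smult nv)
  have line: "((\<lambda>z. f (x + z *s v)) has_field_derivative D (x + z *s v) v) (at z)"
    if "x + z *s v \<in> U" for x z
    by (rule line_has_field_derivative) (use that D lin in auto)
  have hol1: "(\<lambda>z. f (x + z *s v)) holomorphic_on ball 0 (2*r)" if "x \<in> cball x0 (2*r)" for x
    unfolding holomorphic_on_open[OF open_ball]
  proof
    fix z :: complex assume z: "z \<in> ball 0 (2*r)"
    have "x + z *s v \<in> cball x0 (6*r)"
      using that z r norm_triangle_ineq4[of "x0 - x" "z *s v"]
      by (simp add: dist_norm norm_vector_smult nv algebra_simps)
    then show "\<exists>f'. ((\<lambda>z. f (x + z *s v)) has_field_derivative f') (at z)"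
      using line inU by blast
  qed
  have add: "D x (a + b) = D x a + D x b" if "x \<in> U" for x a b
    using D[OF that] has_derivative_linear linear_add by blast
  have scal: "(t *\<^sub>R h :: complex^'n) = complex_of_real t *s h" for t h
    unfolding vec_eq_iff vector_scaleR_component by (simp add: scaleR_conv_of_real)
  \<comment> \<open>the directional derivative is holomorphic along the line\<close>
  have hol2': "(\<lambda>z. D (x0 + z *s v) h) holomorphic_on ball 0 (2*r)" if h: "norm h \<le> r" for h
  proof (rule holomorphic_uniform_sequence[OF open_ball])
    let ?t = "\<lambda>n. complex_of_real (1 / Suc n)"
    let ?F = "\<lambda>n z. (f (x0 + ?t n *s h + z *s v) - f (x0 + z *s v)) * of_nat (Suc n)"
    have th: "norm (?t n *s h) \<le> r / Suc n" for n
      unfolding norm_vector_smult norm_of_real using h by (simp add: divide_right_mono)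
    have th2: "r / Suc n \<le> r" for n using r by (simp add: field_simps)
    show "?F n holomorphic_on ball 0 (2*r)" for n
    proof -
      have "x0 + ?t n *s h \<in> cball x0 (2*r)"
        using th[of n] th2[of n] r by (simp add: dist_norm)
      then show ?thesis using r by (intro holomorphic_intros hol1) auto
    qed
    fix z :: complex assume "z \<in> ball 0 (2*r)"
    then obtain d where d: "d > 0" "cball z d \<subseteq> ball 0 (2*r)"
      using open_contains_cball open_ball by metis
    have "uniform_limit (cball z d) ?F (\<lambda>z. D (x0 + z *s v) h) sequentially"
    proof (rule uniform_limitI)
      fix ee :: real assume ee: "ee > 0"
      have "(\<lambda>n. C * r^2 * (1 / Suc n)) \<longlonglongrightarrow> C * r^2 * 0"
        by (intro tendsto_intros LIMSEQ_Suc lim_1_over_n)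
      then have "eventually (\<lambda>n. C * r^2 * (1 / Suc n) < ee) sequentially"
        using ee order_tendstoD(2)[of _ "0::real"] by simp
      then show "\<forall>\<^sub>F n in sequentially. \<forall>w\<in>cball z d. dist (?F n w) (D (x0 + w *s v) h) < ee"
      proof eventually_elim
        fix n assume n: "C * r^2 * (1 / Suc n) < ee"
        show "\<forall>w\<in>cball z d. dist (?F n w) (D (x0 + w *s v) h) < ee"
        proof
          fix w assume "w \<in> cball z d"
          then have w: "cmod w \<le> 2*r" using d(2) by force
          let ?x = "x0 + w *s v" and ?N = "of_nat (Suc n) :: complex"
          have xx: "?x \<in> cball x0 (3*r)" using zin w r by simp
          have xU: "?x \<in> U" by (rule inU) (use xx r in simp)
          have N0: "cmod ?N = real (Suc n)" by (rule norm_of_nat)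
          have a1: "cmod (f (?x + ?t n *s h) - f ?x - D ?x (?t n *s h)) \<le> C * norm (?t n *s h)^2"
            by (rule T[OF xx]) (use th[of n] th2[of n] in simp)
          have a2: "C * norm (?t n *s h)^2 \<le> C * (r / Suc n)^2"
            by (intro mult_left_mono power_mono th C0) auto
          have "?F n w - D ?x h = (f (?x + ?t n *s h) - f ?x - D ?x (?t n *s h)) * ?N"
            unfolding lin[OF xU] by (simp add: algebra_simps add.left_commute del: of_nat_Suc)
          then have "cmod (?F n w - D ?x h) \<le> C * (r / Suc n)^2 * real (Suc n)"
            using a1 a2 N0 by (simp add: norm_mult mult_right_mono del: of_nat_Suc)
          also have "\<dots> = C * r^2 * (1 / Suc n)" by (simp add: power2_eq_square del: of_nat_Suc)
          finally show "dist (?F n w) (D ?x h) < ee" using n by (simp add: dist_norm)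
        qed
      qed
    qed
    with d show "\<exists>d>0. cball z d \<subseteq> ball 0 (2*r) \<and>
        uniform_limit (cball z d) ?F (\<lambda>z. D (x0 + z *s v) h) sequentially" by blast
  qed
  have hol2: "(\<lambda>z. D (x0 + z *s v) h) holomorphic_on ball 0 (2*r)" for h
  proof -
    define c where "c = complex_of_real ((norm h + 1) / r)"
    have pos: "(norm h + 1) / r > 0" using r by (intro divide_pos_pos add_nonneg_pos) auto
    have c2: "cmod c = (norm h + 1) / r" unfolding c_def norm_of_real using pos by (rule abs_of_pos)
    then have c: "c \<noteq> 0" "cmod c = (norm h + 1) / r" using pos by auto
    define h' where "h' = inverse c *s h"
    have "norm h' = r * (norm h / (norm h + 1))"
      unfolding h'_def norm_vector_smult norm_inverse c by simp
    moreover have "norm h / (norm h + 1) \<le> 1" by (simp add: divide_le_eq add_nonneg_pos)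
    ultimately have h': "norm h' \<le> r" using r by (metis less_imp_le mult_left_le)
    have "h = c *s h'" using c by (simp add: h'_def vector_smult_assoc)
    then have eq: "c * D (x0 + z *s v) h' = D (x0 + z *s v) h" if "z \<in> ball 0 (2*r)" for z
      using lin[of "x0 + z *s v" c h'] inU zin[of z "6*r"] that r by simp
    have "(\<lambda>z. c * D (x0 + z *s v) h') holomorphic_on ball 0 (2*r)"
      by (intro holomorphic_intros hol2'[OF h'])
    then show ?thesis using eq by (rule holomorphic_transform)
  qed
  define L where "L h = deriv (\<lambda>z. D (x0 + z *s v) h) 0" for h
  have r0: "(0::complex) \<in> ball 0 (2*r)" using r by simp
  have DL: "((\<lambda>z. D (x0 + z *s v) h) has_field_derivative L h) (at 0)" for h
    unfolding L_def by (rule holomorphic_derivI[OF hol2 open_ball r0])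
  have ev: "eventually (\<lambda>z. x0 + z *s v \<in> U) (nhds 0)"
  proof (rule eventually_nhds_in_open[OF open_ball r0, THEN eventually_mono])
    fix z :: complex assume "z \<in> ball 0 (2*r)"
    then show "x0 + z *s v \<in> U" using inU zin[of z "6*r"] r by simp
  qed
  have Ladd: "L (a + b) = L a + L b" for a b
  proof -
    have "((\<lambda>z. D (x0 + z *s v) a + D (x0 + z *s v) b) has_field_derivative L a + L b) (at 0)"
      by (intro DERIV_add DL)
    then have "((\<lambda>z. D (x0 + z *s v) (a + b)) has_field_derivative L a + L b) (at 0)"
      by (rule DERIV_cong_ev[THEN iffD2, rotated 3])
         (use ev add in \<open>auto elim!: eventually_mono\<close>)
    then show ?thesis using DL DERIV_unique by blast
  qed
  have Lscal: "L (c *s a) = c * L a" for a c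
  proof -
    have "((\<lambda>z. c * D (x0 + z *s v) a) has_field_derivative c * L a) (at 0)"
      by (intro DERIV_cmult DL)
    then have "((\<lambda>z. D (x0 + z *s v) (c *s a)) has_field_derivative c * L a) (at 0)"
      by (rule DERIV_cong_ev[THEN iffD2, rotated 3])
         (use ev lin in \<open>auto elim!: eventually_mono\<close>)
    then show ?thesis using DL DERIV_unique by blast
  qed
  have "linear L"
  proof (rule linearI)
    show "L (t *\<^sub>R a) = t *\<^sub>R L a" for t a
      unfolding scal Lscal by (simp add: scaleR_conv_of_real)
  qed (rule Ladd)
  then have bl: "bounded_linear L" by (rule linear_conv_bounded_linear[THEN iffD1])
  have main: "cmod (pderiv_at j f (x0+h) - pderiv_at j f x0 - L h) \<le> C / r * norm h ^ 2"
    if h: "norm h \<le> r" for h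
  proof -
    define G where "G z = f (x0 + h + z *s v) - f (x0 + z *s v) - D (x0 + z *s v) h" for z
    have xh: "x0 + h \<in> cball x0 (2*r)" using h r by (simp add: dist_norm)
    have Ghol: "G holomorphic_on ball 0 (2*r)"
      unfolding G_def using xh r by (intro holomorphic_intros hol1 hol2) auto
    have xhU: "x0 + h \<in> U" using xh inU r by simp
    have G': "(G has_field_derivative D (x0+h) v - D x0 v - L h) (at 0)"
      unfolding G_def
      using line[of "x0+h" 0] line[of x0 0] xhU x0
      by (intro DERIV_diff DL) auto
    have "cmod ((deriv ^^ 1) G 0) \<le> fact 1 * (C * norm h ^ 2) / r ^ 1"
    proof (rule Cauchy_inequality)
      show "G holomorphic_on ball 0 r" using Ghol r by (auto elim!: holomorphic_on_subset)
      show "continuous_on (cball 0 r) G"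
        using holomorphic_on_imp_continuous_on[OF Ghol] r by (auto elim!: continuous_on_subset)
      fix z assume "cmod (0 - z) = r"
      then have "x0 + z *s v \<in> cball x0 (3*r)" using zin[of z "3*r"] r by simp
      from T[OF this h] show "cmod (G z) \<le> C * norm h ^ 2"
        by (simp add: G_def algebra_simps)
    qed (use r in simp)
    moreover have "deriv G 0 = D (x0+h) v - D x0 v - L h" by (rule DERIV_imp_deriv[OF G'])
    moreover have "pderiv_at j f (x0+h) = D (x0+h) v" "pderiv_at j f x0 = D x0 v"
      unfolding v_def using pderiv_at_eq D lin xhU x0 by blast+
    ultimately show ?thesis by simp
  qed
  have "(pderiv_at j f has_derivative L) (at x0)"
    unfolding has_derivative_at_alt
  proof (intro conjI bl allI impI)
    fix ee :: real assume ee: "ee > 0"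
    define K where "K = C / r + 1"
    have K: "K > 0" using C0 r by (simp add: K_def add_nonneg_pos)
    show "\<exists>d>0. \<forall>y. norm (y - x0) < d \<longrightarrow>
       cmod (pderiv_at j f y - pderiv_at j f x0 - L (y - x0)) \<le> ee * norm (y - x0)"
    proof (intro exI[of _ "min r (ee / K)"] conjI allI impI)
      show "0 < min r (ee / K)" using r ee K by simp
      fix y assume y: "norm (y - x0) < min r (ee / K)"
      have "cmod (pderiv_at j f y - pderiv_at j f x0 - L (y - x0)) \<le> C / r * norm (y - x0)^2"
        using main[of "y - x0"] y by simp
      also have "\<dots> \<le> K * norm (y - x0) * norm (y - x0)"
        unfolding power2_eq_square mult.assoc[symmetric] by (intro mult_right_mono) (auto simp: K_def)
      also have "\<dots> \<le> ee * norm (y - x0)"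
        using y K by (intro mult_right_mono) (auto simp: field_simps)
      finally show "cmod (pderiv_at j f y - pderiv_at j f x0 - L (y - x0)) \<le> ee * norm (y - x0)" .
    qed
  qed
  then show ?thesis unfolding cdifferentiable_at_def using Lscal by blast
qed

lemma cdifferentiable_const: "cdifferentiable_at (\<lambda>_. c) x"
  unfolding cdifferentiable_at_def by (intro exI[of _ "\<lambda>_. 0"]) auto

lemma cdifferentiable_coord: "cdifferentiable_at (\<lambda>x. x $ j) x"
  unfolding cdifferentiable_at_def
  by (intro exI[of _ "\<lambda>x. x $ j"])
     (auto intro: bounded_linear_imp_has_derivative bounded_linear_vec_nth)

lemma cdifferentiable_add:
  "cdifferentiable_at f x \<Longrightarrow> cdifferentiable_at g x \<Longrightarrow> cdifferentiable_at (\<lambda>x. f x + g x) x"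
  unfolding cdifferentiable_at_def
  apply (elim exE conjE)
  subgoal for A B
    by (intro exI[of _ "\<lambda>v. A v + B v"]) (auto intro: has_derivative_add simp: algebra_simps)
  done

lemma cdifferentiable_mult:
  "cdifferentiable_at f x \<Longrightarrow> cdifferentiable_at g x \<Longrightarrow> cdifferentiable_at (\<lambda>x. f x * g x) x"
  unfolding cdifferentiable_at_def
  apply (elim exE conjE)
  subgoal for A B
    by (rule exI[of _ "\<lambda>v. f x * B v + A v * g x"], rule conjI, erule (1) has_derivative_mult)
       (auto simp: algebra_simps)
  done

lemma holomorphic_near_0_add:
  assumes "holomorphic_near_0 f" "holomorphic_near_0 g"
  shows "holomorphic_near_0 (\<lambda>x. f x + g x)"
proof -
  from assms obtain U V where "open U" "0 \<in> U" "\<forall>x\<in>U. cdifferentiable_at f x"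
    "open V" "0 \<in> V" "\<forall>x\<in>V. cdifferentiable_at g x"
    unfolding holomorphic_near_0_def by metis
  then show ?thesis unfolding holomorphic_near_0_def
    by (intro exI[of _ "U \<inter> V"]) (auto intro: cdifferentiable_add)
qed

lemma holomorphic_near_0_mult:
  assumes "holomorphic_near_0 f" "holomorphic_near_0 g"
  shows "holomorphic_near_0 (\<lambda>x. f x * g x)"
proof -
  from assms obtain U V where "open U" "0 \<in> U" "\<forall>x\<in>U. cdifferentiable_at f x"
    "open V" "0 \<in> V" "\<forall>x\<in>V. cdifferentiable_at g x"
    unfolding holomorphic_near_0_def by metis
  then show ?thesis unfolding holomorphic_near_0_def
    by (intro exI[of _ "U \<inter> V"]) (auto intro: cdifferentiable_mult)
qed

lemma holomorphic_near_0_const: "holomorphic_near_0 (\<lambda>_. c)"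
  unfolding holomorphic_near_0_def by (intro exI[of _ UNIV]) (auto intro: cdifferentiable_const)

lemma holomorphic_near_0_coord: "holomorphic_near_0 (\<lambda>x. x $ j)"
  unfolding holomorphic_near_0_def by (intro exI[of _ UNIV]) (auto intro: cdifferentiable_coord)

lemma holomorphic_near_0_uminus:
  "holomorphic_near_0 f \<Longrightarrow> holomorphic_near_0 (\<lambda>x. - f x)"
  using holomorphic_near_0_mult[OF holomorphic_near_0_const[of "-1"]] by simp

lemma holomorphic_near_0_pderiv_at:
  "holomorphic_near_0 f \<Longrightarrow> holomorphic_near_0 (pderiv_at j f)"
  unfolding holomorphic_near_0_def using cdifferentiable_pderiv_at by metis

lemma pderiv_at_add:
  "cdifferentiable_at f x \<Longrightarrow> cdifferentiable_at g x \<Longrightarrow>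
     pderiv_at j (\<lambda>x. f x + g x) x = pderiv_at j f x + pderiv_at j g x"
  unfolding cdifferentiable_at_def
  apply (elim exE conjE)
  subgoal for A B
    using pderiv_at_eq[of f A x j] pderiv_at_eq[of g B x j]
    by (subst pderiv_at_eq[where A="\<lambda>v. A v + B v"])
       (auto intro: has_derivative_add simp: algebra_simps)
  done

lemma pderiv_at_mult:
  "cdifferentiable_at f x \<Longrightarrow> cdifferentiable_at g x \<Longrightarrow>
     pderiv_at j (\<lambda>x. f x * g x) x = pderiv_at j f x * g x + f x * pderiv_at j g x"
  unfolding cdifferentiable_at_def
  apply (elim exE conjE)
  subgoal for A B
    using pderiv_at_eq[of f A x j] pderiv_at_eq[of g B x j]
    by (subst pderiv_at_eq[OF has_derivative_mult[of f A x UNIV g B]]) (auto simp: algebra_simps)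
  done

lemma holomorphic_near_0_eventually:
  "holomorphic_near_0 f \<Longrightarrow> eventually (cdifferentiable_at f) (nhds 0)"
  unfolding holomorphic_near_0_def eventually_nhds by blast

lemma pderiv_at_cong_ev:
  assumes "eventually (\<lambda>x. f x = g x) (nhds x)"
  shows "pderiv_at j f x = pderiv_at j g x"
  unfolding pderiv_at_def
proof (rule deriv_cong_ev)
  have "isCont (\<lambda>z. x + z *s axis j 1) 0"
    by (intro isCont_add continuous_const linear_continuous_at bounded_linear_smult_left)
  then have "((\<lambda>z. x + z *s axis j 1) \<longlongrightarrow> x + 0 *s axis j 1) (nhds 0)"
    using tendsto_at_iff_tendsto_nhds[of "\<lambda>z. x + z *s axis j 1" 0] by (simp add: isCont_def)
  then have "filterlim (\<lambda>z. x + z *s axis j 1) (nhds x) (nhds 0)" by simp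
  then show "\<forall>\<^sub>F z in nhds 0. f (x + z *s axis j 1) = g (x + z *s axis j 1)"
    by (rule eventually_compose_filterlim[OF assms])
qed simp

quotient_type 'n germ = "complex^'n \<Rightarrow> complex" / partial: germ_eq
proof (rule part_equivpI)
  show "\<exists>f. germ_eq f f" using holomorphic_near_0_const by (auto simp: germ_eq_def)
  show "symp germ_eq" by (auto simp: symp_def germ_eq_def elim: eventually_mono)
  show "transp germ_eq" by (auto simp: transp_def germ_eq_def elim: eventually_elim2)
qed

lemma germ_eq_reflI: "holomorphic_near_0 f \<Longrightarrow> germ_eq f f"
  by (simp add: germ_eq_def)

lemma germ_eq_refl_iff: "germ_eq f f \<longleftrightarrow> holomorphic_near_0 f"
  by (simp add: germ_eq_def)

lemmas holomorphic_near_0_intros =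
  holomorphic_near_0_add holomorphic_near_0_mult holomorphic_near_0_const
  holomorphic_near_0_coord holomorphic_near_0_uminus holomorphic_near_0_pderiv_at

instantiation germ :: (finite) comm_ring_1
begin

lift_definition zero_germ :: "'a germ" is "\<lambda>_. 0"
  by (auto simp: germ_eq_def intro: holomorphic_near_0_intros)
lift_definition one_germ :: "'a germ" is "\<lambda>_. 1"
  by (auto simp: germ_eq_def intro: holomorphic_near_0_intros)
lift_definition plus_germ :: "'a germ \<Rightarrow> 'a germ \<Rightarrow> 'a germ" is "\<lambda>f g x. f x + g x"
  by (auto simp: germ_eq_def intro: holomorphic_near_0_intros elim: eventually_elim2)
lift_definition times_germ :: "'a germ \<Rightarrow> 'a germ \<Rightarrow> 'a germ" is "\<lambda>f g x. f x * g x"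
  by (auto simp: germ_eq_def intro: holomorphic_near_0_intros elim: eventually_elim2)
lift_definition uminus_germ :: "'a germ \<Rightarrow> 'a germ" is "\<lambda>f x. - f x"
  by (auto simp: germ_eq_def intro: holomorphic_near_0_intros elim: eventually_mono)
definition minus_germ :: "'a germ \<Rightarrow> 'a germ \<Rightarrow> 'a germ" where "minus_germ f g = f + - g"

instance
proof
  fix a b c :: "'a germ"
  show "a + b + c = a + (b + c)" "a + b = b + a" "0 + a = a" "- a + a = 0" "1 * a = a"
    "a * b * c = a * (b * c)" "a * b = b * a" "(a + b) * c = a * c + b * c"
    by (transfer, auto simp: germ_eq_def algebra_simps intro!: holomorphic_near_0_intros)+
  show "a - b = a + - b" by (rule minus_germ_def)
  show "(0 :: 'a germ) \<noteq> 1"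
    by transfer (auto simp: germ_eq_def dest: eventually_nhds_x_imp_x)
qed

end

lift_definition germ_var :: "'n \<Rightarrow> ('n::finite) germ" is "\<lambda>j x. x $ j"
  by (auto simp: germ_eq_def intro: holomorphic_near_0_intros)

lift_definition germ_pderiv :: "'n \<Rightarrow> ('n::finite) germ \<Rightarrow> 'n germ" is pderiv_at
proof -
  fix j :: 'n and f g :: "complex^'n \<Rightarrow> complex"
  assume fg: "germ_eq f g"
  then have "eventually (\<lambda>x. eventually (\<lambda>y. f y = g y) (nhds x)) (nhds 0)"
    by (simp add: germ_eq_def eventually_eventually)
  then have "eventually (\<lambda>x. pderiv_at j f x = pderiv_at j g x) (nhds 0)"
    by eventually_elim (rule pderiv_at_cong_ev)
  with fg show "germ_eq (pderiv_at j f) (pderiv_at j g)"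
    by (auto simp: germ_eq_def intro: holomorphic_near_0_intros)
qed

lemma germ_pderiv_0: "germ_pderiv j 0 = 0"
  by transfer (auto simp: germ_eq_def pderiv_at_def intro!: holomorphic_near_0_intros)

lemma germ_pderiv_add: "germ_pderiv j (f + g) = germ_pderiv j f + germ_pderiv j g"
proof transfer
  fix j :: 'a and f g :: "complex^'a \<Rightarrow> complex"
  assume "germ_eq f f" "germ_eq g g"
  then have h: "holomorphic_near_0 f" "holomorphic_near_0 g" by (simp_all add: germ_eq_refl_iff)
  have "eventually (\<lambda>x. pderiv_at j (\<lambda>x. f x + g x) x = pderiv_at j f x + pderiv_at j g x) (nhds 0)"
    using h[THEN holomorphic_near_0_eventually] by eventually_elim (rule pderiv_at_add)
  then show "germ_eq (pderiv_at j (\<lambda>x. f x + g x)) (\<lambda>x. pderiv_at j f x + pderiv_at j g x)"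
    using h by (auto simp: germ_eq_def intro!: holomorphic_near_0_intros)
qed

lemma germ_pderiv_mult: "germ_pderiv j (f * g) = germ_pderiv j f * g + f * germ_pderiv j g"
proof transfer
  fix j :: 'a and f g :: "complex^'a \<Rightarrow> complex"
  assume "germ_eq f f" "germ_eq g g"
  then have h: "holomorphic_near_0 f" "holomorphic_near_0 g" by (simp_all add: germ_eq_refl_iff)
  have "eventually (\<lambda>x. pderiv_at j (\<lambda>x. f x * g x) x
          = pderiv_at j f x * g x + f x * pderiv_at j g x) (nhds 0)"
    using h[THEN holomorphic_near_0_eventually] by eventually_elim (rule pderiv_at_mult)
  then show "germ_eq (pderiv_at j (\<lambda>x. f x * g x))
               (\<lambda>x. pderiv_at j f x * g x + f x * pderiv_at j g x)"
    using h by (auto simp: germ_eq_def intro!: holomorphic_near_0_intros)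
qed

definition germ_ring :: "('n::finite) germ ring" where
  "germ_ring = \<lparr>carrier = UNIV, mult = (*), one = 1, zero = 0, add = (+)\<rparr>"

lemma germ_ring_simps [simp]:
  "carrier germ_ring = UNIV" "x \<otimes>\<^bsub>germ_ring\<^esub> y = x * y" "\<one>\<^bsub>germ_ring\<^esub> = 1"
  "\<zero>\<^bsub>germ_ring\<^esub> = 0" "x \<oplus>\<^bsub>germ_ring\<^esub> y = x + y"
  by (simp_all add: germ_ring_def)

lemma cring_germ_ring: "cring (germ_ring :: ('n::finite) germ ring)"
proof (rule cringI)
  show "abelian_group (germ_ring :: 'n germ ring)"
    by (rule abelian_groupI) (auto simp: algebra_simps intro: exI[of _ "- _"] add.left_inverse)
  show "Group.comm_monoid (germ_ring :: 'n germ ring)"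
    by (rule comm_monoidI) (auto simp: algebra_simps)
qed (auto simp: algebra_simps)

definition max_ideal :: "('n::finite) germ set" where
  "max_ideal = genideal germ_ring (range germ_var)"


section \<open>Tjurina ideals and antiderivatives\<close>

definition tjurina :: "('n::finite) germ \<Rightarrow> 'n germ set" where
  "tjurina f = genideal germ_ring (insert f (range (\<lambda>j. germ_pderiv j f)))"

text \<open>The sum of the ideals \<open>T(g)\<close> over \<open>g \<in> G\<close>. It only depends on the ideal generated by \<open>G\<close>
  (\<open>tjurina_set_genideal\<close> below), so for an ideal \<open>J\<close> the set \<open>tjurina_set J\<close> is
  \<open>T(g\<^sub>1) + \<dots> + T(g\<^sub>q)\<close> for every system of generators \<open>g\<^sub>1, \<dots>, g\<^sub>q\<close> of \<open>J\<close>.\<close>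

definition tjurina_set :: "('n::finite) germ set \<Rightarrow> 'n germ set" where
  "tjurina_set G = genideal germ_ring (\<Union>g\<in>G. tjurina g)"

definition antiderivs :: "('n::finite) germ set \<Rightarrow> 'n germ set" where
  "antiderivs I = {f. tjurina f \<subseteq> I}"

definition T_full :: "('n::finite) germ set \<Rightarrow> bool" where
  "T_full I \<longleftrightarrow> I = tjurina_set (antiderivs I)"

lemma tjurina_subset_iff:
  assumes "ideal I germ_ring"
  shows "tjurina f \<subseteq> I \<longleftrightarrow> f \<in> I \<and> (\<forall>j. germ_pderiv j f \<in> I)"
proof -
  interpret cring germ_ring by (rule cring_germ_ring)
  show ?thesis unfolding tjurina_def using assms
    by (subst Idl_subset_ideal) auto
qed

lemma ideal_antiderivs:
  assumes "ideal I germ_ring"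
  shows "ideal (antiderivs I) germ_ring"
proof -
  interpret R: cring germ_ring by (rule cring_germ_ring)
  interpret I: ideal I germ_ring by (rule assms)
  have mult: "x * y \<in> I" if "x \<in> I" for x y
    using I.I_r_closed[OF that, of y] by simp
  have add: "x + y \<in> I" if "x \<in> I" "y \<in> I" for x y
    using I.a_closed[OF that] by simp
  have closed: "a * x \<in> antiderivs I" if "a \<in> antiderivs I" for a x
    using that unfolding antiderivs_def tjurina_subset_iff[OF assms] mem_Collect_eq germ_pderiv_mult
    by (auto intro!: add mult)
  show ?thesis
  proof (rule idealI)
    show "ring germ_ring" by (rule R.ring_axioms)
    show "subgroup (antiderivs I) (add_monoid germ_ring)"
    proof (rule group.subgroupI)
      show "group (add_monoid germ_ring)" by (rule R.a_group)
      have "0 \<in> I" using I.zero_closed by simp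
      then have "0 \<in> antiderivs I"
        unfolding antiderivs_def tjurina_subset_iff[OF assms] by (simp add: germ_pderiv_0)
      then show "antiderivs I \<noteq> {}" by auto
      fix a b assume a: "a \<in> antiderivs I" and b: "b \<in> antiderivs I"
      have "a + b \<in> antiderivs I"
        using a b unfolding antiderivs_def tjurina_subset_iff[OF assms] mem_Collect_eq germ_pderiv_add
        by (auto intro!: add)
      then show "a \<otimes>\<^bsub>add_monoid germ_ring\<^esub> b \<in> antiderivs I" by simp
      have "\<ominus>\<^bsub>germ_ring\<^esub> a = - a" by (rule R.minus_equality) auto
      then show "inv\<^bsub>add_monoid germ_ring\<^esub> a \<in> antiderivs I"
        using closed[OF a, of "-1"] by (simp add: a_inv_def)
    qed simp
  qed (use closed in \<open>auto simp: mult.commute\<close>)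
qed

lemma tjurina_set_genideal: "tjurina_set (genideal germ_ring G) = tjurina_set G"
proof -
  interpret R: cring germ_ring by (rule cring_germ_ring)
  have id: "ideal (tjurina_set G) germ_ring" for G :: "'a germ set"
    unfolding tjurina_set_def by (rule R.genideal_ideal) simp
  have sub: "tjurina g \<subseteq> tjurina_set G" if "g \<in> G" for g and G :: "'a germ set"
    using R.genideal_self[of "\<Union>g\<in>G. tjurina g"] that unfolding tjurina_set_def by auto
  have least: "tjurina_set G \<subseteq> K" if "ideal K germ_ring" "\<And>g. g \<in> G \<Longrightarrow> tjurina g \<subseteq> K"
    for G K :: "'a germ set"
    unfolding tjurina_set_def by (rule R.genideal_minimal) (use that in auto)
  have "genideal germ_ring G \<subseteq> antiderivs (tjurina_set G)"
    by (rule R.genideal_minimal[OF ideal_antiderivs[OF id]]) (auto simp: antiderivs_def dest: sub)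
  then have "tjurina_set (genideal germ_ring G) \<subseteq> tjurina_set G"
    by (intro least id) (auto simp: antiderivs_def)
  moreover have "tjurina_set G \<subseteq> tjurina_set (genideal germ_ring G)"
    using R.genideal_self[of G] by (intro least id sub) auto
  ultimately show ?thesis by blast
qed


section \<open>Polynomials over the ring of germs and \<open>Proj\<close>\<close>

text \<open>A polynomial in the indeterminates \<open>\<alpha>\<^sub>0, \<dots>, \<alpha>\<^bsub>q-1\<^esub>\<close> maps the monomial
  \<open>m :: nat \<Rightarrow>\<^sub>0 nat\<close> (the exponents) to its coefficient.\<close>

type_synonym 'a mpoly = "(nat \<Rightarrow>\<^sub>0 nat) \<Rightarrow>\<^sub>0 'a"

definition poly_ring :: "nat \<Rightarrow> ('a::comm_ring_1) mpoly ring" where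
  "poly_ring q = \<lparr>carrier = {p. \<forall>m\<in>Poly_Mapping.keys p. Poly_Mapping.keys m \<subseteq> {..<q}},
     mult = (*), one = 1, zero = 0, add = (+)\<rparr>"

lemma poly_ring_simps [simp]:
  "p \<in> carrier (poly_ring q) \<longleftrightarrow>
     (\<forall>m\<in>Poly_Mapping.keys p. Poly_Mapping.keys m \<subseteq> {..<q})"
  "x \<otimes>\<^bsub>poly_ring q\<^esub> y = x * y" "\<one>\<^bsub>poly_ring q\<^esub> = 1"
  "\<zero>\<^bsub>poly_ring q\<^esub> = 0" "x \<oplus>\<^bsub>poly_ring q\<^esub> y = x + y"
  by (simp_all add: poly_ring_def)

lemma poly_ring_add_closed:
  "a \<in> carrier (poly_ring q) \<Longrightarrow> b \<in> carrier (poly_ring q) \<Longrightarrow> a + b \<in> carrier (poly_ring q)"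
  using Poly_Mapping.keys_add[of a b] by (simp add: subset_iff Ball_def) blast

lemma poly_ring_mult_closed:
  assumes "a \<in> carrier (poly_ring q)" "b \<in> carrier (poly_ring q)"
  shows "a * b \<in> carrier (poly_ring q)"
  unfolding poly_ring_simps
proof
  fix m assume "m \<in> Poly_Mapping.keys (a * b)"
  then obtain s t where "m = s + t" "s \<in> Poly_Mapping.keys a" "t \<in> Poly_Mapping.keys b"
    using keys_mult[of a b] by blast
  then show "Poly_Mapping.keys m \<subseteq> {..<q}"
    using Poly_Mapping.keys_add[of s t] assms unfolding poly_ring_simps by blast
qed

lemma cring_poly_ring: "cring (poly_ring q :: ('a::comm_ring_1) mpoly ring)"
proof (rule cringI)
  have z: "0 \<in> carrier (poly_ring q :: 'a mpoly ring)" by simp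
  have o: "1 \<in> carrier (poly_ring q :: 'a mpoly ring)" by simp
  have neg: "\<exists>b\<in>carrier (poly_ring q). b + a = 0" if "a \<in> carrier (poly_ring q)"
    for a :: "'a mpoly"
    by (rule bexI[of _ "- a"]) (use that in auto)
  show "abelian_group (poly_ring q :: 'a mpoly ring)"
    by (rule abelian_groupI; (unfold poly_ring_simps(2-))?)
       (use poly_ring_add_closed z neg in \<open>auto simp only: ac_simps add_0_left add_0_right\<close>)
  show "Group.comm_monoid (poly_ring q :: 'a mpoly ring)"
    by (rule comm_monoidI; (unfold poly_ring_simps(2-))?)
       (use poly_ring_mult_closed o in \<open>auto simp only: ac_simps mult_1_left mult_1_right\<close>)
qed (auto simp: algebra_simps)

definition const_poly :: "'a \<Rightarrow> ('a::comm_ring_1) mpoly" where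
  "const_poly c = Poly_Mapping.single 0 c"

definition var_poly :: "nat \<Rightarrow> ('a::comm_ring_1) mpoly" where
  "var_poly i = Poly_Mapping.single (Poly_Mapping.single i 1) 1"

definition monomial_deg :: "(nat \<Rightarrow>\<^sub>0 nat) \<Rightarrow> nat" where
  "monomial_deg m = (\<Sum>i\<in>Poly_Mapping.keys m. Poly_Mapping.lookup m i)"

definition hom_component :: "nat \<Rightarrow> ('a::comm_ring_1) mpoly \<Rightarrow> 'a mpoly" where
  "hom_component d p = Poly_Mapping.mapp (\<lambda>m c. if monomial_deg m = d then c else 0) p"

definition homogeneous_set :: "('a::comm_ring_1) mpoly set \<Rightarrow> bool" where
  "homogeneous_set P \<longleftrightarrow> (\<forall>p\<in>P. \<forall>d. hom_component d p \<in> P)"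

definition irrelevant_ideal :: "nat \<Rightarrow> ('a::comm_ring_1) mpoly set" where
  "irrelevant_ideal q = {p \<in> carrier (poly_ring q). hom_component 0 p = 0}"

text \<open>The points of \<open>Proj\<close>; the closed sets are the vanishing sets of (homogeneous) ideals.\<close>

definition Proj :: "nat \<Rightarrow> ('a::comm_ring_1) mpoly set set" where
  "Proj q = {P. primeideal P (poly_ring q) \<and> homogeneous_set P \<and> \<not> irrelevant_ideal q \<subseteq> P}"

definition Proj_vanishing :: "nat \<Rightarrow> ('a::comm_ring_1) mpoly set \<Rightarrow> 'a mpoly set set" where
  "Proj_vanishing q A = {P \<in> Proj q. A \<subseteq> P}"

text \<open>The structure morphism \<open>Proj \<rightarrow> Spec\<close> on points.\<close>

definition Proj_to_Spec :: "('a::comm_ring_1) mpoly set \<Rightarrow> 'a set" where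
  "Proj_to_Spec P = {c. const_poly c \<in> P}"

definition colon_ideal :: "nat \<Rightarrow> ('a::comm_ring_1) mpoly set \<Rightarrow> 'a mpoly set \<Rightarrow> 'a mpoly set" where
  "colon_ideal q A B = {p \<in> carrier (poly_ring q). \<forall>b\<in>B. p * b \<in> A}"


section \<open>\<open>T\<close>-dependence\<close>

definition sigma_poly :: "nat \<Rightarrow> (nat \<Rightarrow> ('n::finite) germ) \<Rightarrow> 'n germ mpoly" where
  "sigma_poly q g = (\<Sum>i<q. const_poly (g i) * var_poly i)"

text \<open>The derivation of the polynomial ring extending \<open>\<partial>/\<partial>x\<^sub>j\<close> and killing the \<open>\<alpha>\<^sub>i\<close> acts on the
  coefficients.\<close>

definition tjurina_sigma :: "nat \<Rightarrow> (nat \<Rightarrow> ('n::finite) germ) \<Rightarrow> 'n germ mpoly set" where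
  "tjurina_sigma q g = genideal (poly_ring q)
     (insert (sigma_poly q g) (range (\<lambda>j. Poly_Mapping.map (germ_pderiv j) (sigma_poly q g))))"

definition extended_tjurina :: "nat \<Rightarrow> ('n::finite) germ set \<Rightarrow> 'n germ mpoly set" where
  "extended_tjurina q J = genideal (poly_ring q) (const_poly ` tjurina_set J)"

text \<open>Both homogeneous ideals are finitely generated when \<open>J\<close> is, so forming their colon ideal
  commutes with passing to the associated ideal sheaves.\<close>

definition supp_F :: "nat \<Rightarrow> (nat \<Rightarrow> ('n::finite) germ) \<Rightarrow> 'n germ mpoly set set" where
  "supp_F q g = Proj_vanishing q
     (colon_ideal q (tjurina_sigma q g)
       (extended_tjurina q (genideal germ_ring (g ` {..<q}))))"

text \<open>The condition may depend on the system of generators: if \<open>g\<close> and \<open>h\<close> are two germs in disjoint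
  sets of variables, both not lying in their Jacobian ideals, and \<open>u\<close> is a further variable, it can
  hold for \<open>g, h, u g\<close> and fail for \<open>g, h\<close>. The ideal is called \<open>T\<close>-dependent if the condition holds
  for some finite system of generators.\<close>

definition T_dependent :: "('n::finite) germ set \<Rightarrow> bool" where
  "T_dependent J \<longleftrightarrow>
     (\<exists>q g. q \<ge> 1 \<and> J = genideal germ_ring (g ` {..<q}) \<and>
        \<not> {P \<in> Proj q. Proj_to_Spec P = max_ideal} \<subseteq> supp_F q g)"

end

theory Submission
  imports Defs "HOL-Complex_Analysis.Complex_Singularities"
begin

text \<open>If \<open>I = T(\<Delta>(I))\<close> and some \<open>h\<close> in the colon ideal has a coefficient that does not vanish at \<open>0\<close>,
  then \<open>h(0, b) \<noteq> 0\<close> for some \<open>b \<in> \<complex>\<^sup>q\<close>. Substituting \<open>\<alpha> = b\<close> turns \<open>h T(J) \<subseteq> T(\<sigma>)\<close> into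
  \<open>(unit) I \<subseteq> T(f)\<close> with \<open>f = \<Sum> b\<^sub>i g\<^sub>i \<in> \<Delta>(I)\<close>, so \<open>I = T(f)\<close>.

  Conversely, if \<open>I = T(f)\<close>, take generators of \<open>\<Delta>(I)\<close> the first of which is \<open>f\<close>. At the point
  \<open>\<alpha> = (1, 0, \<dots>, 0)\<close> over \<open>\<mm>\<close> the generators of \<open>T(\<sigma>)\<close> are congruent to those of \<open>T(f)\<close>, and
  Nakayama's lemma gives \<open>T(\<sigma>) = \<pi>\<^sup>*T(f)\<close> there. The finitely many generators exist
  because the ring of germs is Noetherian (Rueckert), which rests on Weierstrass division. The
  quotient and remainder are constructed by iterating the division by \<open>x\<^sub>j\<^sup>d\<close>, a contraction on a
  thin tube around the \<open>x\<^sub>j\<close>-axis.\<close>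

section \<open>Complex differentiable functions\<close>

text \<open>Division with remainder alone carries the Noetherian property: modulo one regular
  element of an ideal, every element is a polynomial of degree below \<open>d\<close> in one
  variable, and these polynomials form a finitely generated module over the germs in one variable
  fewer. All elements of an ideal may vanish on the chosen axis, hence the linear changes of
  coordinates. The tube must be thin because g - x_j^d is known to vanish on the axis only, while
  the iteration contracts once this difference is at most (1/2)(\<rho>/4)^d; so the radius \<rho>
  along the axis is fixed first and the transversal radius last. On the side of Proj, stalks and
  localizations are replaced by single witnesses: a point \<open>P\<close> lies outside
  \<open>supp_F\<close> exactly when some polynomial s outside \<open>P\<close> satisfies s T(J)
  \<subseteq> T(\<sigma>). One direction consumes such an s, the other produces it by elimination
  over the polynomial ring.\<close>

lemma cdifferentiable_compose:
  assumes "cdifferentiable_at f (A x)" "(A has_derivative B) (at x)" "\<And>c v. B (c *s v) = c *s B v"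
  shows "cdifferentiable_at (\<lambda>x. f (A x)) x"
proof -
  from assms(1) obtain D where D: "(f has_derivative D) (at (A x))" "\<And>c v. D (c *s v) = c * D v"
    unfolding cdifferentiable_at_def by blast
  show ?thesis unfolding cdifferentiable_at_def
    using has_derivative_compose[OF assms(2) D(1)] D(2) assms(3) by (intro exI[of _ "\<lambda>v. D (B v)"]) auto
qed

lemma cdifferentiable_inverse:
  assumes "cdifferentiable_at f x" "f x \<noteq> 0"
  shows "cdifferentiable_at (\<lambda>x. inverse (f x)) x"
proof -
  from assms(1) obtain D where D: "(f has_derivative D) (at x)" "\<And>c v. D (c *s v) = c * D v"
    unfolding cdifferentiable_at_def by blast
  show ?thesis unfolding cdifferentiable_at_def
    by (rule exI[of _ "\<lambda>h. - (inverse (f x) * D h * inverse (f x))"])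
       (use Deriv.has_derivative_inverse[OF assms(2) D(1)] D(2) in auto)
qed

lemma cdifferentiable_cong_ev:
  assumes "cdifferentiable_at f x" "eventually (\<lambda>y. f y = g y) (nhds x)"
  shows "cdifferentiable_at g x"
proof -
  from assms(1) obtain D where D: "(f has_derivative D) (at x)" "\<And>c v. D (c *s v) = c * D v"
    unfolding cdifferentiable_at_def by blast
  have "(g has_derivative D) (at x)"
    by (rule has_derivative_transform_eventually[OF D(1)])
       (use assms(2) in \<open>auto simp: eventually_at_filter dest: eventually_nhds_x_imp_x elim: eventually_mono\<close>)
  with D(2) show ?thesis unfolding cdifferentiable_at_def by blast
qed

lemma cdifferentiable_continuous: "cdifferentiable_at f x \<Longrightarrow> isCont f x"
  unfolding cdifferentiable_at_def using has_derivative_continuous by blast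

lemma cdifferentiable_line:
  "cdifferentiable_at f (x + z *s v) \<Longrightarrow> (\<lambda>z. f (x + z *s v)) field_differentiable (at z)"
  unfolding cdifferentiable_at_def field_differentiable_def using line_has_field_derivative by blast

text \<open>One-variable Cauchy inequality on the complex line through \<open>x\<close> in direction
  \<open>h\<close>. The disc has radius \<open>r / (2 * norm h)\<close>, so that its closure stays
  inside the open ball; this costs the factor 2.\<close>

lemma derivative_Cauchy_bound:
  fixes f :: "complex^'n \<Rightarrow> complex"
  assumes D: "(f has_derivative D) (at x)" "\<And>c v. D (c *s v) = c * D v"
    and f: "\<And>y. y \<in> ball x r \<Longrightarrow> cdifferentiable_at f y"
    and M: "\<And>y. y \<in> ball x r \<Longrightarrow> cmod (f y) \<le> M" and r: "r > 0"
  shows "cmod (D h) \<le> 2 * M / r * norm h"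
proof (cases "h = 0")
  case True
  then show ?thesis using D(2)[of 0 0] by simp
next
  case False
  define R where "R = r / (2 * norm h)"
  have R: "R > 0" using False r by (simp add: R_def)
  have inb: "x + z *s h \<in> ball x r" if "cmod z \<le> R" for z
  proof -
    have "cmod z * norm h \<le> R * norm h" using that by (intro mult_right_mono) auto
    then have "cmod z * norm h < r" using False r by (simp add: R_def)
    then show ?thesis by (simp add: dist_norm norm_vector_smult)
  qed
  have hol: "(\<lambda>z. f (x + z *s h)) holomorphic_on cball 0 R"
    unfolding holomorphic_on_def
    using inb f by (auto intro!: field_differentiable_at_within cdifferentiable_line)
  have "cmod ((deriv ^^ 1) (\<lambda>z. f (x + z *s h)) 0) \<le> fact 1 * M / R ^ 1"
    by (rule Cauchy_inequality)
       (use hol R inb M in \<open>auto intro: holomorphic_on_imp_continuous_on holomorphic_on_subset\<close>)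
  moreover have "deriv (\<lambda>z. f (x + z *s h)) 0 = D h"
    using line_has_field_derivative[of f D x 0 h] D by (auto intro: DERIV_imp_deriv)
  ultimately show ?thesis by (simp add: R_def mult_ac)
qed

text \<open>The Weierstrass convergence theorem in several variables. A summable bound on the
  functions yields one on the derivatives by \<open>derivative_Cauchy_bound\<close>, so the series
  may be differentiated term by term, and complex linearity passes to the sum.\<close>

lemma cdifferentiable_suminf:
  fixes f :: "nat \<Rightarrow> complex^'n \<Rightarrow> complex"
  assumes U: "open U" and f: "\<And>n x. x \<in> U \<Longrightarrow> cdifferentiable_at (f n) x"
    and M: "\<And>n x. x \<in> U \<Longrightarrow> cmod (f n x) \<le> M n" and sM: "summable M" and x: "x \<in> U"
  shows "cdifferentiable_at (\<lambda>x. suminf (\<lambda>n. f n x)) x"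
proof -
  obtain e where e: "e > 0" "ball x e \<subseteq> U" using U x open_contains_ball by blast
  \<comment> \<open>Halving leaves a ball of radius \<open>r\<close> inside \<open>U\<close> around
    every point of \<open>ball x r\<close>, so the Cauchy bound has the same constant at all these
    points.\<close>
  define r where "r = e / 2"
  have r: "r > 0" using e by (simp add: r_def)
  have sub: "ball y r \<subseteq> U" if "y \<in> ball x r" for y
  proof
    fix z assume "z \<in> ball y r"
    then show "z \<in> U" using that e(2) dist_triangle[of x z y]
      by (auto simp: r_def subset_iff)
  qed
  have inU: "y \<in> U" if "y \<in> ball x r" for y using sub[OF that] r by auto
  define D where "D n y = (SOME A. (f n has_derivative A) (at y) \<and> (\<forall>c v. A (c *s v) = c * A v))" for n y
  have "(f n has_derivative D n y) (at y) \<and> (\<forall>c v. D n y (c *s v) = c * D n y v)" if "y \<in> U" for n y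
    unfolding D_def by (rule someI_ex[OF f[OF that, unfolded cdifferentiable_at_def]])
  then have D: "\<And>n y. y \<in> U \<Longrightarrow> (f n has_derivative D n y) (at y)"
    and lin: "\<And>n y c v. y \<in> U \<Longrightarrow> D n y (c *s v) = c * D n y v" by blast+
  have bd: "cmod (D n y h) \<le> 2 * M n / r * norm h" if "y \<in> ball x r" for n y h
  proof (rule derivative_Cauchy_bound[OF D[OF inU[OF that]] lin[OF inU[OF that]] _ _ r])
    fix z assume "z \<in> ball y r"
    then have "z \<in> U" using sub[OF that] by blast
    then show "cdifferentiable_at (f n) z" "cmod (f n z) \<le> M n" by (rule f M)+
  qed
  have sb: "summable (\<lambda>n. 2 * M n / r * K)" for K
    by (rule summable_mult2[OF summable_divide[OF summable_mult[OF sM]]])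
  have sD: "summable (\<lambda>n. D n y h)" if "y \<in> ball x r" for y h
    by (rule summable_comparison_test'[OF sb, of 0]) (use bd[OF that] in auto)
  \<comment> \<open>Termwise differentiation asks for a tail estimate proportional to
    \<open>norm h\<close> and uniform in \<open>y\<close>.\<close>
  have tail: "cmod ((\<Sum>i<n. D i y h) - suminf (\<lambda>i. D i y h)) \<le> (suminf (\<lambda>i. 2 * M (i+n) / r)) * norm h"
    if y: "y \<in> ball x r" for n y h
  proof -
    have "cmod ((\<Sum>i<n. D i y h) - suminf (\<lambda>i. D i y h)) = cmod (suminf (\<lambda>i. D (i+n) y h))"
      using suminf_minus_initial_segment[OF sD[OF y], of n h]
      by (simp add: norm_minus_commute)
    also have "\<dots> \<le> (suminf (\<lambda>i. 2 * M (i+n) / r * norm h))"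
      by (rule norm_suminf_le) (use bd[OF y] sb summable_iff_shift[of "\<lambda>n. 2 * M n / r * norm h" n] in auto)
    also have "\<dots> = (suminf (\<lambda>i. 2 * M (i+n) / r)) * norm h"
      using sb[of 1] summable_iff_shift[of "\<lambda>n. 2 * M n / r" n] by (subst suminf_mult2) auto
    finally show ?thesis .
  qed
  have lim: "(\<lambda>n. suminf (\<lambda>i. 2 * M (i+n) / r)) \<longlonglongrightarrow> 0"
    using suminf_exist_split2[of "\<lambda>n. 2 * M n / r"] sb[of 1] by simp
  have sf: "summable (\<lambda>n. f n y)" if "y \<in> U" for y
    by (rule summable_comparison_test'[OF sM, of 0]) (use M[OF that] in auto)
  have xin: "x \<in> ball x r" using r by simp
  have "\<exists>g. \<forall>y\<in>ball x r. (\<lambda>n. f n y) sums g y \<and> (g has_derivative (\<lambda>h. suminf (\<lambda>i. D i y h))) (at y within ball x r)"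
  proof (rule has_derivative_series[where x=x and l="suminf (\<lambda>n. f n x)"])
    show "(f n has_derivative D n y) (at y within ball x r)" if "y \<in> ball x r" for n y
      using D[OF inU[OF that]] has_derivative_at_withinI by blast
    show "(\<lambda>n. f n x) sums (suminf (\<lambda>n. f n x))" using sf[OF x] by (rule summable_sums)
    fix ee :: real assume "ee > 0"
    with lim have "eventually (\<lambda>n. (suminf (\<lambda>i. 2 * M (i+n) / r)) < ee) sequentially"
      by (rule order_tendstoD(2))
    then show "\<forall>\<^sub>F n in sequentially. \<forall>y\<in>ball x r. \<forall>h.
        cmod ((\<Sum>i<n. D i y h) - suminf (\<lambda>i. D i y h)) \<le> ee * norm h"
    proof eventually_elim
      case (elim n)
      show ?case
      proof (intro ballI allI)
        fix y h :: "complex^'n" assume "y \<in> ball x r"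
        moreover have "suminf (\<lambda>i. 2 * M (i+n) / r) * norm h \<le> ee * norm h"
          using elim by (intro mult_right_mono) auto
        ultimately show "cmod ((\<Sum>i<n. D i y h) - suminf (\<lambda>i. D i y h)) \<le> ee * norm h"
          using tail order_trans by blast
      qed
    qed
  qed (use xin in auto)
  then obtain g where g: "\<And>y. y \<in> ball x r \<Longrightarrow> (\<lambda>n. f n y) sums g y"
      "(g has_derivative (\<lambda>h. suminf (\<lambda>i. D i x h))) (at x within ball x r)" using xin by blast
  have "(g has_derivative (\<lambda>h. suminf (\<lambda>i. D i x h))) (at x)"
    using g(2) at_within_open[OF xin open_ball] by simp
  moreover have "(suminf (\<lambda>i. D i x (c *s v))) = c * (suminf (\<lambda>i. D i x v))" for c v
    using suminf_mult[OF sD[OF xin]] lin[OF x] by simp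
  ultimately have "cdifferentiable_at g x" unfolding cdifferentiable_at_def by blast
  then show ?thesis
  proof (rule cdifferentiable_cong_ev)
    have "g y = (suminf (\<lambda>n. f n y))" if "y \<in> ball x r" for y using sums_unique[OF g(1)[OF that]] .
    then show "\<forall>\<^sub>F y in nhds x. g y = (suminf (\<lambda>n. f n y))"
      using eventually_nhds_in_open[OF open_ball xin] by (auto elim: eventually_mono)
  qed
qed

section \<open>Slices in one coordinate, and tubes around a coordinate axis\<close>

definition vec_upd :: "'n \<Rightarrow> 'a \<Rightarrow> 'a^'n \<Rightarrow> 'a^'n" where
  "vec_upd j z x = (\<chi> i. if i = j then z else x $ i)"

lemma vec_upd_nth [simp]: "vec_upd j z x $ i = (if i = j then z else x $ i)"
  by (simp add: vec_upd_def)

lemma vec_upd_upd [simp]: "vec_upd j z (vec_upd j w x) = vec_upd j z x"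
  by (simp add: vec_eq_iff)

lemma vec_upd_same [simp]: "vec_upd j (x $ j) x = x"
  by (simp add: vec_eq_iff)

lemma vec_upd_0_0 [simp]: "vec_upd j 0 0 = 0"
  by (simp add: vec_eq_iff)

lemma vec_upd_eq_line: "vec_upd j z x = vec_upd j 0 x + z *s axis j (1::complex)"
  by (simp add: vec_eq_iff axis_def)

lemma cdifferentiable_vec_upd:
  fixes f :: "complex^'n \<Rightarrow> complex"
  assumes "cdifferentiable_at f (vec_upd j z x)"
  shows "(\<lambda>z. f (vec_upd j z x)) field_differentiable (at z)"
proof -
  have "(\<lambda>z. f (vec_upd j z x)) = (\<lambda>z. f (vec_upd j 0 x + z *s axis j 1))"
    by (simp flip: vec_upd_eq_line)
  then show ?thesis using cdifferentiable_line[of f "vec_upd j 0 x" z "axis j 1"] assms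
    by (simp flip: vec_upd_eq_line)
qed

lemma linear_vec_upd_0: "linear (vec_upd j 0 :: complex^'n \<Rightarrow> complex^'n)"
  by (rule linearI) (auto simp: vec_eq_iff)

lemma cdifferentiable_vec_upd_0:
  "cdifferentiable_at f (vec_upd j 0 x) \<Longrightarrow> cdifferentiable_at (\<lambda>x. f (vec_upd j 0 x)) x"
  by (rule cdifferentiable_compose[where B="vec_upd j 0"])
     (auto simp: vec_eq_iff intro!: bounded_linear_imp_has_derivative linear_vec_upd_0 linear_conv_bounded_linear[THEN iffD1])

lemma cdifferentiable_power: "cdifferentiable_at f x \<Longrightarrow> cdifferentiable_at (\<lambda>x. f x ^ k) x"
  by (induction k) (auto intro: cdifferentiable_const cdifferentiable_mult)

text \<open>The product shape makes every slice in the j-th coordinate a full disc of radius \<rho>,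
  and it allows \<open>r\<close> to shrink while \<rho> stays fixed.\<close>

definition tube :: "'n \<Rightarrow> real \<Rightarrow> real \<Rightarrow> (complex^'n) set" where
  "tube j r \<rho> = {x. cmod (x $ j) < \<rho> \<and> norm (vec_upd j 0 x) < r}"

lemma open_tube: "open (tube (j::'n::finite) r \<rho>)"
proof -
  have c: "continuous_on UNIV (vec_upd j 0 :: complex^'n \<Rightarrow> complex^'n)"
    using linear_continuous_on linear_vec_upd_0 linear_conv_bounded_linear by blast
  show ?thesis unfolding tube_def
    by (intro open_Collect_conj open_Collect_less continuous_intros c)
qed

lemma tube_upd: "x \<in> tube j r \<rho> \<Longrightarrow> cmod z < \<rho> \<Longrightarrow> vec_upd j z x \<in> tube j r \<rho>"
  by (simp add: tube_def)

lemma tube_subset_ball: "r + \<rho> \<le> R \<Longrightarrow> x \<in> tube j r \<rho> \<Longrightarrow> x \<in> ball 0 R"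
proof -
  assume a: "r + \<rho> \<le> R" "x \<in> tube j r \<rho>"
  have "norm x = norm (vec_upd j 0 x + (x $ j) *s axis j 1)"
    using vec_upd_eq_line[of j "x $ j" x] by simp
  also have "\<dots> \<le> norm (vec_upd j 0 x) + cmod (x $ j)"
    by (rule order_trans[OF norm_triangle_ineq]) (simp add: norm_vector_smult)
  finally show ?thesis using a by (simp add: tube_def)
qed

text \<open>Identifies the Taylor coefficients along a slice with partial derivatives, which are
  holomorphic in all variables. Both claims are proved together because differentiating the slice
  once more uses that the previous partial derivative is holomorphic on the tube.\<close>

lemma deriv_upd_eq_pderiv:
  fixes f :: "complex^'n \<Rightarrow> complex"
  assumes f: "\<And>x. x \<in> tube j r \<rho> \<Longrightarrow> cdifferentiable_at f x"
  shows "(\<forall>x\<in>tube j r \<rho>. cdifferentiable_at ((pderiv_at j ^^ k) f) x) \<and>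
    (\<forall>x\<in>tube j r \<rho>. \<forall>z\<in>ball 0 \<rho>. (deriv ^^ k) (\<lambda>z. f (vec_upd j z x)) z = (pderiv_at j ^^ k) f (vec_upd j z x))"
proof (induction k)
  case (Suc k)
  have c: "\<forall>x\<in>tube j r \<rho>. cdifferentiable_at ((pderiv_at j ^^ Suc k) f) x"
    using Suc cdifferentiable_pderiv_at[OF open_tube, of j r \<rho>] by auto
  have "(deriv ^^ Suc k) (\<lambda>z. f (vec_upd j z x)) z = (pderiv_at j ^^ Suc k) f (vec_upd j z x)"
    if x: "x \<in> tube j r \<rho>" and z: "z \<in> ball 0 \<rho>" for x z
  proof -
    have "(deriv ^^ Suc k) (\<lambda>z. f (vec_upd j z x)) z = deriv (\<lambda>z. (pderiv_at j ^^ k) f (vec_upd j z x)) z"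
      using Suc x z eventually_nhds_in_open[OF open_ball z] by (auto intro!: deriv_cong_ev elim!: eventually_mono)
    \<comment> \<open>The slice is recentred at \<open>z\<close>, so that it becomes a line through
      the point at which \<open>pderiv_at\<close> is taken.\<close>
    also have "(\<lambda>w. (pderiv_at j ^^ k) f (vec_upd j w x)) =
       (\<lambda>w. (pderiv_at j ^^ k) f (vec_upd j z x + (w - z) *s axis j 1))"
      by (rule ext, rule arg_cong[of _ _ "(pderiv_at j ^^ k) f"]) (simp add: vec_eq_iff axis_def)
    also have "deriv (\<lambda>w. (pderiv_at j ^^ k) f (vec_upd j z x + (w - z) *s axis j 1)) z
         = (pderiv_at j ^^ Suc k) f (vec_upd j z x)"
    proof -
      have "vec_upd j z x \<in> tube j r \<rho>" using x z by (auto intro: tube_upd)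
      with Suc obtain A where A: "((pderiv_at j ^^ k) f has_derivative A) (at (vec_upd j z x))"
        "\<And>c v. A (c *s v) = c * A v" unfolding cdifferentiable_at_def by blast
      have "((\<lambda>w. (pderiv_at j ^^ k) f (vec_upd j z x + w *s axis j 1)) has_field_derivative A (axis j 1)) (at (z - z))"
        using line_has_field_derivative[of _ A "vec_upd j z x" 0 "axis j 1"] A by simp
      then have "((\<lambda>w. (pderiv_at j ^^ k) f (vec_upd j z x + (w - z) *s axis j 1)) has_field_derivative A (axis j 1)) (at z)"
        using DERIV_shift[of "\<lambda>w. (pderiv_at j ^^ k) f (vec_upd j z x + w *s axis j 1)" "A (axis j 1)" z "- z"]
        by simp
      then show ?thesis using pderiv_at_eq[OF A] by (simp add: DERIV_imp_deriv)
    qed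
    finally show ?thesis .
  qed
  with c show ?case by blast
qed (use f in auto)

section \<open>Weierstrass division\<close>

text \<open>The quotient is the Taylor series in \<open>x $ j\<close> with its constant term dropped
  and one power of \<open>x $ j\<close> removed. Its coefficients are partial derivatives evaluated
  at \<open>vec_upd j 0 x\<close>, hence holomorphic in the other variables.\<close>

lemma tube_divide:
  fixes f :: "complex^'n \<Rightarrow> complex"
  assumes f: "\<And>x. x \<in> tube j r \<rho> \<Longrightarrow> cdifferentiable_at f x"
    and M: "\<And>x. x \<in> tube j r \<rho> \<Longrightarrow> cmod (f x) \<le> M" and \<rho>: "\<rho> > 0"
  shows "\<exists>q. \<forall>x\<in>tube j r \<rho>. cdifferentiable_at q x \<and> cmod (q x) \<le> 4 / \<rho> * M
    \<and> f x = f (vec_upd j 0 x) + x $ j * q x"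
proof -
  define a where "a k x = (pderiv_at j ^^ k) f (vec_upd j 0 x) / fact k" for k x
  define q where "q x = suminf (\<lambda>k. a (Suc k) x * (x $ j) ^ k)" for x
  note P = deriv_upd_eq_pderiv[of j r \<rho> f, OF f]
  have hol: "(\<lambda>z. f (vec_upd j z x)) holomorphic_on ball 0 \<rho>" if x: "x \<in> tube j r \<rho>" for x
    unfolding holomorphic_on_def
  proof
    fix z :: complex assume "z \<in> ball 0 \<rho>"
    then have "cdifferentiable_at f (vec_upd j z x)" using f tube_upd[OF x] by simp
    then show "(\<lambda>z. f (vec_upd j z x)) field_differentiable at z within ball 0 \<rho>"
      by (rule field_differentiable_at_within[OF cdifferentiable_vec_upd])
  qed
  have a_deriv: "a k x = (deriv ^^ k) (\<lambda>z. f (vec_upd j z x)) 0 / fact k" if "x \<in> tube j r \<rho>" for k x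
    using P[of k] that \<rho> by (simp add: a_def)
  have sums: "(\<lambda>k. a k x * z ^ k) sums f (vec_upd j z x)" if "x \<in> tube j r \<rho>" "cmod z < \<rho>" for x z
    using holomorphic_power_series[OF hol[OF that(1)], of z] that(2) a_deriv[OF that(1)] by simp
  have bd: "cmod (a k x) \<le> M / s ^ k" if x: "x \<in> tube j r \<rho>" and s: "0 < s" "s < \<rho>" for k x s
  proof -
    have sub: "cball 0 s \<subseteq> ball (0::complex) \<rho>" using s by auto
    have "cmod ((deriv ^^ k) (\<lambda>z. f (vec_upd j z x)) 0) \<le> fact k * M / s ^ k"
    proof (rule Cauchy_inequality)
      show "(\<lambda>z. f (vec_upd j z x)) holomorphic_on ball 0 s"
        using hol[OF x] sub ball_subset_cball holomorphic_on_subset by blast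
      show "continuous_on (cball 0 s) (\<lambda>z. f (vec_upd j z x))"
        using hol[OF x] sub holomorphic_on_imp_continuous_on holomorphic_on_subset by blast
    qed (use s x in \<open>auto intro!: M tube_upd\<close>)
    then show ?thesis by (simp add: a_deriv[OF x] norm_divide field_simps)
  qed
  \<comment> \<open>Cauchy's estimate on the circle of radius \<open>s\<close>, played against
    \<open>cmod (x $ j) \<le> t\<close>, gives a geometric majorant that is independent of
    \<open>x\<close>.\<close>
  have bd2: "cmod (a (Suc k) x * (x $ j) ^ k) \<le> M / s * (t / s) ^ k"
    if x: "x \<in> tube j r \<rho>" and t: "cmod (x $ j) \<le> t" "t < s" "s < \<rho>" for x s t k
  proof -
    have s: "0 < s" using t by (meson norm_ge_zero order_le_less_trans)
    have M0: "M \<ge> 0" using M[OF x] norm_ge_zero order_trans by blast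
    have "cmod (a (Suc k) x * (x $ j) ^ k) \<le> M / s ^ Suc k * t ^ k"
      unfolding norm_mult norm_power
      using bd[OF x s t(3), of "Suc k"] t(1) s M0 by (intro mult_mono power_mono) auto
    then show ?thesis by (simp add: power_divide)
  qed
  have geo: "summable (\<lambda>k. M / s * (t / s) ^ k)" if "0 \<le> t" "t < s" for s t
    using that by (intro summable_mult summable_geometric) auto
  have sm: "summable (\<lambda>k. a (Suc k) x * (x $ j) ^ k)" if x: "x \<in> tube j r \<rho>" for x
  proof -
    from x obtain s where s: "cmod (x $ j) < s" "s < \<rho>" using dense by (auto simp: tube_def)
    show ?thesis
      by (rule summable_comparison_test'[OF geo[OF norm_ge_zero s(1)], of 0]) (use bd2[OF x _ s] in auto)
  qed
  have eq: "f x = f (vec_upd j 0 x) + x $ j * q x" if x: "x \<in> tube j r \<rho>" for x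
  proof -
    have "(\<lambda>k. a k x * (x $ j) ^ k) sums f x" using sums[OF x, of "x $ j"] x by (simp add: tube_def)
    then have "(\<lambda>k. a (Suc k) x * (x $ j) ^ Suc k) sums (f x - a 0 x)"
      using sums_Suc_iff[of "\<lambda>k. a k x * (x $ j) ^ k"] by simp
    moreover have "(\<lambda>k. x $ j * (a (Suc k) x * (x $ j) ^ k)) sums (x $ j * q x)"
      unfolding q_def by (intro sums_mult summable_sums sm x)
    ultimately have "f x - a 0 x = x $ j * q x"
      using sums_unique2 by (auto simp: mult_ac)
    then show ?thesis by (simp add: a_def algebra_simps)
  qed
  have "cdifferentiable_at q x" if x: "x \<in> tube j r \<rho>" for x
  proof -
    \<comment> \<open>The majorant is uniform only on tubes of smaller axial radius
      \<open>t\<close>; this suffices because differentiability is local.\<close>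
    from x obtain t where t: "cmod (x $ j) < t" "t < \<rho>" using dense by (auto simp: tube_def)
    from t obtain s where s: "t < s" "s < \<rho>" using dense by auto
    have t0: "0 \<le> t" using t by (meson norm_ge_zero less_imp_le order_trans)
    show ?thesis unfolding q_def
    proof (rule cdifferentiable_suminf[OF open_tube[of j r t] _ _ geo[OF t0 s(1)]])
      show "x \<in> tube j r t" using x t by (simp add: tube_def)
      fix n y assume "y \<in> tube j r t"
      then have y: "y \<in> tube j r \<rho>" "cmod (y $ j) \<le> t" using t by (auto simp: tube_def)
      show "cmod (a (Suc n) y * (y $ j) ^ n) \<le> M / s * (t / s) ^ n" by (rule bd2) (use y s in auto)
      have "vec_upd j 0 y \<in> tube j r \<rho>" using y \<rho> by (simp add: tube_upd)
      then have "cdifferentiable_at ((pderiv_at j ^^ Suc n) f) (vec_upd j 0 y)" using P[of "Suc n"] by blast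
      then have "cdifferentiable_at (\<lambda>y. inverse (fact (Suc n)) * (pderiv_at j ^^ Suc n) f (vec_upd j 0 y)) y"
        by (intro cdifferentiable_mult cdifferentiable_const cdifferentiable_vec_upd_0)
      then have "cdifferentiable_at (a (Suc n)) y"
        unfolding a_def by (simp add: field_simps del: fact_Suc)
      then show "cdifferentiable_at (\<lambda>y. a (Suc n) y * (y $ j) ^ n) y"
        by (intro cdifferentiable_mult cdifferentiable_power cdifferentiable_coord)
    qed
  qed
  \<comment> \<open>A bound that loses no radius, so that the division can be iterated on the same tube.\<close>
  moreover have "cmod (q x) \<le> 4 / \<rho> * M" if x: "x \<in> tube j r \<rho>" for x
  proof (cases "cmod (x $ j) \<le> \<rho> / 2")
    case True
    \<comment> \<open>Estimating on the circle of radius 3\<rho>/4 gives the ratio 2/3, whose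
      geometric series sums to 3, hence the total 4M/\<rho>, the same value as in the other
      case.\<close>
    have lt: "\<rho> / 2 < 3 * \<rho> / 4" "3 * \<rho> / 4 < \<rho>" using \<rho> by auto
    have "cmod (q x) \<le> suminf (\<lambda>k. M / (3 * \<rho> / 4) * ((\<rho> / 2) / (3 * \<rho> / 4)) ^ k)"
      unfolding q_def
      by (rule norm_suminf_le) (use bd2[OF x True lt] geo[OF _ lt(1)] \<rho> in auto)
    also have "\<dots> = suminf (\<lambda>k. M / (3 * \<rho> / 4) * (2/3) ^ k)" using \<rho> by (simp add: field_simps)
    also have "\<dots> = M / (3 * \<rho> / 4) * suminf (\<lambda>k. (2/3) ^ k)"
      by (intro suminf_mult summable_geometric) simp
    also have "suminf (\<lambda>k. (2/3) ^ k) = (3::real)" by (subst suminf_geometric) auto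
    also have "M / (3 * \<rho> / 4) * 3 = 4 / \<rho> * M" using \<rho> by (simp add: field_simps)
    finally show ?thesis .
  next
    case False
    have M0: "M \<ge> 0" using M[OF x] norm_ge_zero order_trans by blast
    \<comment> \<open>Far from the hyperplane the bound comes from the division itself: a numerator
      of size at most 2M over a denominator of size more than \<rho>/2.\<close>
    have "\<rho> / 2 * cmod (q x) \<le> cmod (x $ j) * cmod (q x)"
      using False by (intro mult_right_mono) auto
    also have "\<dots> = cmod (f x - f (vec_upd j 0 x))" using eq[OF x] by (simp flip: norm_mult)
    also have "\<dots> \<le> M + M"
      using M[OF x] M[OF tube_upd[OF x, of 0]] \<rho> norm_triangle_ineq4[of "f x" "f (vec_upd j 0 x)"] by simp
    finally show ?thesis using \<rho> by (simp add: field_simps)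
  qed
  ultimately show ?thesis using eq by blast
qed

text \<open>Each further division by \<open>x $ j\<close> is applied to the last quotient, whose
  restriction to the hyperplane becomes the next remainder coefficient; the factors 4/\<rho>
  multiply.\<close>

lemma tube_divide_power:
  fixes f :: "complex^'n \<Rightarrow> complex"
  assumes f: "\<And>x. x \<in> tube j r \<rho> \<Longrightarrow> cdifferentiable_at f x"
    and M: "\<And>x. x \<in> tube j r \<rho> \<Longrightarrow> cmod (f x) \<le> M" and \<rho>: "\<rho> > 0"
  shows "\<exists>q R. \<forall>x\<in>tube j r \<rho>. cdifferentiable_at q x \<and> cmod (q x) \<le> (4 / \<rho>) ^ d * M
    \<and> (\<forall>i<d. cdifferentiable_at (R i) x \<and> cmod (R i x) \<le> (4 / \<rho>) ^ i * M \<and> R i x = R i (vec_upd j 0 x))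
    \<and> f x = (x $ j) ^ d * q x + (\<Sum>i<d. R i x * (x $ j) ^ i)"
proof (induction d)
  case 0
  show ?case by (rule exI[of _ f]) (use f M in auto)
next
  case (Suc d)
  then obtain q R where qR: "\<And>x. x \<in> tube j r \<rho> \<Longrightarrow> cdifferentiable_at q x \<and> cmod (q x) \<le> (4 / \<rho>) ^ d * M
    \<and> (\<forall>i<d. cdifferentiable_at (R i) x \<and> cmod (R i x) \<le> (4 / \<rho>) ^ i * M \<and> R i x = R i (vec_upd j 0 x))
    \<and> f x = (x $ j) ^ d * q x + (\<Sum>i<d. R i x * (x $ j) ^ i)" by blast
  have "\<exists>q'. \<forall>x\<in>tube j r \<rho>. cdifferentiable_at q' x \<and> cmod (q' x) \<le> 4 / \<rho> * ((4 / \<rho>) ^ d * M)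
    \<and> q x = q (vec_upd j 0 x) + x $ j * q' x"
    by (rule tube_divide) (use qR \<rho> in auto)
  then obtain q' where q': "\<And>x. x \<in> tube j r \<rho> \<Longrightarrow> cdifferentiable_at q' x \<and> cmod (q' x) \<le> 4 / \<rho> * ((4 / \<rho>) ^ d * M)
    \<and> q x = q (vec_upd j 0 x) + x $ j * q' x" by blast
  define R' where "R' = R(d := \<lambda>x. q (vec_upd j 0 x))"
  show ?case
  proof (intro exI[of _ q'] exI[of _ R'] ballI conjI allI impI)
    fix x assume x: "x \<in> tube j r \<rho>"
    have x0: "vec_upd j 0 x \<in> tube j r \<rho>" using x \<rho> by (simp add: tube_upd)
    show "cdifferentiable_at q' x" "cmod (q' x) \<le> (4 / \<rho>) ^ Suc d * M" using q'[OF x] by (auto simp: mult_ac)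
    have "f x = (x $ j) ^ d * (q (vec_upd j 0 x) + x $ j * q' x) + (\<Sum>i<d. R i x * (x $ j) ^ i)"
      using qR[OF x] q'[OF x] by metis
    also have "(\<Sum>i<d. R i x * (x $ j) ^ i) = (\<Sum>i<d. R' i x * (x $ j) ^ i)"
      by (rule sum.cong) (auto simp: R'_def)
    finally show "f x = (x $ j) ^ Suc d * q' x + (\<Sum>i<Suc d. R' i x * (x $ j) ^ i)"
      by (simp add: R'_def algebra_simps)
    fix i assume i: "i < Suc d"
    have q0: "cdifferentiable_at q (vec_upd j 0 x)" "cmod (q (vec_upd j 0 x)) \<le> (4 / \<rho>) ^ d * M"
      using qR[OF x0] by blast+
    have Ri: "cdifferentiable_at (R i) x" "cmod (R i x) \<le> (4 / \<rho>) ^ i * M" "R i x = R i (vec_upd j 0 x)"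
      if "i \<noteq> d" proof -
      have "i < d" using i that by simp
      then show "cdifferentiable_at (R i) x" "cmod (R i x) \<le> (4 / \<rho>) ^ i * M"
        "R i x = R i (vec_upd j 0 x)" using qR[OF x] by blast+
    qed
    show "cdifferentiable_at (R' i) x"
      using q0(1) Ri(1) by (cases "i = d") (simp_all add: R'_def cdifferentiable_vec_upd_0)
    show "cmod (R' i x) \<le> (4 / \<rho>) ^ i * M" using q0(2) Ri(2) by (cases "i = d") (simp_all add: R'_def)
    show "R' i x = R' i (vec_upd j 0 x)" using Ri(3) by (cases "i = d") (simp_all add: R'_def)
  qed
qed

text \<open>The quotient by x_j^d grows by at most \<open>(4 / \<rho>) ^ d\<close>, so the condition
  on \<epsilon> says that dividing and then multiplying the quotient by -h at least halves the
  bound.\<close>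

lemma tube_weierstrass_division:
  fixes f h :: "complex^'n \<Rightarrow> complex"
  assumes f: "\<And>x. x \<in> tube j r \<rho> \<Longrightarrow> cdifferentiable_at f x"
    and M: "\<And>x. x \<in> tube j r \<rho> \<Longrightarrow> cmod (f x) \<le> M" and \<rho>: "\<rho> > 0"
    and h: "\<And>x. x \<in> tube j r \<rho> \<Longrightarrow> cdifferentiable_at h x"
    and \<epsilon>: "\<And>x. x \<in> tube j r \<rho> \<Longrightarrow> cmod (h x) \<le> \<epsilon>" "\<epsilon> * (4 / \<rho>) ^ d \<le> 1 / 2"
  shows "\<exists>q R. \<forall>x\<in>tube j r \<rho>. cdifferentiable_at q x
    \<and> (\<forall>i<d. cdifferentiable_at (R i) x \<and> R i x = R i (vec_upd j 0 x))
    \<and> f x = q x * ((x $ j) ^ d + h x) + (\<Sum>i<d. R i x * (x $ j) ^ i)"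
proof -
  let ?T = "tube j r \<rho>"
  define ok where "ok F B \<longleftrightarrow> (\<forall>x\<in>?T. cdifferentiable_at F x \<and> cmod (F x) \<le> B)" for F B
  define dv where "dv F B q R \<longleftrightarrow> (\<forall>x\<in>?T. cdifferentiable_at q x \<and> cmod (q x) \<le> (4 / \<rho>) ^ d * B
    \<and> (\<forall>i<d. cdifferentiable_at (R i) x \<and> cmod (R i x) \<le> (4 / \<rho>) ^ i * B \<and> R i x = R i (vec_upd j 0 x))
    \<and> F x = (x $ j) ^ d * q x + (\<Sum>i<d. R i x * (x $ j) ^ i))" for F B q R
  have "\<exists>q R. dv F B q R" if "ok F B" for F B
    unfolding dv_def by (rule tube_divide_power) (use that \<rho> in \<open>auto simp: ok_def\<close>)
  then obtain Q R where "\<And>F B. ok F B \<Longrightarrow> dv F B (Q F B) (R F B)" by metis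
  note QR = this[unfolded dv_def, rule_format]
  define B where "B k = M * (1/2) ^ k" for k :: nat
  \<comment> \<open>With \<open>g = x\<^sub>j\<^sup>d + h\<close>, the remainder of dividing \<open>F\<^sub>k\<close> by \<open>x\<^sub>j\<^sup>d\<close> gives
    \<open>F\<^sub>k = Q\<^sub>k g + R\<^sub>k + F\<^bsub>k+1\<^esub>\<close>, and \<open>F\<^sub>k\<close> decays geometrically; now sum over \<open>k\<close>.\<close>
  define F where "F = rec_nat f (\<lambda>k G x. - (h x * Q G (B k) x))"
  have F0: "F 0 = f" and FS: "F (Suc k) = (\<lambda>x. - (h x * Q (F k) (B k) x))" for k
    by (simp_all add: F_def)
  have ok: "ok (F k) (B k)" for k
  proof (induction k)
    case 0
    show ?case using f M by (simp add: ok_def F0 B_def)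
  next
    case (Suc k)
    show ?case unfolding ok_def FS
    proof (intro ballI conjI)
      fix x assume x: "x \<in> ?T"
      have "cdifferentiable_at (\<lambda>x. (-1) * (h x * Q (F k) (B k) x)) x"
        using QR[OF Suc x] h[OF x] by (intro cdifferentiable_mult cdifferentiable_const) auto
      then show "cdifferentiable_at (\<lambda>x. - (h x * Q (F k) (B k) x)) x" by simp
      have B0: "B k \<ge> 0" using Suc x unfolding ok_def by (meson norm_ge_zero order_trans)
      have e0: "\<epsilon> \<ge> 0" using \<epsilon>(1)[OF x] norm_ge_zero order_trans by blast
      have "cmod (- (h x * Q (F k) (B k) x)) \<le> \<epsilon> * ((4 / \<rho>) ^ d * B k)"
        unfolding norm_minus_cancel norm_mult
        using QR[OF Suc x] \<epsilon>(1)[OF x] e0 by (intro mult_mono) auto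
      also have "\<dots> = (\<epsilon> * (4 / \<rho>) ^ d) * B k" by simp
      also have "\<dots> \<le> 1/2 * B k" by (rule mult_right_mono) (use \<epsilon>(2) B0 in auto)
      also have "\<dots> = B (Suc k)" by (simp add: B_def)
      finally show "cmod (- (h x * Q (F k) (B k) x)) \<le> B (Suc k)" .
    qed
  qed
  have sB: "summable B" unfolding B_def by (intro summable_mult summable_geometric) simp
  define Qk where "Qk k = Q (F k) (B k)" for k
  define Rk where "Rk i k = R (F k) (B k) i" for i k
  note S = QR[OF ok, folded Qk_def Rk_def]
  define q where "q x = suminf (\<lambda>k. Qk k x)" for x
  define R' where "R' i x = suminf (\<lambda>k. Rk i k x)" for i x
  have Q: "cdifferentiable_at (Qk k) x" "cmod (Qk k x) \<le> (4 / \<rho>) ^ d * B k" if "x \<in> ?T" for k x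
    using S[OF that] by blast+
  have R: "cdifferentiable_at (Rk i k) x" "cmod (Rk i k x) \<le> (4 / \<rho>) ^ i * B k"
    "Rk i k x = Rk i k (vec_upd j 0 x)" if "x \<in> ?T" "i < d" for k x i
    using S[OF that(1)] that(2) by blast+
  have sumQ: "(\<lambda>k. Qk k x) sums q x" if x: "x \<in> ?T" for x
    unfolding q_def
    by (rule summable_sums, rule summable_comparison_test'[OF summable_mult[OF sB], of 0]) (rule Q(2)[OF x])
  have sumR: "(\<lambda>k. Rk i k x) sums R' i x" if x: "x \<in> ?T" and i: "i < d" for x i
    unfolding R'_def
    by (rule summable_sums, rule summable_comparison_test'[OF summable_mult[OF sB], of 0]) (rule R(2)[OF x i])
  show ?thesis
  proof (intro exI[of _ q] exI[of _ R'] ballI conjI allI impI)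
    fix x assume x: "x \<in> ?T"
    show "cdifferentiable_at q x" unfolding q_def
      by (rule cdifferentiable_suminf[OF open_tube[of j r \<rho>] _ _ summable_mult[OF sB] x]) (rule Q; assumption)+
    let ?g = "(x $ j) ^ d + h x"
    have step: "F k x - F (Suc k) x = Qk k x * ?g + (\<Sum>i<d. Rk i k x * (x $ j) ^ i)" for k
      using S[OF x, of k] by (simp add: FS Qk_def algebra_simps)
    \<comment> \<open>The differences telescope to \<open>f x\<close> because \<open>F k\<close>
      tends to 0, while by \<open>step\<close> they also sum to the division formula.\<close>
    have "(\<lambda>k. F k x - F (Suc k) x) sums (F 0 x - 0)"
    proof (rule telescope_sums')
      have "(\<lambda>k. F k x) \<longlonglongrightarrow> 0"
        by (rule Lim_null_comparison[OF _ summable_LIMSEQ_zero[OF sB]])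
           (use ok x in \<open>auto simp: ok_def\<close>)
      then show "(\<lambda>k. F k x) \<longlonglongrightarrow> 0" .
    qed
    moreover have "(\<lambda>k. F k x - F (Suc k) x) sums (q x * ?g + (\<Sum>i<d. R' i x * (x $ j) ^ i))"
      unfolding step by (intro sums_add sums_mult2 sums_sum sumQ sumR x) auto
    ultimately show "f x = q x * ?g + (\<Sum>i<d. R' i x * (x $ j) ^ i)"
      using sums_unique2 F0 by fastforce
    fix i assume i: "i < d"
    show "cdifferentiable_at (R' i) x" unfolding R'_def
      by (rule cdifferentiable_suminf[OF open_tube[of j r \<rho>] _ _ summable_mult[OF sB] x]) (rule R[OF _ i]; assumption)+
    show "R' i x = R' i (vec_upd j 0 x)"
      unfolding R'_def by (rule suminf_cong) (rule R(3)[OF x i])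
  qed
qed

lemma holomorphic_near_0_ball:
  "holomorphic_near_0 f \<Longrightarrow> \<exists>e>0. \<forall>x\<in>ball 0 e. cdifferentiable_at f x"
  unfolding holomorphic_near_0_def using open_contains_ball by (metis subsetD)

text \<open>The difference h between g and x_j^d vanishes on the j-th axis, so uniform continuity
  makes it as small as desired within a small distance of the axis. This supplies the smallness
  required by \<open>tube_weierstrass_division\<close>.\<close>

lemma weierstrass_division_near_0:
  fixes f g :: "complex^'n \<Rightarrow> complex"
  assumes f: "holomorphic_near_0 f" and g: "holomorphic_near_0 g"
    and gd: "eventually (\<lambda>z. g (z *s axis j 1) = z ^ d) (nhds 0)"
  shows "\<exists>q R. holomorphic_near_0 q \<and>
    (\<forall>i<d. holomorphic_near_0 (R i) \<and> eventually (\<lambda>x. R i x = R i (vec_upd j 0 x)) (nhds 0)) \<and>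
    eventually (\<lambda>x. f x = q x * g x + (\<Sum>i<d. R i x * (x $ j) ^ i)) (nhds 0)"
proof -
  obtain e1 where e1: "e1 > 0" "\<And>x. x \<in> ball 0 e1 \<Longrightarrow> cdifferentiable_at f x"
    using holomorphic_near_0_ball[OF f] by blast
  obtain e2 where e2: "e2 > 0" "\<And>x. x \<in> ball 0 e2 \<Longrightarrow> cdifferentiable_at g x"
    using holomorphic_near_0_ball[OF g] by blast
  obtain e3 where e3: "e3 > 0" "\<And>z. cmod z < e3 \<Longrightarrow> g (z *s axis j 1) = z ^ d"
    using gd unfolding eventually_nhds_metric by (auto simp: dist_norm)
  \<comment> \<open>A third is taken so that the closed ball of radius 2\<rho>, which will contain
    the tube, stays inside both balls of holomorphy.\<close>
  define \<rho> where "\<rho> = min (min e1 e2) e3 / 3"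
  have \<rho>: "\<rho> > 0" "2 * \<rho> < e1" "2 * \<rho> < e2" "\<rho> \<le> e3" using e1(1) e2(1) e3(1) by (auto simp: \<rho>_def min_def)
  define h where "h x = g x - (x $ j) ^ d" for x
  have sub: "x \<in> ball 0 e1" "x \<in> ball 0 e2" if "x \<in> cball 0 (2 * \<rho>)" for x :: "complex^'n" using that \<rho> by auto
  have cf: "continuous_on (cball 0 (2 * \<rho>)) f"
    using e1(2) sub(1) by (intro continuous_at_imp_continuous_on) (auto intro: cdifferentiable_continuous)
  have dh: "cdifferentiable_at h x" if "x \<in> cball 0 (2 * \<rho>)" for x
  proof -
    have "cdifferentiable_at (\<lambda>x. g x + (-1) * (x $ j) ^ d) x"
      using e2(2) sub(2)[OF that]
      by (intro cdifferentiable_add cdifferentiable_mult cdifferentiable_const cdifferentiable_power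
          cdifferentiable_coord) auto
    then show ?thesis unfolding h_def by simp
  qed
  have ch: "continuous_on (cball 0 (2 * \<rho>)) h"
    using dh by (intro continuous_at_imp_continuous_on) (auto intro: cdifferentiable_continuous)
  have "bounded (f ` cball 0 (2 * \<rho>))"
    using cf by (intro compact_imp_bounded compact_continuous_image) auto
  then obtain M where M: "\<And>x. x \<in> cball 0 (2 * \<rho>) \<Longrightarrow> cmod (f x) \<le> M"
    unfolding bounded_iff by (metis imageI)
  define \<epsilon> where "\<epsilon> = 1 / 2 * (\<rho> / 4) ^ d"
  have \<epsilon>: "\<epsilon> > 0" "\<epsilon> * (4 / \<rho>) ^ d \<le> 1 / 2"
    using \<rho> by (auto simp: \<epsilon>_def power_divide)
  have "uniformly_continuous_on (cball 0 (2 * \<rho>)) h" using ch by (rule compact_uniformly_continuous) simp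
  with \<epsilon>(1) obtain \<delta> where \<delta>: "\<delta> > 0"
    "\<And>x y. x \<in> cball 0 (2 * \<rho>) \<Longrightarrow> y \<in> cball 0 (2 * \<rho>) \<Longrightarrow> dist y x < \<delta> \<Longrightarrow> dist (h y) (h x) < \<epsilon>"
    unfolding uniformly_continuous_on_def by meson
  \<comment> \<open>The bound \<delta> controls the distance to the axis, the bound \<rho> keeps the
    tube inside the ball of radius 2\<rho>.\<close>
  define r where "r = min \<delta> \<rho>"
  have r: "r > 0" "r \<le> \<delta>" "r \<le> \<rho>" using \<delta> \<rho> by (auto simp: r_def)
  let ?T = "tube j r \<rho>"
  have T: "x \<in> cball 0 (2 * \<rho>)" if "x \<in> ?T" for x
    using tube_subset_ball[of r \<rho> "2 * \<rho>", OF _ that] r by auto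
  have hb: "cmod (h x) \<le> \<epsilon>" if x: "x \<in> ?T" for x
  proof -
    have y: "(x $ j) *s axis j 1 \<in> cball 0 (2 * \<rho>)"
      using x \<rho> by (simp add: tube_def norm_vector_smult)
    have "x - (x $ j) *s axis j 1 = vec_upd j 0 x"
      using vec_upd_eq_line[of j "x $ j" x] by (simp add: algebra_simps)
    then have "dist x ((x $ j) *s axis j 1) < \<delta>" using x r by (simp add: dist_norm tube_def)
    from \<delta>(2)[OF y T[OF x] this] have "dist (h x) (h ((x $ j) *s axis j 1)) < \<epsilon>" .
    moreover have "h ((x $ j) *s axis j 1) = 0"
      using e3(2)[of "x $ j"] x \<rho> by (simp add: h_def tube_def)
    ultimately show ?thesis by simp
  qed
  have "\<exists>q R. \<forall>x\<in>?T. cdifferentiable_at q x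
    \<and> (\<forall>i<d. cdifferentiable_at (R i) x \<and> R i x = R i (vec_upd j 0 x))
    \<and> f x = q x * ((x $ j) ^ d + h x) + (\<Sum>i<d. R i x * (x $ j) ^ i)"
    by (rule tube_weierstrass_division[OF e1(2)[OF sub(1)[OF T]] M[OF T] \<rho>(1) dh[OF T] hb \<epsilon>(2)])
  then obtain q R where qR: "\<And>x. x \<in> ?T \<Longrightarrow> cdifferentiable_at q x
    \<and> (\<forall>i<d. cdifferentiable_at (R i) x \<and> R i x = R i (vec_upd j 0 x))
    \<and> f x = q x * ((x $ j) ^ d + h x) + (\<Sum>i<d. R i x * (x $ j) ^ i)" by blast
  have "0 \<in> ?T" using r \<rho> by (simp add: tube_def)
  with open_tube have ev: "eventually (\<lambda>x. x \<in> ?T) (nhds 0)" by (rule eventually_nhds_in_open)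
  have hol: "holomorphic_near_0 F" if "\<And>x. x \<in> ?T \<Longrightarrow> cdifferentiable_at F x" for F
    unfolding holomorphic_near_0_def using open_tube \<open>0 \<in> ?T\<close> that by blast
  show ?thesis
    by (intro exI[of _ q] exI[of _ R] conjI allI impI hol)
       (use qR ev in \<open>auto simp: h_def elim!: eventually_mono\<close>)
qed

section \<open>Germs: units, substitutions and regularity\<close>

lemma holomorphic_near_0_iff: "holomorphic_near_0 f \<longleftrightarrow> eventually (cdifferentiable_at f) (nhds 0)"
  unfolding holomorphic_near_0_def eventually_nhds by blast

lemma germ_exhaust:
  obtains f where "holomorphic_near_0 f" "G = abs_germ f"
  using germ.abs_induct[of "\<lambda>G. \<exists>f. holomorphic_near_0 f \<and> G = abs_germ f" G]
  by (auto simp: germ_eq_refl_iff)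

lemma abs_germ_eq_iff:
  "holomorphic_near_0 f \<Longrightarrow> holomorphic_near_0 g \<Longrightarrow>
     abs_germ f = abs_germ g \<longleftrightarrow> eventually (\<lambda>x. f x = g x) (nhds 0)"
  using Quotient3_rel[OF Quotient3_germ, of f g] by (auto simp: germ_eq_def)

lemma abs_germ_hom:
  assumes "holomorphic_near_0 f" "holomorphic_near_0 g"
  shows "abs_germ f + abs_germ g = abs_germ (\<lambda>x. f x + g x)"
    "abs_germ f * abs_germ g = abs_germ (\<lambda>x. f x * g x)"
  using assms by (auto intro!: plus_germ.abs_eq times_germ.abs_eq simp: germ_eq_refl_iff)

lemma holomorphic_near_0_power: "holomorphic_near_0 f \<Longrightarrow> holomorphic_near_0 (\<lambda>x. f x ^ k)"
  by (induction k) (auto intro: holomorphic_near_0_intros)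

lemma holomorphic_near_0_sum:
  "(\<And>i. i \<in> S \<Longrightarrow> holomorphic_near_0 (f i)) \<Longrightarrow> holomorphic_near_0 (\<lambda>x. \<Sum>i\<in>S. f i x)"
  by (induction S rule: infinite_finite_induct) (auto intro: holomorphic_near_0_intros)

lemma abs_germ_power: "holomorphic_near_0 f \<Longrightarrow> abs_germ f ^ k = abs_germ (\<lambda>x. f x ^ k)"
  by (induction k) (auto simp: one_germ.abs_eq abs_germ_hom holomorphic_near_0_power)

lemma abs_germ_sum:
  "(\<And>i. i \<in> S \<Longrightarrow> holomorphic_near_0 (f i)) \<Longrightarrow> (\<Sum>i\<in>S. abs_germ (f i)) = abs_germ (\<lambda>x. \<Sum>i\<in>S. f i x)"
  by (induction S rule: infinite_finite_induct)
     (auto simp: zero_germ.abs_eq abs_germ_hom holomorphic_near_0_sum)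

lift_definition germ_const :: "complex \<Rightarrow> ('n::finite) germ" is "\<lambda>c _. c"
  by (auto simp: germ_eq_def intro: holomorphic_near_0_intros)

lift_definition germ_value :: "('n::finite) germ \<Rightarrow> complex" is "\<lambda>f. f 0"
  by (auto simp: germ_eq_def dest: eventually_nhds_x_imp_x)

lemma germ_const_hom:
  "germ_const 0 = 0" "germ_const 1 = 1" "germ_const (a + b) = germ_const a + germ_const b"
  "germ_const (a * b) = germ_const a * germ_const b"
  by (transfer; simp add: germ_eq_def holomorphic_near_0_const)+

lemma germ_value_hom [simp]:
  "germ_value 0 = 0" "germ_value 1 = 1" "germ_value (a + b) = germ_value a + germ_value b"
  "germ_value (a * b) = germ_value a * germ_value b" "germ_value (germ_const c) = c"
  "germ_value (germ_var j) = 0"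
  by (transfer; simp)+

lemma germ_pderiv_const: "germ_pderiv j (germ_const c) = 0"
  by transfer (auto simp: germ_eq_def pderiv_at_def intro!: holomorphic_near_0_intros)

lemma germ_unit:
  assumes "germ_value G \<noteq> 0"
  obtains G' where "G * G' = 1"
proof -
  obtain f where f: "holomorphic_near_0 f" "G = abs_germ f" by (rule germ_exhaust)
  have f0: "f 0 \<noteq> 0" using assms f by (simp add: germ_value.abs_eq germ_eq_refl_iff)
  have "isCont f 0"
    using f(1) by (auto simp: holomorphic_near_0_def intro: cdifferentiable_continuous)
  then have "(f \<longlongrightarrow> f 0) (nhds 0)" using tendsto_at_iff_tendsto_nhds[of f 0] by (simp add: isCont_def)
  then have ne: "eventually (\<lambda>x. f x \<noteq> 0) (nhds 0)" using f0 tendsto_imp_eventually_ne by blast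
  have h: "holomorphic_near_0 (\<lambda>x. inverse (f x))"
    using ne f(1) unfolding holomorphic_near_0_iff by eventually_elim (rule cdifferentiable_inverse)
  have "G * abs_germ (\<lambda>x. inverse (f x)) = 1"
    using f h ne by (auto simp: abs_germ_hom one_germ.abs_eq abs_germ_eq_iff holomorphic_near_0_const
        holomorphic_near_0_mult elim: eventually_mono)
  then show ?thesis by (rule that)
qed

section \<open>Linear substitutions in germs\<close>

lemma bounded_linear_matrix: "bounded_linear (\<lambda>x. (A :: complex^'n^'m) *v x)"
  by (intro linear_conv_bounded_linear[THEN iffD1] linearI)
     (auto simp: vec_eq_iff matrix_vector_mult_def scaleR_sum_right algebra_simps sum.distrib)

lemma eventually_nhds_0_matrix:
  assumes "eventually P (nhds 0)"
  shows "eventually (\<lambda>x. P ((A :: complex^'n^'m) *v x)) (nhds 0)"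
proof -
  have "isCont (\<lambda>x. A *v x) 0" by (rule linear_continuous_at[OF bounded_linear_matrix])
  then have "filterlim (\<lambda>x. A *v x) (nhds 0) (nhds 0)"
    using tendsto_at_iff_tendsto_nhds[of "\<lambda>x. A *v x" 0] by (simp add: isCont_def)
  then show ?thesis by (rule eventually_compose_filterlim[OF assms])
qed

lemma holomorphic_near_0_matrix:
  "holomorphic_near_0 f \<Longrightarrow> holomorphic_near_0 (\<lambda>x. f ((A :: complex^'n^'m) *v x))"
  unfolding holomorphic_near_0_iff
  by (drule eventually_nhds_0_matrix[of _ A], erule eventually_mono)
     (rule cdifferentiable_compose[where B="\<lambda>x. A *v x"],
      auto intro: bounded_linear_imp_has_derivative bounded_linear_matrix simp: vector_scalar_commute)

text \<open>A single operation serves for setting coordinates to zero, with a singular matrix, and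
  for changes of coordinates, with an invertible one.\<close>

lift_definition germ_subst :: "complex^'n^'n \<Rightarrow> ('n::finite) germ \<Rightarrow> 'n germ" is "\<lambda>A f x. f (A *v x)"
  by (auto simp: germ_eq_def intro: holomorphic_near_0_matrix eventually_nhds_0_matrix)

lemma germ_subst_hom [simp]:
  "germ_subst A 0 = 0" "germ_subst A 1 = 1" "germ_subst A (f + g) = germ_subst A f + germ_subst A g"
  "germ_subst A (f * g) = germ_subst A f * germ_subst A g"
  by (transfer; auto simp: germ_eq_def intro!: holomorphic_near_0_matrix holomorphic_near_0_intros)+

lemma germ_subst_sum [simp]: "germ_subst A (sum f S) = (\<Sum>i\<in>S. germ_subst A (f i))"
  by (induction S rule: infinite_finite_induct) auto

lemma germ_subst_power [simp]: "germ_subst A (f ^ k) = germ_subst A f ^ k"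
  by (induction k) auto

lemma germ_subst_subst: "germ_subst A (germ_subst B f) = germ_subst (B ** A) f"
  by transfer (auto simp: germ_eq_def matrix_vector_mul_assoc intro!: holomorphic_near_0_matrix)

lemma germ_subst_id: "germ_subst (mat 1) f = f"
  by transfer (simp add: germ_eq_refl_iff)

definition coord_proj :: "'n set \<Rightarrow> complex^'n^'n" where
  "coord_proj K = (\<chi> i k. if i = k \<and> i \<in> K then 1 else 0)"

lemma coord_proj_nth [simp]: "(coord_proj K *v x) $ i = (if i \<in> K then x $ i else 0)"
  by (simp add: coord_proj_def matrix_vector_mult_def if_distrib[of "\<lambda>c. c * _"] cong: if_cong)

lemma coord_proj_mult: "coord_proj K ** coord_proj L = coord_proj (K \<inter> L)"
  by (simp add: matrix_eq vec_eq_iff flip: matrix_vector_mul_assoc)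

abbreviation germ_proj :: "'n set \<Rightarrow> ('n::finite) germ \<Rightarrow> 'n germ" where
  "germ_proj K \<equiv> germ_subst (coord_proj K)"

lemma germ_proj_proj: "germ_proj K (germ_proj L f) = germ_proj (K \<inter> L) f"
  by (simp add: germ_subst_subst coord_proj_mult Int_commute)

lemma germ_proj_UNIV: "germ_proj UNIV f = f"
proof -
  have "coord_proj UNIV = (mat 1 :: complex^'a^'a)"
    by (simp add: matrix_eq vec_eq_iff)
  then show ?thesis by (simp add: germ_subst_id)
qed

lemma germ_proj_empty: "germ_proj {} f = germ_const (germ_value f)"
proof (cases f rule: germ_exhaust)
  case (1 F)
  have "coord_proj {} *v x = 0" for x :: "complex^'a" by (simp add: vec_eq_iff)
  with 1 show ?thesis
    by (simp add: germ_subst.abs_eq germ_value.abs_eq germ_const.abs_eq germ_eq_refl_iff)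
qed

lemma germ_proj_var: "germ_proj K (germ_var j) = (if j \<in> K then germ_var j else 0)"
  by transfer (auto simp: germ_eq_def intro: holomorphic_near_0_intros)

lemma coord_proj_eq_upd: "coord_proj (- {j}) *v x = vec_upd j 0 x"
  by (simp add: vec_eq_iff)

lemma coord_proj_eq_axis: "coord_proj {j} *v x = x $ j *s axis j 1"
  by (simp add: vec_eq_iff axis_def)

lemma filterlim_line:
  fixes v :: "complex^'n"
  shows "filterlim (\<lambda>z. z *s v) (nhds 0) (nhds 0)"
proof -
  have "isCont (\<lambda>z. z *s v) 0" by (rule linear_continuous_at[OF bounded_linear_smult_left])
  then show ?thesis
    using tendsto_at_iff_tendsto_nhds[of "\<lambda>z. z *s v" 0] by (simp add: isCont_def)
qed

lemma filterlim_coord: "filterlim (\<lambda>x. x $ j) (nhds 0) (nhds (0::complex^'n))"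
proof -
  have "isCont (\<lambda>x::complex^'n. x $ j) 0" by (intro continuous_intros)
  then show ?thesis
    using tendsto_at_iff_tendsto_nhds[of "\<lambda>x::complex^'n. x $ j" 0] by (simp add: isCont_def)
qed

lemma germ_weierstrass_division:
  fixes F G :: "('n::finite) germ"
  assumes "germ_proj {j} G = germ_var j ^ d"
  shows "\<exists>Q R. (\<forall>i<d. germ_proj (- {j}) (R i) = R i) \<and> F = Q * G + (\<Sum>i<d. R i * germ_var j ^ i)"
proof -
  obtain f where f: "holomorphic_near_0 f" "F = abs_germ f" by (rule germ_exhaust)
  obtain g where g: "holomorphic_near_0 g" "G = abs_germ g" by (rule germ_exhaust)
  have "eventually (\<lambda>x. g (x $ j *s axis j 1) = (x $ j) ^ d) (nhds 0)"
    using assms g holomorphic_near_0_matrix[OF g(1), of "coord_proj {j}"]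
    by (simp add: germ_subst.abs_eq germ_eq_refl_iff germ_var.abs_eq abs_germ_power
        holomorphic_near_0_intros holomorphic_near_0_power abs_germ_eq_iff coord_proj_eq_axis)
  \<comment> \<open>The equality of germs is an identity in n variables that only involves
    \<open>x $ j\<close>; composing with the axis turns it into the one-variable hypothesis.\<close>
  from eventually_compose_filterlim[OF this filterlim_line[of "axis j 1"]]
  have "eventually (\<lambda>z. g (z *s axis j 1) = z ^ d) (nhds 0)" by simp
  from weierstrass_division_near_0[OF f(1) g(1) this] obtain q r where q: "holomorphic_near_0 q"
    and r: "\<And>i. i < d \<Longrightarrow> holomorphic_near_0 (r i)"
      "\<And>i. i < d \<Longrightarrow> eventually (\<lambda>x. r i x = r i (vec_upd j 0 x)) (nhds 0)"
    and eq: "eventually (\<lambda>x. f x = q x * g x + (\<Sum>i<d. r i x * (x $ j) ^ i)) (nhds 0)" by blast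
  have h: "holomorphic_near_0 (\<lambda>x. r i x * (x $ j) ^ i)" if "i < d" for i
    using r that by (intro holomorphic_near_0_intros holomorphic_near_0_power)
  have hs: "holomorphic_near_0 (\<lambda>x. \<Sum>i<d. r i x * (x $ j) ^ i)"
    using h by (intro holomorphic_near_0_sum) auto
  have "F = abs_germ q * G + (\<Sum>i<d. abs_germ (r i) * germ_var j ^ i)"
  proof -
    have "(\<Sum>i<d. abs_germ (r i) * germ_var j ^ i) = (\<Sum>i<d. abs_germ (\<lambda>x. r i x * (x $ j) ^ i))"
      using r by (intro sum.cong) (auto simp: germ_var.abs_eq abs_germ_power abs_germ_hom
          holomorphic_near_0_coord holomorphic_near_0_power)
    also have "\<dots> = abs_germ (\<lambda>x. \<Sum>i<d. r i x * (x $ j) ^ i)"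
      using h by (intro abs_germ_sum) auto
    finally have "abs_germ q * G + (\<Sum>i<d. abs_germ (r i) * germ_var j ^ i)
        = abs_germ (\<lambda>x. q x * g x + (\<Sum>i<d. r i x * (x $ j) ^ i))"
      using q g hs by (simp add: abs_germ_hom holomorphic_near_0_mult)
    then show ?thesis
      using f eq q g hs by (simp add: abs_germ_eq_iff holomorphic_near_0_add holomorphic_near_0_mult)
  qed
  moreover have "germ_proj (- {j}) (abs_germ (r i)) = abs_germ (r i)" if "i < d" for i
  proof -
    have "holomorphic_near_0 (\<lambda>x. r i (vec_upd j 0 x))"
      using holomorphic_near_0_matrix[OF r(1)[OF that], of "coord_proj (- {j})"] by (simp add: coord_proj_eq_upd)
    with r[OF that] show ?thesis
      by (simp add: germ_subst.abs_eq germ_eq_refl_iff coord_proj_eq_upd abs_germ_eq_iff eq_commute)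
  qed
  ultimately show ?thesis
    by (intro exI[of _ "abs_germ q"] exI[of _ "\<lambda>i. abs_germ (r i)"]) blast
qed

section \<open>Regularity along a coordinate axis\<close>

lemma holomorphic_near_0_of_coord:
  assumes "h holomorphic_on ball 0 e" "e > 0"
  shows "holomorphic_near_0 (\<lambda>x :: complex^'n. h (x $ j))"
  unfolding holomorphic_near_0_iff
proof (rule eventually_mono[OF eventually_compose_filterlim[OF _ filterlim_coord]])
  show "eventually (\<lambda>z. z \<in> ball 0 e) (nhds (0::complex))"
    using assms(2) by (intro eventually_nhds_in_open) auto
  fix x :: "complex^'n" assume "x $ j \<in> ball 0 e"
  then obtain D where D: "(h has_field_derivative D) (at (x $ j))"
    using holomorphic_derivI[OF assms(1) open_ball] by blast
  show "cdifferentiable_at (\<lambda>x. h (x $ j)) x"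
    unfolding cdifferentiable_at_def
    by (rule exI[of _ "\<lambda>v. D * (v $ j)"], rule conjI,
        rule has_derivative_compose[OF bounded_linear_imp_has_derivative[OF bounded_linear_vec_nth] D[unfolded has_field_derivative_def]])
       auto
qed

lemma holomorphic_on_line:
  fixes v :: "complex^'n"
  assumes "\<And>x. x \<in> ball 0 e \<Longrightarrow> cdifferentiable_at g x" "\<And>z. z \<in> U \<Longrightarrow> z *s v \<in> ball 0 e"
  shows "(\<lambda>z. g (z *s v)) holomorphic_on U"
  unfolding holomorphic_on_def
  using cdifferentiable_line[of g 0 _ v] assms by (auto intro: field_differentiable_at_within)

text \<open>On the axis, \<open>G\<close> is a power of the coordinate times a function without
  zeros near 0. Its reciprocal, read as a germ in \<open>x $ j\<close> alone, is the multiplier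
  \<open>U\<close>; it turns the restriction into an exact power, the normal form assumed by the
  division.\<close>

lemma germ_axis_regular:
  fixes G :: "('n::finite) germ"
  assumes "germ_proj {j} G \<noteq> 0"
  shows "\<exists>d U. germ_proj {j} (U * G) = germ_var j ^ d"
proof -
  obtain g where g: "holomorphic_near_0 g" "G = abs_germ g" by (rule germ_exhaust)
  obtain e where e: "e > 0" "\<And>x. x \<in> ball 0 e \<Longrightarrow> cdifferentiable_at g x"
    using holomorphic_near_0_ball[OF g(1)] by blast
  define p where "p = (\<lambda>z. g (z *s axis j 1))"
  have hol: "p holomorphic_on ball 0 e"
    unfolding p_def by (rule holomorphic_on_line[OF e(2)]) (auto simp: norm_vector_smult)
  have "\<exists>w\<in>ball 0 e. p w \<noteq> 0"
  proof (rule ccontr)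
    assume "\<not> ?thesis"
    then have "eventually (\<lambda>z. p z = 0) (nhds 0)"
      using e(1) eventually_nhds_in_open[OF open_ball, of 0 0 e] by (auto elim: eventually_mono)
    from eventually_compose_filterlim[OF this filterlim_coord]
    have "germ_proj {j} G = 0"
      using g holomorphic_near_0_matrix[OF g(1), of "coord_proj {j}"]
      by (simp add: germ_subst.abs_eq germ_eq_refl_iff zero_germ.abs_eq abs_germ_eq_iff
          holomorphic_near_0_const coord_proj_eq_axis p_def)
    with assms show False ..
  qed
  from conjunct2[OF zorder_exist_zero[OF hol open_ball connected_ball _ this, of 0]] e(1)
  obtain r where r: "r > 0" "zor_poly p 0 holomorphic_on cball 0 r"
    and p: "\<And>w. w \<in> cball 0 r \<Longrightarrow> p w = zor_poly p 0 w * (w - 0) ^ nat (zorder p 0) \<and> zor_poly p 0 w \<noteq> 0"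
    by (metis centre_in_ball)
  define u where "u = (\<lambda>z. inverse (zor_poly p 0 z))"
  have "u holomorphic_on ball 0 r"
    unfolding u_def using p
    by (intro holomorphic_on_inverse holomorphic_on_subset[OF r(2) ball_subset_cball]) auto
  then have hu: "holomorphic_near_0 (\<lambda>x::complex^'n. u (x $ j))"
    using r(1) by (rule holomorphic_near_0_of_coord)
  have "u z * p z = z ^ nat (zorder p 0)" if "z \<in> ball 0 r" for z
    using p[of z] that by (simp add: u_def)
  then have "eventually (\<lambda>z. u z * p z = z ^ nat (zorder p 0)) (nhds 0)"
    using r(1) by (intro eventually_mono[OF eventually_nhds_in_open[OF open_ball, of 0 0 r]]) simp_all
  from eventually_compose_filterlim[OF this filterlim_coord]
  have ev: "eventually (\<lambda>x::complex^'n. u (x $ j) * g (x $ j *s axis j 1) = (x $ j) ^ nat (zorder p 0)) (nhds 0)"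
    by (simp add: p_def)
  have hug: "holomorphic_near_0 (\<lambda>x. u (x $ j) * g x)" using hu g(1) by (rule holomorphic_near_0_mult)
  have "germ_proj {j} (abs_germ (\<lambda>x. u (x $ j)) * G) = germ_var j ^ nat (zorder p 0)"
    using g hu hug ev holomorphic_near_0_matrix[OF hug, of "coord_proj {j}"]
    by (simp add: abs_germ_hom germ_subst.abs_eq germ_eq_refl_iff germ_var.abs_eq abs_germ_power
        holomorphic_near_0_coord holomorphic_near_0_power abs_germ_eq_iff coord_proj_eq_axis axis_def)
  then show ?thesis by blast
qed

text \<open>Sends the j-th axis to the line spanned by \<open>axis j 1 + w\<close>. With
  \<open>w $ j = 0\<close> the other axes are fixed and the inverse is the shear by
  \<open>- w\<close>.\<close>

definition shear :: "'n \<Rightarrow> complex^'n \<Rightarrow> complex^'n^'n" where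
  "shear j w = (\<chi> i k. (if i = k then 1 else 0) + (if k = j then w $ i else 0))"

lemma shear_mult_vec: "shear j w *v x = x + x $ j *s w"
  by (simp add: shear_def vec_eq_iff matrix_vector_mult_def distrib_right sum.distrib
      if_distrib[of "\<lambda>c. c * _"] cong: if_cong)

lemma shear_inverse: "w $ j = 0 \<Longrightarrow> shear j w ** shear j (- w) = mat 1"
  by (simp add: matrix_eq shear_mult_vec vec_eq_iff flip: matrix_vector_mul_assoc)

lemma shear_commute_proj:
  "j \<in> K \<Longrightarrow> coord_proj K *v w = w \<Longrightarrow> coord_proj K ** shear j w = shear j w ** coord_proj K"
  by (simp add: matrix_eq shear_mult_vec matrix_vector_right_distrib vector_scalar_commute
      flip: matrix_vector_mul_assoc)

text \<open>A nonzero germ is nonzero at some point near 0 with nonzero j-th coordinate. The shear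
  moves the j-th axis onto the line from 0 through the projection of that point to the coordinates
  in \<open>K\<close>, and the identity theorem on this line excludes a zero restriction. Choosing
  \<open>w\<close> within \<open>K\<close> makes the shear compatible with
  \<open>germ_proj K\<close>.\<close>

lemma germ_shear_regular:
  fixes G :: "('n::finite) germ"
  assumes G: "G \<noteq> 0" "germ_proj K G = G" "j \<in> K"
  shows "\<exists>w. w $ j = 0 \<and> coord_proj K *v w = w \<and> germ_proj {j} (germ_subst (shear j w) G) \<noteq> 0"
proof -
  obtain g where g: "holomorphic_near_0 g" "G = abs_germ g" by (rule germ_exhaust)
  have "eventually (\<lambda>x. cdifferentiable_at g x \<and> g (coord_proj K *v x) = g x) (nhds 0)"
    using g G(2) holomorphic_near_0_matrix[OF g(1), of "coord_proj K"]
    by (intro eventually_conj) (simp_all add: holomorphic_near_0_iff[symmetric] germ_subst.abs_eq germ_eq_refl_iff abs_germ_eq_iff)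
  then obtain e where e: "e > 0" "\<And>x. x \<in> ball 0 e \<Longrightarrow> cdifferentiable_at g x"
     "\<And>x. x \<in> ball 0 e \<Longrightarrow> g (coord_proj K *v x) = g x"
    unfolding eventually_nhds_metric by (auto simp: dist_commute)
  have "\<exists>x\<in>ball 0 e. g x \<noteq> 0"
  proof (rule ccontr)
    assume "\<not> ?thesis"
    then have "eventually (\<lambda>z. g z = 0) (nhds 0)"
      using e(1) eventually_nhds_in_open[OF open_ball, of 0 0 e] by (auto elim: eventually_mono)
    then have "G = 0" using g by (simp add: zero_germ.abs_eq abs_germ_eq_iff holomorphic_near_0_const)
    with G(1) show False ..
  qed
  then obtain x where x: "x \<in> ball 0 e" "g x \<noteq> 0" by blast
  have "continuous_on (ball 0 e) g"
    using e(2) by (intro continuous_at_imp_continuous_on) (auto intro: cdifferentiable_continuous)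
  then have "open (ball 0 e \<inter> g -` (- {0}))"
    by (intro continuous_open_preimage) auto
  then obtain \<delta> where \<delta>: "\<delta> > 0" "ball x \<delta> \<subseteq> ball 0 e \<inter> g -` (- {0})"
    using x unfolding open_contains_ball by blast
  \<comment> \<open>A nudge by \<delta>/2 along the axis makes the j-th coordinate nonzero without
    leaving the ball on which \<open>g\<close> has no zero.\<close>
  define y where "y = x + (if x $ j = 0 then of_real (\<delta> / 2) else 0) *s axis j 1"
  have "y \<in> ball x \<delta>" using \<delta>(1) by (simp add: y_def dist_norm norm_vector_smult)
  then have y: "y \<in> ball 0 e" "g y \<noteq> 0" using \<delta>(2) by auto
  have yj: "y $ j \<noteq> 0" using \<delta>(1) by (simp add: y_def)
  \<comment> \<open>Projecting to \<open>K\<close> does not change the values of \<open>g\<close>,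
    and the scaling to \<open>v $ j = 1\<close> makes \<open>v\<close> the image of
    \<open>axis j 1\<close> under the shear.\<close>
  define v where "v = coord_proj K *v (inverse (y $ j) *s y)"
  define w where "w = v - axis j 1"
  have vj: "v $ j = 1" using yj G(3) by (simp add: v_def)
  have w: "w $ j = 0" "coord_proj K *v w = w"
    using vj G(3) by (auto simp: w_def vec_eq_iff axis_def v_def)
  have yv: "y $ j *s v = coord_proj K *v y" using yj by (simp add: v_def vec_eq_iff)
  have nv: "norm (coord_proj K *v y) \<le> norm y"
    unfolding norm_vec_def by (rule L2_set_mono) auto
  have ne: "g (y $ j *s v) \<noteq> 0" using e(3)[OF y(1)] y(2) yv by simp
  have "germ_proj {j} (germ_subst (shear j w) G) \<noteq> 0"
  proof
    assume "germ_proj {j} (germ_subst (shear j w) G) = 0"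
    then have "germ_subst (shear j w ** coord_proj {j}) G = 0" by (simp add: germ_subst_subst)
    then have "eventually (\<lambda>x. g ((shear j w ** coord_proj {j}) *v x) = 0) (nhds 0)"
      using g holomorphic_near_0_matrix[OF g(1), of "shear j w ** coord_proj {j}"]
      by (simp add: germ_subst.abs_eq germ_eq_refl_iff zero_germ.abs_eq abs_germ_eq_iff holomorphic_near_0_const)
    moreover have "(shear j w ** coord_proj {j}) *v x = x $ j *s v" for x
      by (simp add: shear_mult_vec coord_proj_eq_axis w_def vec_eq_iff axis_def algebra_simps
          flip: matrix_vector_mul_assoc)
    ultimately have "eventually (\<lambda>x. g (x $ j *s v) = 0) (nhds 0)" by simp
    from eventually_compose_filterlim[OF this filterlim_line[of "axis j 1"]]
    have "eventually (\<lambda>z. g (z *s v) = 0) (nhds 0)" by simp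
    then obtain s where s: "s > 0" "\<And>z. cmod z < s \<Longrightarrow> g (z *s v) = 0"
      unfolding eventually_nhds_metric by (auto simp: dist_norm)
    let ?R = "e / norm v"
    have v0: "norm v > 0" using vj by auto
    have "g (y $ j *s v) = 0"
    \<comment> \<open>Vanishing is known near 0 only; it spreads over the disc of radius e / norm v,
      which contains \<open>y $ j\<close> because projecting does not increase the norm of
      \<open>y\<close>.\<close>
    proof (rule analytic_continuation[of "\<lambda>z. g (z *s v)" "ball 0 ?R" "ball 0 (min s ?R)" 0])
      show "(\<lambda>z. g (z *s v)) holomorphic_on ball 0 ?R"
        by (rule holomorphic_on_line[OF e(2)]) (use v0 in \<open>auto simp: norm_vector_smult field_simps\<close>)
      show "(0::complex) islimpt ball 0 (min s ?R)"
        using s(1) v0 e(1) by (simp add: islimpt_ball)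
      have "cmod (y $ j) * norm v < e"
        using nv y(1) by (simp flip: norm_vector_smult add: yv)
      then show "y $ j \<in> ball 0 ?R" using v0 by (simp add: field_simps)
    qed (use s v0 e in auto)
    with ne show False ..
  qed
  with w show ?thesis by blast
qed

section \<open>The ring of germs is Noetherian\<close>

text \<open>One predicate covers the ideals of a ring and the modules over a subring
  \<open>S\<close> inside it; the Noetherian induction needs both at once. Differences come from
  \<open>-1 \<in> S\<close>.\<close>

definition submodule_over :: "'a::comm_ring_1 set \<Rightarrow> 'a set \<Rightarrow> bool" where
  "submodule_over S J \<longleftrightarrow> 0 \<in> J \<and> (\<forall>x\<in>J. \<forall>y\<in>J. x + y \<in> J) \<and> (\<forall>a\<in>S. \<forall>x\<in>J. a * x \<in> J)"

lemma submodule_overI: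
  "0 \<in> J \<Longrightarrow> (\<And>x y. x \<in> J \<Longrightarrow> y \<in> J \<Longrightarrow> x + y \<in> J) \<Longrightarrow> (\<And>a x. a \<in> S \<Longrightarrow> x \<in> J \<Longrightarrow> a * x \<in> J)
     \<Longrightarrow> submodule_over S J"
  by (auto simp: submodule_over_def)

lemma submodule_overD:
  assumes "submodule_over S J"
  shows "0 \<in> J" "x \<in> J \<Longrightarrow> y \<in> J \<Longrightarrow> x + y \<in> J" "a \<in> S \<Longrightarrow> x \<in> J \<Longrightarrow> a * x \<in> J"
  using assms by (auto simp: submodule_over_def)

lemma submodule_over_sum:
  "submodule_over S J \<Longrightarrow> (\<And>i. i \<in> X \<Longrightarrow> f i \<in> J) \<Longrightarrow> sum f X \<in> J"
  by (induction X rule: infinite_finite_induct) (auto intro: submodule_overD)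

lemma submodule_over_diff:
  assumes "submodule_over S J" "-1 \<in> S" "x \<in> J" "y \<in> J"
  shows "x - y \<in> J"
  using submodule_overD(2)[OF assms(1,3) submodule_overD(3)[OF assms(1,2,4)]] by simp

lemma submodule_over_hull: "submodule_over S (submodule_over S hull G)"
  by (rule hull_in) (auto simp: submodule_over_def)

lemma submodule_over_hull_least: "G \<subseteq> J \<Longrightarrow> submodule_over S J \<Longrightarrow> submodule_over S hull G \<subseteq> J"
  by (rule hull_minimal)

definition finitely_generated :: "'a::comm_ring_1 set \<Rightarrow> 'a set \<Rightarrow> bool" where
  "finitely_generated S J \<longleftrightarrow> (\<exists>G. finite G \<and> G \<subseteq> J \<and> J \<subseteq> submodule_over S hull G)"

definition noetherian :: "'a::comm_ring_1 set \<Rightarrow> bool" where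
  "noetherian S \<longleftrightarrow> (\<forall>J. submodule_over S J \<and> J \<subseteq> S \<longrightarrow> finitely_generated S J)"

lemma finitely_generated_0: "finitely_generated S {0}"
  unfolding finitely_generated_def
  using submodule_overD(1)[OF submodule_over_hull] by (intro exI[of _ "{}"]) auto

text \<open>Hilbert's leading-coefficient argument for one new module generator \<open>t\<close>.
  The coefficient \<open>c\<close> of an element need not be unique, but two elements of
  \<open>J\<close> sharing a coefficient differ by an element of \<open>J \<inter> V\<close>, where
  generators are already known.\<close>

lemma noetherian_extend_by_one:
  assumes S: "noetherian S" "0 \<in> S" "-1 \<in> S" "\<And>x y. x \<in> S \<Longrightarrow> y \<in> S \<Longrightarrow> x + y \<in> S"
      "\<And>x y. x \<in> S \<Longrightarrow> y \<in> S \<Longrightarrow> x * y \<in> S"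
    and J: "submodule_over S J" and V: "submodule_over S V" and fg: "finitely_generated S (J \<inter> V)"
  shows "finitely_generated S (J \<inter> {v + c * t | v c. v \<in> V \<and> c \<in> S})"
proof -
  \<comment> \<open>the ideal of leading coefficients\<close>
  define L where "L H = {c \<in> S. \<exists>v\<in>V. v + c * t \<in> H}" for H
  have L: "submodule_over S (L H)" if H: "submodule_over S H" for H
  proof (rule submodule_overI)
    show "0 \<in> L H"
      using S(2) submodule_overD(1)[OF V] submodule_overD(1)[OF H] unfolding L_def by force
    fix x y assume "x \<in> L H" "y \<in> L H"
    then obtain v u where vu: "x \<in> S" "v \<in> V" "v + x * t \<in> H" "y \<in> S" "u \<in> V" "u + y * t \<in> H"
      unfolding L_def by blast
    have "(v + u) + (x + y) * t \<in> H"
      using submodule_overD(2)[OF H vu(3,6)] by (simp add: algebra_simps)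
    then show "x + y \<in> L H" using vu S(4) submodule_overD(2)[OF V] unfolding L_def by blast
  next
    fix a x assume a: "a \<in> S" "x \<in> L H"
    then obtain v where v: "x \<in> S" "v \<in> V" "v + x * t \<in> H" unfolding L_def by blast
    have "a * v + (a * x) * t \<in> H"
      using submodule_overD(3)[OF H a(1) v(3)] by (simp add: algebra_simps)
    then show "a * x \<in> L H" using v a S(5) submodule_overD(3)[OF V] unfolding L_def by blast
  qed
  obtain C where C: "finite C" "C \<subseteq> L J" "L J \<subseteq> submodule_over S hull C"
    using S(1) L[OF J] unfolding noetherian_def finitely_generated_def by (metis (lifting) L_def mem_Collect_eq subsetI)
  obtain G where G: "finite G" "G \<subseteq> J \<inter> V" "J \<inter> V \<subseteq> submodule_over S hull G"
    using fg unfolding finitely_generated_def by blast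
  have "\<forall>c\<in>C. \<exists>v. v \<in> V \<and> v + c * t \<in> J" using C(2) unfolding L_def by blast
  then obtain v where v: "\<And>c. c \<in> C \<Longrightarrow> v c \<in> V \<and> v c + c * t \<in> J" by metis
  define G' where "G' = (\<lambda>c. v c + c * t) ` C \<union> G"
  let ?H = "submodule_over S hull G'"
  note H = submodule_over_hull[of S G']
  have GG: "G' \<subseteq> ?H" by (rule hull_subset)
  have GJ: "G' \<subseteq> J" using v G(2) by (auto simp: G'_def)
  have HJ: "?H \<subseteq> J" by (rule submodule_over_hull_least[OF GJ J])
  \<comment> \<open>The coefficients attained on the hull form a submodule, so reaching the
    generators \<open>C\<close> reaches every coefficient that occurs in \<open>J\<close>.\<close>
  have "C \<subseteq> L ?H" using v GG C(2) unfolding G'_def L_def by blast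
  then have "submodule_over S hull C \<subseteq> L ?H" by (rule hull_minimal) (rule L[OF H])
  with C(3) have LL: "L J \<subseteq> L ?H" by blast
  have GH: "J \<inter> V \<subseteq> ?H"
    using G(3) hull_mono[of G G' "submodule_over S"] by (auto simp: G'_def)
  show ?thesis unfolding finitely_generated_def
  proof (intro exI[of _ G'] conjI subsetI)
    show "finite G'" using C(1) G(1) by (simp add: G'_def)
    fix f assume "f \<in> G'"
    then consider c where "c \<in> C" "f = v c + c * t" | "f \<in> J" "f \<in> V" using G(2) by (auto simp: G'_def)
    then show "f \<in> J \<inter> {v + c * t | v c. v \<in> V \<and> c \<in> S}"
    proof cases
      case 1
      then show ?thesis using v C(2) unfolding L_def by blast
    next
      case 2
      then show ?thesis using S(2) by force
    qed
  next
    fix f assume "f \<in> J \<inter> {v + c * t | v c. v \<in> V \<and> c \<in> S}"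
    then obtain u c where f: "f \<in> J" "f = u + c * t" "u \<in> V" "c \<in> S" by blast
    then have "c \<in> L J" unfolding L_def by blast
    then obtain u' where u': "u' \<in> V" "u' + c * t \<in> ?H" using LL unfolding L_def by blast
    have "f - (u' + c * t) \<in> J" using submodule_over_diff[OF J S(3) f(1)] u'(2) HJ by blast
    moreover have "f - (u' + c * t) = u - u'" by (simp add: f(2))
    moreover have "u - u' \<in> V" by (rule submodule_over_diff[OF V S(3) f(3) u'(1)])
    ultimately have "f - (u' + c * t) \<in> ?H" using GH by (metis IntI subsetD)
    from submodule_overD(2)[OF H this u'(2)] show "f \<in> ?H" by simp
  qed
qed

text \<open>Modulo \<open>g\<close> every element of \<open>J\<close> lies in \<open>V d\<close>,
  the polynomials in \<open>w\<close> of degree below \<open>d\<close> over \<open>S\<close>. Adding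
  one power of \<open>w\<close> at a time gives finitely many generators of
  \<open>J \<inter> V d\<close> over \<open>S\<close>; together with \<open>g\<close> they generate
  \<open>J\<close> over \<open>B\<close>.\<close>

lemma noetherian_extension:
  assumes S: "noetherian S" "0 \<in> S" "-1 \<in> S" "\<And>x y. x \<in> S \<Longrightarrow> y \<in> S \<Longrightarrow> x + y \<in> S"
      "\<And>x y. x \<in> S \<Longrightarrow> y \<in> S \<Longrightarrow> x * y \<in> S"
    and B: "S \<subseteq> B" and J: "submodule_over B J" and g: "g \<in> J"
    and div: "\<And>f. f \<in> J \<Longrightarrow> \<exists>q\<in>B. \<exists>r. (\<forall>i<d. r i \<in> S) \<and> f = q * g + (\<Sum>i<d. r i * w ^ i)"
  shows "finitely_generated B J"
proof -
  define V where "V e = {\<Sum>i<e. r i * w ^ i | r. \<forall>i<e. r i \<in> S}" for e :: nat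
  have JS: "submodule_over S J" using J B by (auto simp: submodule_over_def)
  have V_I: "(\<Sum>i<e. r i * w ^ i) \<in> V e" if "\<forall>i<e. r i \<in> S" for e r
    unfolding V_def using that by blast
  have V: "submodule_over S (V e)" for e
  proof (rule submodule_overI)
    show "0 \<in> V e" unfolding V_def using S(2) by (auto intro!: exI[of _ "\<lambda>_. 0"])
    fix x y assume "x \<in> V e" "y \<in> V e"
    then obtain r s where r: "\<forall>i<e. r i \<in> S" "\<forall>i<e. s i \<in> S" and xy: "x = (\<Sum>i<e. r i * w ^ i)" "y = (\<Sum>i<e. s i * w ^ i)"
      unfolding V_def by blast
    have "x + y = (\<Sum>i<e. (r i + s i) * w ^ i)" by (simp add: xy sum.distrib algebra_simps)
    moreover have "\<forall>i<e. r i + s i \<in> S" using S(4) r by blast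
    ultimately show "x + y \<in> V e" using V_I[of e "\<lambda>i. r i + s i"] by simp
  next
    fix a x assume a: "a \<in> S" "x \<in> V e"
    then obtain r where r: "\<forall>i<e. r i \<in> S" and x: "x = (\<Sum>i<e. r i * w ^ i)" unfolding V_def by blast
    have "a * x = (\<Sum>i<e. (a * r i) * w ^ i)" by (simp add: x sum_distrib_left mult.assoc)
    moreover have "\<forall>i<e. a * r i \<in> S" using S(5) r a by blast
    ultimately show "a * x \<in> V e" using V_I[of e "\<lambda>i. a * r i"] by simp
  qed
  have V_Suc: "V (Suc e) = {v + c * w ^ e | v c. v \<in> V e \<and> c \<in> S}" for e
  proof (intro equalityI subsetI)
    fix x assume "x \<in> V (Suc e)"
    then show "x \<in> {v + c * w ^ e | v c. v \<in> V e \<and> c \<in> S}"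
      unfolding V_def by fastforce
  next
    fix x assume "x \<in> {v + c * w ^ e | v c. v \<in> V e \<and> c \<in> S}"
    then obtain r c where r: "\<forall>i<e. r i \<in> S" "c \<in> S" "x = (\<Sum>i<e. r i * w ^ i) + c * w ^ e" unfolding V_def by blast
    then have "x = (\<Sum>i<Suc e. (r(e := c)) i * w ^ i)" by simp
    moreover have "\<forall>i<Suc e. (r(e := c)) i \<in> S" using r by simp
    ultimately show "x \<in> V (Suc e)" unfolding V_def by blast
  qed
  have "finitely_generated S (J \<inter> V e)" for e
  proof (induction e)
    case 0
    have "J \<inter> V 0 = {0}" using submodule_overD(1)[OF J] by (auto simp: V_def)
    then show ?case by (simp add: finitely_generated_0)
  next
    case (Suc e)
    show ?case unfolding V_Suc by (rule noetherian_extend_by_one[OF S JS V Suc])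
  qed
  from this[of d] obtain G where G: "finite G" "G \<subseteq> J \<inter> V d" "J \<inter> V d \<subseteq> submodule_over S hull G"
    unfolding finitely_generated_def by blast
  let ?H = "submodule_over B hull (insert g G)"
  note H = submodule_over_hull[of B "insert g G"]
  have sub: "insert g G \<subseteq> ?H" by (rule hull_subset)
  have "submodule_over S ?H" using H B by (auto simp: submodule_over_def)
  then have GH: "J \<inter> V d \<subseteq> ?H" using G(3) sub hull_minimal[of G ?H "submodule_over S"] by blast
  show ?thesis unfolding finitely_generated_def
  proof (intro exI[of _ "insert g G"] conjI subsetI)
    fix f assume f: "f \<in> J"
    then obtain q r where q: "q \<in> B" "\<forall>i<d. r i \<in> S" "f = q * g + (\<Sum>i<d. r i * w ^ i)" using div by blast
    have "f - q * g \<in> J" using submodule_over_diff[OF J _ f submodule_overD(3)[OF J q(1) g]] S(3) B by blast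
    moreover have "f - q * g \<in> V d" using q unfolding V_def by auto
    ultimately have "f - q * g \<in> ?H" using GH by blast
    moreover have "q * g \<in> ?H" using submodule_overD(3)[OF H q(1)] sub by blast
    ultimately show "f \<in> ?H" using submodule_overD(2)[OF H] by fastforce
  qed (use G g in auto)
qed

section \<open>Induction on the set of variables\<close>

lemma germ_subst_uminus_1: "germ_subst A (-1) = -1"
  by transfer (simp add: germ_eq_def holomorphic_near_0_const)

lemma germ_value_subst [simp]: "germ_value (germ_subst A f) = germ_value f"
  by transfer simp

text \<open>The dimension is a type here, so the induction on the number of variables runs over the sets
  \<open>K\<close> of coordinates on which the germs depend.\<close>

definition germs_in :: "'n set \<Rightarrow> ('n::finite) germ set" where
  "germs_in K = {f. germ_proj K f = f}"

text \<open>Germs in no variables are the constants, a field, so any nonzero element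
  generates.\<close>

lemma noetherian_germs_in_empty: "noetherian (germs_in {} :: ('n::finite) germ set)"
  unfolding noetherian_def
proof (intro allI impI, elim conjE)
  fix J :: "'n germ set" assume J: "submodule_over (germs_in {}) J" "J \<subseteq> germs_in {}"
  show "finitely_generated (germs_in {}) J"
  proof (cases "J = {0}")
    case True
    then show ?thesis by (simp add: finitely_generated_0)
  next
    case False
    then obtain f where f: "f \<in> J" "f \<noteq> 0" using submodule_overD(1)[OF J(1)] by blast
    then have fc: "f = germ_const (germ_value f)" using J(2) by (auto simp: germs_in_def germ_proj_empty)
    then have v: "germ_value f \<noteq> 0" using f(2) germ_const_hom(1) by metis
    show ?thesis unfolding finitely_generated_def
    proof (intro exI[of _ "{f}"] conjI subsetI)
      fix h assume "h \<in> J"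
      then have h: "h = germ_const (germ_value h)" using J(2) by (auto simp: germs_in_def germ_proj_empty)
      have "h = germ_const (germ_value h / germ_value f) * f"
        using v h fc by (metis germ_const_hom(4) nonzero_divide_eq_eq)
      moreover have "germ_const (germ_value h / germ_value f) \<in> germs_in {}"
        by (simp add: germs_in_def germ_proj_empty)
      moreover have "f \<in> submodule_over (germs_in {}) hull {f}" by (simp add: hull_inc)
      ultimately show "h \<in> submodule_over (germs_in {}) hull {f}"
        using submodule_overD(3)[OF submodule_over_hull] by metis
    qed (use f in auto)
  qed
qed

lemma germs_in_closed:
  "0 \<in> germs_in K" "-1 \<in> germs_in K" "x \<in> germs_in K \<Longrightarrow> y \<in> germs_in K \<Longrightarrow> x + y \<in> germs_in K"
  "x \<in> germs_in K \<Longrightarrow> y \<in> germs_in K \<Longrightarrow> x * y \<in> germs_in K"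
  by (simp_all add: germs_in_def germ_subst_uminus_1)

text \<open>The division takes place in all variables and is then projected to
  \<open>insert j K\<close>. The projection fixes \<open>f\<close>, \<open>G\<close> and the
  variable; remainder coefficients free of \<open>x $ j\<close> land in the germs over
  \<open>K\<close>, and \<open>U\<close> is absorbed into the quotient.\<close>

lemma germs_in_division:
  assumes "j \<notin> K" "germ_proj {j} (U * G) = germ_var j ^ d" "G \<in> germs_in (insert j K)" "f \<in> germs_in (insert j K)"
  shows "\<exists>q\<in>germs_in (insert j K). \<exists>r. (\<forall>i<d. r i \<in> germs_in K) \<and> f = q * G + (\<Sum>i<d. r i * germ_var j ^ i)"
proof -
  let ?P = "germ_proj (insert j K)"
  from germ_weierstrass_division[OF assms(2), of f] obtain q r where
    r: "\<And>i. i < d \<Longrightarrow> germ_proj (- {j}) (r i) = r i" and f: "f = q * (U * G) + (\<Sum>i<d. r i * germ_var j ^ i)" by blast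
  have "f = ?P f" using assms(4) by (simp add: germs_in_def)
  also have "\<dots> = ?P (q * U) * G + (\<Sum>i<d. ?P (r i) * germ_var j ^ i)"
    using assms(3) by (subst f) (simp add: germs_in_def germ_proj_var mult.assoc)
  finally have "f = ?P (q * U) * G + (\<Sum>i<d. ?P (r i) * germ_var j ^ i)" .
  moreover have "?P (q * U) \<in> germs_in (insert j K)" by (simp add: germs_in_def germ_proj_proj)
  moreover have "?P (r i) \<in> germs_in K" if "i < d" for i
  proof -
    have eq: "insert j K \<inter> - {j} = K" using assms(1) by auto
    have "?P (r i) = germ_proj (insert j K \<inter> - {j}) (r i)" using r[OF that] germ_proj_proj by metis
    then show ?thesis by (simp add: eq germs_in_def germ_proj_proj)
  qed
  ultimately show ?thesis by (intro bexI[of _ "?P (q * U)"] exI[of _ "\<lambda>i. ?P (r i)"]) auto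
qed

text \<open>A shear is an automorphism of the germs over \<open>insert j K\<close>. It makes one
  element of \<open>J\<close> regular, so \<open>noetherian_extension\<close> applies to the image
  of \<open>J\<close>, and the inverse shear carries the generators back.\<close>

lemma noetherian_germs_in_insert:
  assumes "noetherian (germs_in K)" "j \<notin> K"
  shows "noetherian (germs_in (insert j K) :: ('n::finite) germ set)"
  unfolding noetherian_def
proof (intro allI impI, elim conjE)
  let ?B = "germs_in (insert j K) :: 'n germ set"
  fix J :: "'n germ set" assume J: "submodule_over ?B J" "J \<subseteq> ?B"
  show "finitely_generated ?B J"
  proof (cases "J = {0}")
    case True
    then show ?thesis by (simp add: finitely_generated_0)
  next
    case False
    then obtain G where G: "G \<in> J" "G \<noteq> 0" using submodule_overD(1)[OF J(1)] by blast
    then obtain w where w: "w $ j = 0" "coord_proj (insert j K) *v w = w"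
      "germ_proj {j} (germ_subst (shear j w) G) \<noteq> 0"
      using germ_shear_regular[of G "insert j K" j] J(2) by (auto simp: germs_in_def)
    let ?\<phi> = "germ_subst (shear j w)" and ?\<psi> = "germ_subst (shear j (- w))"
    have mw: "coord_proj (insert j K) *v (- w) = - w"
      using w(2) by (auto simp: vec_eq_iff split: if_splits)
    have \<phi>\<psi>: "?\<psi> (?\<phi> x) = x" for x
      using shear_inverse[of w j] w(1) by (simp add: germ_subst_subst germ_subst_id)
    have B: "?\<phi> x \<in> ?B" "?\<psi> x \<in> ?B" if "x \<in> ?B" for x
      using that shear_commute_proj[of j "insert j K"] w(2) mw by (auto simp: germs_in_def) (metis germ_subst_subst insertI1)+
    have \<psi>\<phi>: "?\<phi> (?\<psi> x) = x" for x
      using shear_inverse[of "- w" j] w(1) by (simp add: germ_subst_subst germ_subst_id)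
    have J': "submodule_over ?B (?\<phi> ` J)"
    proof (rule submodule_overI)
      show "0 \<in> ?\<phi> ` J" using submodule_overD(1)[OF J(1)] by force
      show "x + y \<in> ?\<phi> ` J" if "x \<in> ?\<phi> ` J" "y \<in> ?\<phi> ` J" for x y
        using that submodule_overD(2)[OF J(1)] by (auto simp flip: germ_subst_hom(3))
      fix a x assume a: "a \<in> ?B" "x \<in> ?\<phi> ` J"
      then obtain y where y: "y \<in> J" "x = ?\<phi> y" by blast
      \<comment> \<open>The shear is not linear over the germs: scalars have to be pulled back as
        well.\<close>
      have "a * x = ?\<phi> (?\<psi> a * y)" using \<psi>\<phi> y by simp
      then show "a * x \<in> ?\<phi> ` J" using submodule_overD(3)[OF J(1) B(2)[OF a(1)] y(1)] by blast
    qed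
    from germ_axis_regular[OF w(3)] obtain d U where U: "germ_proj {j} (U * ?\<phi> G) = germ_var j ^ d" by blast
    have sub: "germs_in K \<subseteq> ?B"
      by (auto simp: germs_in_def) (metis germ_proj_proj Int_absorb1 subset_insertI)
    have "finitely_generated ?B (?\<phi> ` J)"
    proof (rule noetherian_extension[OF assms(1) germs_in_closed(1,2) _ _ sub J'])
      show "?\<phi> G \<in> ?\<phi> ` J" using G(1) by blast
      fix f assume "f \<in> ?\<phi> ` J"
      then have "f \<in> ?B" using J(2) B(1) by blast
      moreover have "?\<phi> G \<in> ?B" using G(1) J(2) B(1) by blast
      ultimately show "\<exists>q\<in>?B. \<exists>r. (\<forall>i<d. r i \<in> germs_in K) \<and> f = q * ?\<phi> G + (\<Sum>i<d. r i * germ_var j ^ i)"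
        by (intro germs_in_division[OF assms(2) U])
    qed (fact germs_in_closed)+
    then obtain X where X: "finite X" "X \<subseteq> ?\<phi> ` J" "?\<phi> ` J \<subseteq> submodule_over ?B hull X"
      unfolding finitely_generated_def by blast
    let ?H = "submodule_over ?B hull (?\<psi> ` X)"
    note H = submodule_over_hull[of ?B "?\<psi> ` X"]
    \<comment> \<open>The preimage of the hull under the inverse shear is again a submodule and
      contains \<open>X\<close>, hence all of the image of \<open>J\<close>.\<close>
    have "submodule_over ?B {x. ?\<psi> x \<in> ?H}"
      by (rule submodule_overI) (auto intro: submodule_overD[OF H] B)
    moreover have "X \<subseteq> {x. ?\<psi> x \<in> ?H}" using hull_subset[of "?\<psi> ` X"] by blast
    ultimately have "submodule_over ?B hull X \<subseteq> {x. ?\<psi> x \<in> ?H}" by (intro hull_minimal)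
    with X(3) have "J \<subseteq> ?H" using \<phi>\<psi> by (force simp: subset_iff)
    moreover have "?\<psi> ` X \<subseteq> J" using X(2) \<phi>\<psi> by (force simp: subset_iff)
    ultimately show ?thesis unfolding finitely_generated_def using X(1) by blast
  qed
qed

theorem noetherian_germs: "noetherian (UNIV :: ('n::finite) germ set)"
proof -
  have "noetherian (germs_in K :: 'n germ set)" if "finite K" for K
    using that by induction (auto intro: noetherian_germs_in_empty noetherian_germs_in_insert)
  from this[OF finite[of UNIV]] show ?thesis by (simp add: germs_in_def germ_proj_UNIV)
qed

section \<open>Back to ideals, their generators and the maximal ideal\<close>

lemma ideal_iff_submodule_over:
  fixes R :: "'a::comm_ring_1 ring"
  assumes "cring R" and R: "\<And>x y. x \<otimes>\<^bsub>R\<^esub> y = x * y" "\<And>x y. x \<oplus>\<^bsub>R\<^esub> y = x + y" "\<zero>\<^bsub>R\<^esub> = 0"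
    and neg: "\<And>x. x \<in> carrier R \<Longrightarrow> - x \<in> carrier R" "- 1 \<in> carrier R"
  shows "ideal I R \<longleftrightarrow> I \<subseteq> carrier R \<and> submodule_over (carrier R) I"
proof
  assume "ideal I R"
  then interpret I: ideal I R .
  note sub = I.is_additive_subgroup
  show "I \<subseteq> carrier R \<and> submodule_over (carrier R) I"
    using additive_subgroup.a_subset[OF sub] additive_subgroup.zero_closed[OF sub]
      additive_subgroup.a_closed[OF sub] I.I_l_closed
    by (auto intro!: submodule_overI simp: R)
next
  interpret R: cring R by (rule assms)
  assume "I \<subseteq> carrier R \<and> submodule_over (carrier R) I"
  then have sub: "I \<subseteq> carrier R" and I: "submodule_over (carrier R) I" by blast+
  show "ideal I R"
  proof (rule idealI)
    show "ring R" by (rule R.ring_axioms)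
    show "subgroup I (add_monoid R)"
    proof (rule group.subgroupI)
      show "group (add_monoid R)" by (rule R.a_group)
      show "I \<noteq> {}" using submodule_overD(1)[OF I] by auto
      show "I \<subseteq> carrier (add_monoid R)" using sub by simp
      fix a b assume a: "a \<in> I" and b: "b \<in> I"
      then show "a \<otimes>\<^bsub>add_monoid R\<^esub> b \<in> I" using submodule_overD(2)[OF I] by (simp add: R)
      have "\<ominus>\<^bsub>R\<^esub> a = - a" by (rule R.minus_equality) (use a sub neg in \<open>auto simp: R\<close>)
      then show "inv\<^bsub>add_monoid R\<^esub> a \<in> I"
        using submodule_overD(3)[OF I neg(2) a] by (simp add: a_inv_def)
    qed
    fix a x assume "a \<in> I" "x \<in> carrier R"
    from submodule_overD(3)[OF I this(2,1)]
    show "x \<otimes>\<^bsub>R\<^esub> a \<in> I" "a \<otimes>\<^bsub>R\<^esub> x \<in> I" by (simp_all add: R mult.commute)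
  qed
qed

lemma ideal_germ_ring_iff: "ideal I germ_ring \<longleftrightarrow> submodule_over UNIV (I :: ('n::finite) germ set)"
  using ideal_iff_submodule_over[OF cring_germ_ring, of I] by simp

lemma genideal_germ_ring: "genideal germ_ring G = submodule_over UNIV hull G"
  by (simp add: genideal_def hull_def ideal_germ_ring_iff)

lemma ideal_germ_ring_finite_generators:
  assumes "ideal J germ_ring"
  obtains G where "finite G" "J = genideal germ_ring G"
proof -
  have J: "submodule_over UNIV J" using assms by (simp add: ideal_germ_ring_iff)
  with noetherian_germs obtain G where G: "finite G" "G \<subseteq> J" "J \<subseteq> submodule_over UNIV hull G"
    unfolding noetherian_def finitely_generated_def by blast
  then have "J = genideal germ_ring G"
    unfolding genideal_germ_ring using submodule_over_hull_least[OF G(2) J] by blast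
  with G(1) show ?thesis by (rule that)
qed

text \<open>Division by the variable itself, with \<open>d = 1\<close>, leaves a remainder in one
  variable fewer and with the same value at 0. After all variables are removed only the constant 0
  is left.\<close>

lemma max_ideal_eq: "max_ideal = {f. germ_value f = 0}"
proof
  show "max_ideal \<subseteq> {f. germ_value f = 0}"
    unfolding max_ideal_def genideal_germ_ring
    by (rule hull_minimal) (auto intro!: submodule_overI)
  have M: "submodule_over UNIV (max_ideal :: 'a germ set)"
    unfolding max_ideal_def genideal_germ_ring by (rule submodule_over_hull)
  have "f \<in> max_ideal" if "finite K" "f \<in> germs_in K" "germ_value f = 0" for K and f :: "'a germ"
    using that
  proof (induction arbitrary: f)
    case empty
    then show ?case using submodule_overD(1)[OF M] by (simp add: germs_in_def germ_proj_empty germ_const_hom)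
  next
    case (insert j K)
    have "germ_proj {j} (1 * germ_var j) = germ_var j ^ 1" by (simp add: germ_proj_var)
    from germs_in_division[OF insert.hyps(2) this _ insert.prems(1)] obtain q r
      where q: "r \<in> germs_in K" "f = q * germ_var j + r"
      by (auto simp: germs_in_def germ_proj_var)
    then have "r \<in> max_ideal" using insert by simp
    moreover have "germ_var j \<in> max_ideal"
      unfolding max_ideal_def genideal_germ_ring by (simp add: hull_inc)
    ultimately show ?case using q(2) submodule_overD(2,3)[OF M] by simp
  qed
  from this[OF finite[of UNIV]] show "{f. germ_value f = 0} \<subseteq> (max_ideal :: 'a germ set)"
    by (auto simp: germs_in_def germ_proj_UNIV)
qed

section \<open>Evaluation of polynomials over the germs\<close>

lemma lookup_map_hom: "f 0 = 0 \<Longrightarrow> Poly_Mapping.lookup (Poly_Mapping.map f p) m = f (Poly_Mapping.lookup p m)"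
  by (simp add: Poly_Mapping.map.rep_eq when_def)

lemma mpoly_induct [case_names zero single add]:
  assumes "P 0" "\<And>m c. P (Poly_Mapping.single m c)" "\<And>p q. P p \<Longrightarrow> P q \<Longrightarrow> P (p + q)"
  shows "P (p :: ('k \<Rightarrow>\<^sub>0 'a::comm_ring_1))"
proof (induction p rule: update_induct)
  case (update f a b)
  have "Poly_Mapping.update a b f = f + Poly_Mapping.single a b"
    using update(1) by (intro poly_mapping_eqI) (auto simp: lookup_update lookup_add lookup_single when_def in_keys_iff)
  with update assms show ?case by metis
qed (simp add: assms(1))

lemma mpoly_eq_sum_single: "p = (\<Sum>m\<in>Poly_Mapping.keys p. Poly_Mapping.single m (Poly_Mapping.lookup p m))"
  by (rule poly_mapping_eqI) (simp add: lookup_sum lookup_single when_def in_keys_iff)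

definition mon_eval :: "(nat \<Rightarrow> 'b::comm_ring_1) \<Rightarrow> (nat \<Rightarrow>\<^sub>0 nat) \<Rightarrow> 'b" where
  "mon_eval a m = (\<Prod>i\<in>Poly_Mapping.keys m. a i ^ Poly_Mapping.lookup m i)"

definition mpoly_eval :: "('a::comm_ring_1 \<Rightarrow> 'b::comm_ring_1) \<Rightarrow> (nat \<Rightarrow> 'b) \<Rightarrow> 'a mpoly \<Rightarrow> 'b" where
  "mpoly_eval \<phi> a p = (\<Sum>m\<in>Poly_Mapping.keys p. \<phi> (Poly_Mapping.lookup p m) * mon_eval a m)"

lemma mon_eval_superset:
  "finite X \<Longrightarrow> Poly_Mapping.keys m \<subseteq> X \<Longrightarrow> mon_eval a m = (\<Prod>i\<in>X. a i ^ Poly_Mapping.lookup m i)"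
  unfolding mon_eval_def by (rule prod.mono_neutral_left) (auto simp: in_keys_iff)

lemma mon_eval_add: "mon_eval a (m + n) = mon_eval a m * mon_eval a n"
proof -
  let ?X = "Poly_Mapping.keys m \<union> Poly_Mapping.keys n"
  have "mon_eval a (m + n) = (\<Prod>i\<in>?X. a i ^ Poly_Mapping.lookup (m + n) i)"
    by (rule mon_eval_superset) (auto dest: Poly_Mapping.keys_add[THEN subsetD])
  also have "\<dots> = (\<Prod>i\<in>?X. a i ^ Poly_Mapping.lookup m i) * (\<Prod>i\<in>?X. a i ^ Poly_Mapping.lookup n i)"
    by (simp add: lookup_add power_add prod.distrib)
  also have "\<dots> = mon_eval a m * mon_eval a n"
    by (simp add: mon_eval_superset[of ?X])
  finally show ?thesis .
qed

text \<open>Instantiated twice: with \<open>id\<close>, to replace the variables by constant germs,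
  and with the value at 0 into \<open>complex poly\<close>, to describe a point of Proj.\<close>

locale mpoly_evaluation =
  fixes \<phi> :: "'a::comm_ring_1 \<Rightarrow> 'b::comm_ring_1" and a :: "nat \<Rightarrow> 'b"
  assumes hom: "\<phi> 0 = 0" "\<phi> 1 = 1" "\<phi> (x + y) = \<phi> x + \<phi> y" "\<phi> (x * y) = \<phi> x * \<phi> y"
begin

abbreviation ev where "ev \<equiv> mpoly_eval \<phi> a"

lemma eval_superset:
  "finite X \<Longrightarrow> Poly_Mapping.keys p \<subseteq> X \<Longrightarrow> ev p = (\<Sum>m\<in>X. \<phi> (Poly_Mapping.lookup p m) * mon_eval a m)"
  unfolding mpoly_eval_def by (rule sum.mono_neutral_left) (auto simp: in_keys_iff hom)

lemma eval_0 [simp]: "ev 0 = 0"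
  by (simp add: mpoly_eval_def)

lemma eval_add [simp]: "ev (p + q) = ev p + ev q"
  unfolding mpoly_eval_def
  by (rule setsum_keys_plus_distrib) (auto simp: hom algebra_simps)

lemma eval_sum [simp]: "ev (sum f X) = (\<Sum>i\<in>X. ev (f i))"
  by (induction X rule: infinite_finite_induct) auto

lemma eval_single: "ev (Poly_Mapping.single m c) = \<phi> c * mon_eval a m"
  by (subst eval_superset[of "{m}"]) (auto simp: lookup_single)

lemma eval_mult [simp]: "ev (p * q) = ev p * ev q"
proof (induction p rule: mpoly_induct)
  case (single m c)
  show ?case
    by (induction q rule: mpoly_induct)
       (simp_all add: mult_single eval_single hom mon_eval_add algebra_simps)
qed (simp_all add: algebra_simps)

lemma eval_const [simp]: "ev (const_poly c) = \<phi> c"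
  by (simp add: const_poly_def eval_single mon_eval_def)

lemma eval_var [simp]: "ev (var_poly i) = a i"
  by (simp add: var_poly_def eval_single hom mon_eval_def)

lemma eval_1 [simp]: "ev 1 = 1"
  using eval_const[of 1] hom by (simp add: const_poly_def)

end

section \<open>The linear form sigma and its Tjurina ideal\<close>

lemma const_poly_hom:
  "const_poly 0 = 0" "const_poly (x + y) = const_poly x + const_poly y"
  "const_poly (x * y) = const_poly x * const_poly y"
  by (simp_all add: const_poly_def single_add mult_single)

lemma const_poly_sum: "const_poly (sum f X) = (\<Sum>i\<in>X. const_poly (f i))"
  by (induction X rule: infinite_finite_induct) (auto simp: const_poly_hom)

lemma const_poly_in_carrier: "const_poly c \<in> carrier (poly_ring q)"
  by (auto simp: const_poly_def split: if_splits)

lemma var_poly_in_carrier: "i < q \<Longrightarrow> var_poly i \<in> carrier (poly_ring q)"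
  by (auto simp: var_poly_def split: if_splits)

lemma ideal_poly_ring_iff:
  "ideal I (poly_ring q) \<longleftrightarrow> I \<subseteq> carrier (poly_ring q) \<and> submodule_over (carrier (poly_ring q)) I"
  by (rule ideal_iff_submodule_over[OF cring_poly_ring]) auto

lemma poly_ring_sum_closed:
  "(\<And>i. i \<in> X \<Longrightarrow> f i \<in> carrier (poly_ring q)) \<Longrightarrow> sum f X \<in> carrier (poly_ring q)"
proof (induction X rule: infinite_finite_induct)
  case (insert x F)
  then have "f x \<in> carrier (poly_ring q)" "sum f F \<in> carrier (poly_ring q)" by blast+
  from poly_ring_add_closed[OF this] show ?case by (simp only: sum.insert[OF insert.hyps])
qed simp_all

lemma sigma_poly_in_carrier: "sigma_poly q g \<in> carrier (poly_ring q)"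
  unfolding sigma_poly_def
  by (intro poly_ring_sum_closed poly_ring_mult_closed const_poly_in_carrier var_poly_in_carrier) simp

text \<open>Collects relations among germs, one for each index \<open>i\<close>, into a single
  relation over the polynomial ring whose coefficients are linear forms; these forms become the
  matrix for Nakayama's lemma.\<close>

lemma sigma_poly_lincomb:
  "(\<Sum>l\<in>X. sigma_poly q (\<lambda>i. c i l) * const_poly (u l)) = sigma_poly q (\<lambda>i. \<Sum>l\<in>X. c i l * u l)"
  unfolding sigma_poly_def const_poly_sum const_poly_hom sum_distrib_right
  by (subst sum.swap) (simp add: mult_ac)

lemma sigma_poly_pderiv:
  "Poly_Mapping.map (germ_pderiv j) (sigma_poly q g) = sigma_poly q (\<lambda>i. germ_pderiv j (g i))"
proof (rule poly_mapping_eqI)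
  fix m
  have sum: "germ_pderiv j (sum f X) = (\<Sum>i\<in>X. germ_pderiv j (f i))" for f and X :: "nat set"
    by (induction X rule: infinite_finite_induct) (auto simp: germ_pderiv_0 germ_pderiv_add)
  show "Poly_Mapping.lookup (Poly_Mapping.map (germ_pderiv j) (sigma_poly q g)) m
      = Poly_Mapping.lookup (sigma_poly q (\<lambda>i. germ_pderiv j (g i))) m"
    by (simp add: lookup_map_hom germ_pderiv_0 sigma_poly_def const_poly_def var_poly_def mult_single
        lookup_sum sum lookup_single when_def if_distrib[of "germ_pderiv j"] cong: if_cong)
qed

lemma tjurina_sigma_eq:
  "tjurina_sigma q g = genideal (poly_ring q)
     (insert (sigma_poly q g) (range (\<lambda>j. sigma_poly q (\<lambda>i. germ_pderiv j (g i)))))"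
  by (simp add: tjurina_sigma_def sigma_poly_pderiv)

lemma tjurina_sigma_gens:
  "sigma_poly q g \<in> tjurina_sigma q g" "sigma_poly q (\<lambda>i. germ_pderiv j (g i)) \<in> tjurina_sigma q g"
proof -
  interpret cring "poly_ring q :: 'a germ mpoly ring" by (rule cring_poly_ring)
  have "insert (sigma_poly q g) (range (\<lambda>j. sigma_poly q (\<lambda>i. germ_pderiv j (g i)))) \<subseteq> tjurina_sigma q g"
    unfolding tjurina_sigma_eq by (rule genideal_self) (use sigma_poly_in_carrier in blast)
  then show "sigma_poly q g \<in> tjurina_sigma q g" "sigma_poly q (\<lambda>i. germ_pderiv j (g i)) \<in> tjurina_sigma q g"
    by blast+
qed

lemma ideal_tjurina_sigma: "ideal (tjurina_sigma q g) (poly_ring q)"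
proof -
  interpret cring "poly_ring q :: 'a germ mpoly ring" by (rule cring_poly_ring)
  show ?thesis unfolding tjurina_sigma_eq by (rule genideal_ideal) (use sigma_poly_in_carrier in blast)
qed

lemma tjurina_sigma_least:
  assumes "ideal A (poly_ring q)" "sigma_poly q g \<in> A" "\<And>j. sigma_poly q (\<lambda>i. germ_pderiv j (g i)) \<in> A"
  shows "tjurina_sigma q g \<subseteq> A"
proof -
  interpret cring "poly_ring q :: 'a germ mpoly ring" by (rule cring_poly_ring)
  show ?thesis unfolding tjurina_sigma_eq by (rule genideal_minimal) (use assms in auto)
qed

text \<open>Nakayama's lemma at the prime \<open>P\<close>: the matrix \<open>M\<close> is invertible modulo \<open>P\<close>, and Gaussian
  elimination with cross-multiplied rows avoids dividing by elements outside \<open>P\<close>.\<close>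

lemma nakayama_elimination:
  fixes C A P :: "'a::comm_ring_1 set" and M :: "'k \<Rightarrow> 'k \<Rightarrow> 'a"
  assumes C: "1 \<in> C" "-1 \<in> C" "\<And>x y. x \<in> C \<Longrightarrow> y \<in> C \<Longrightarrow> x + y \<in> C" "\<And>x y. x \<in> C \<Longrightarrow> y \<in> C \<Longrightarrow> x * y \<in> C"
    and A: "submodule_over C A" and P: "submodule_over C P" "1 \<notin> P"
      "\<And>x y. x \<in> C \<Longrightarrow> y \<in> C \<Longrightarrow> x * y \<in> P \<Longrightarrow> x \<in> P \<or> y \<in> P"
    and X: "finite X"
  shows "(\<And>k l. M k l \<in> C) \<Longrightarrow> (\<And>k l. M k l \<in> P \<longleftrightarrow> k \<noteq> l)
    \<Longrightarrow> (\<And>k. k \<in> X \<Longrightarrow> (\<Sum>l\<in>X. M k l * u l) \<in> A) \<Longrightarrow> \<exists>s\<in>C. s \<notin> P \<and> (\<forall>l\<in>X. s * u l \<in> A)"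
  using X
proof (induction X arbitrary: M)
  case empty
  then show ?case using C P by auto
next
  case (insert n X)
  have diff: "x - y \<in> C" if "x \<in> C" "y \<in> C" for x y
    using C(3)[OF that(1) C(4)[OF C(2) that(2)]] by simp
  \<comment> \<open>Row and column \<open>n\<close> stay untouched so that the hypotheses on the
    matrix, which range over all indices, persist for \<open>M'\<close>.\<close>
  define M' where "M' k l = (if k \<noteq> n \<and> l \<noteq> n then M n n * M k l - M k n * M n l else M k l)" for k l
  have nn: "M n n \<in> C" "M n n \<notin> P" using insert.prems by auto
  have "\<exists>s\<in>C. s \<notin> P \<and> (\<forall>l\<in>X. s * u l \<in> A)"
  proof (rule insert.IH)
    show "M' k l \<in> C" for k l using insert.prems(1) C(4) diff by (simp add: M'_def)
    show "M' k l \<in> P \<longleftrightarrow> k \<noteq> l" for k l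
    proof (cases "k \<noteq> n \<and> l \<noteq> n")
      case True
      have b: "M k n * M n l \<in> P" 
        using submodule_overD(3)[OF P(1) insert.prems(1)[of k n], of "M n l"] insert.prems(2)[of n l] True by auto
      show ?thesis
      proof (cases "k = l")
        case True
        have "M' k l \<notin> P"
        proof
          assume "M' k l \<in> P"
          from submodule_overD(2)[OF P(1) this b] have "M n n * M k l \<in> P"
            using \<open>k \<noteq> n \<and> l \<noteq> n\<close> by (simp add: M'_def)
          then show False using P(3) insert.prems(1,2) True by blast
        qed
        with True show ?thesis by simp
      next
        case False
        have "M n n * M k l \<in> P" 
          using submodule_overD(3)[OF P(1) insert.prems(1)[of n n], of "M k l"] insert.prems(2)[of k l] False by auto
        from submodule_over_diff[OF P(1) C(2) this b] False True show ?thesis by (simp add: M'_def)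
      qed
    qed (use insert.prems(2) in \<open>auto simp: M'_def\<close>)
    fix k assume k: "k \<in> X"
    have rel: "(\<Sum>l\<in>X. M k l * u l) + M k n * u n \<in> A" if "k \<in> insert n X" for k
      using insert.prems(3)[OF that] insert.hyps by (simp add: add.commute)
    have "M n n * ((\<Sum>l\<in>X. M k l * u l) + M k n * u n) - M k n * ((\<Sum>l\<in>X. M n l * u l) + M n n * u n) \<in> A"
      by (intro submodule_over_diff[OF A C(2)] submodule_overD(3)[OF A] insert.prems(1) rel) (use k in auto)
    also have "M n n * ((\<Sum>l\<in>X. M k l * u l) + M k n * u n) - M k n * ((\<Sum>l\<in>X. M n l * u l) + M n n * u n)
        = (\<Sum>l\<in>X. (M n n * M k l - M k n * M n l) * u l)"
      by (simp add: algebra_simps sum_distrib_left sum_subtractf)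
    also have "\<dots> = (\<Sum>l\<in>X. M' k l * u l)"
      using insert.hyps k by (intro sum.cong) (auto simp: M'_def)
    finally show "(\<Sum>l\<in>X. M' k l * u l) \<in> A" .
  qed
  then obtain s where s: "s \<in> C" "s \<notin> P" "\<And>l. l \<in> X \<Longrightarrow> s * u l \<in> A" by blast
  \<comment> \<open>Back substitution: row \<open>n\<close> times \<open>s\<close>, with all other
    unknowns already in \<open>A\<close>, leaves the last unknown multiplied by the pivot.\<close>
  have "s * (\<Sum>l\<in>insert n X. M n l * u l) - (\<Sum>l\<in>X. M n l * (s * u l)) \<in> A"
    by (intro submodule_over_diff[OF A C(2)] submodule_overD(3)[OF A] submodule_over_sum[OF A]
        insert.prems s) auto
  also have "s * (\<Sum>l\<in>insert n X. M n l * u l) - (\<Sum>l\<in>X. M n l * (s * u l)) = s * M n n * u n"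
    using insert.hyps by (simp add: algebra_simps sum_distrib_left)
  finally have n: "s * M n n * u n \<in> A" .
  have "s * M n n * u l \<in> A" if "l \<in> X" for l
    using submodule_overD(3)[OF A nn(1) s(3)[OF that]] by (simp add: mult_ac)
  with n have "\<forall>l\<in>insert n X. s * M n n * u l \<in> A" by blast
  moreover have "s * M n n \<notin> P" using P(3) s nn by blast
  ultimately show ?case using C(4)[OF s(1) nn(1)] by blast
qed

section \<open>Specializing the variables to constants\<close>

lemma digits_unique:
  fixes f g :: "nat \<Rightarrow> nat"
  assumes "\<And>i. i < q \<Longrightarrow> f i < N" "\<And>i. i < q \<Longrightarrow> g i < N" "(\<Sum>i<q. f i * N ^ i) = (\<Sum>i<q. g i * N ^ i)" "i < q"
  shows "f i = g i"
  using assms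
proof (induction q arbitrary: f g i)
  case (Suc q)
  have split: "(\<Sum>i<Suc q. f i * N ^ i) = f 0 + N * (\<Sum>i<q. f (Suc i) * N ^ i)" for f :: "nat \<Rightarrow> nat"
    unfolding sum.lessThan_Suc_shift by (simp add: sum_distrib_left mult_ac)
  have N: "f 0 < N" "g 0 < N" using Suc.prems by auto
  have eq: "f 0 + N * (\<Sum>i<q. f (Suc i) * N ^ i) = g 0 + N * (\<Sum>i<q. g (Suc i) * N ^ i)"
    using Suc.prems(3) by (simp only: split)
  from arg_cong[OF eq, of "\<lambda>x. x mod N"] have 0: "f 0 = g 0" using N by simp
  with eq N have "(\<Sum>i<q. f (Suc i) * N ^ i) = (\<Sum>i<q. g (Suc i) * N ^ i)" by simp
  then have "f (Suc k) = g (Suc k)" if "k < q" for k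
    using Suc.IH[of "\<lambda>i. f (Suc i)" "\<lambda>i. g (Suc i)" k] Suc.prems that by auto
  with 0 Suc.prems(4) show ?case by (cases i) auto
qed simp

lemma ideal_tjurina: "ideal (tjurina f) germ_ring"
  unfolding tjurina_def by (rule ring.genideal_ideal) (use cring_germ_ring in \<open>auto simp: cring_def\<close>)

lemma tjurina_gens: "f \<in> tjurina f" "germ_pderiv j f \<in> tjurina f"
  using tjurina_subset_iff[OF ideal_tjurina, of f] by auto

lemma germ_value_sum: "germ_value (sum f X) = (\<Sum>i\<in>X. germ_value (f i))"
  by (induction X rule: infinite_finite_induct) auto

lemma germ_value_power: "germ_value (f ^ k) = germ_value f ^ k"
  by (induction k) auto

lemma germ_value_prod: "germ_value (prod f X) = (\<Prod>i\<in>X. germ_value (f i))"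
  by (induction X rule: infinite_finite_induct) auto

text \<open>Putting x = 0 turns \<open>h\<close> into a complex polynomial with a nonzero
  coefficient. It is restricted to a curve on which it stays nonzero, and a one-variable polynomial
  has only finitely many roots.\<close>

lemma exists_unit_specialization:
  fixes h :: "('n::finite) germ mpoly"
  assumes h: "h \<in> carrier (poly_ring q)" and m0: "m0 \<in> Poly_Mapping.keys h" "germ_value (Poly_Mapping.lookup h m0) \<noteq> 0"
  shows "\<exists>b. germ_value (mpoly_eval id (\<lambda>i. germ_const (b i)) h) \<noteq> 0"
proof -
  have "finite ((\<lambda>(m, i). Poly_Mapping.lookup m i) ` (Poly_Mapping.keys h \<times> {..<q}))" by simp
  then obtain N where "\<forall>d\<in>(\<lambda>(m, i). Poly_Mapping.lookup m i) ` (Poly_Mapping.keys h \<times> {..<q}). d < N"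
    unfolding finite_nat_set_iff_bounded by blast
  then have N: "Poly_Mapping.lookup m i < N" if "m \<in> Poly_Mapping.keys h" "i < q" for m i using that by force
  \<comment> \<open>Kronecker substitution \<open>\<alpha>\<^sub>i = z\<^bsup>N^i\<^esup>\<close>: distinct monomials of \<open>h\<close> go to distinct powers of \<open>z\<close>.\<close>
  define e where "e m = (\<Sum>i<q. Poly_Mapping.lookup m i * N ^ i)" for m :: "nat \<Rightarrow>\<^sub>0 nat"
  have keys: "Poly_Mapping.keys m \<subseteq> {..<q}" if "m \<in> Poly_Mapping.keys h" for m using h that by simp
  have e_inj: "m = m0" if m: "m \<in> Poly_Mapping.keys h" and "e m = e m0" for m
  proof (rule poly_mapping_eqI)
    fix i
    show "Poly_Mapping.lookup m i = Poly_Mapping.lookup m0 i"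
    proof (cases "i < q")
      case True
      then show ?thesis using digits_unique[of q "Poly_Mapping.lookup m" N "Poly_Mapping.lookup m0"] N m m0(1) that(2) by (simp add: e_def)
    next
      case False
      then have "i \<notin> Poly_Mapping.keys m" "i \<notin> Poly_Mapping.keys m0" using keys m m0(1) by auto
      then show ?thesis by (simp add: in_keys_iff)
    qed
  qed
  define H where "H = (\<Sum>m\<in>Poly_Mapping.keys h. monom (germ_value (Poly_Mapping.lookup h m)) (e m))"
  have "coeff H (e m0) = (\<Sum>m\<in>Poly_Mapping.keys h. if m = m0 then germ_value (Poly_Mapping.lookup h m) else 0)"
    unfolding H_def coeff_sum by (intro sum.cong) (auto dest: e_inj)
  also have "\<dots> = germ_value (Poly_Mapping.lookup h m0)" using m0(1) by simp
  finally have "H \<noteq> 0" using m0(2) by auto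
  then have "finite {z. poly H z = 0}" by (rule poly_roots_finite)
  then obtain z where z: "poly H z \<noteq> 0" using infinite_UNIV_char_0[where 'a=complex] by (metis (mono_tags) UNIV_eq_I mem_Collect_eq)
  define b where "b i = z ^ (N ^ i)" for i
  have "germ_value (mon_eval (\<lambda>i. germ_const (b i) :: 'n germ) m) = z ^ e m" if "m \<in> Poly_Mapping.keys h" for m
    by (subst mon_eval_superset[OF _ keys[OF that]])
       (simp_all add: germ_value_prod germ_value_power b_def e_def power_sum mult.commute flip: power_mult)
  then have "germ_value (mpoly_eval id (\<lambda>i. germ_const (b i)) h) = poly H z"
    unfolding mpoly_eval_def H_def
    by (simp add: germ_value_sum poly_sum poly_monom)
  with z show ?thesis by metis
qed

section \<open>Tjurina ideals and \<open>T\<close>-dependence\<close>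

lemma tjurina_subset_tjurina_set: "f \<in> G \<Longrightarrow> tjurina f \<subseteq> tjurina_set G"
  unfolding tjurina_set_def genideal_germ_ring using hull_subset[of "\<Union> (tjurina ` G)"] by blast

lemma tjurina_set_antiderivs_subset:
  "ideal I germ_ring \<Longrightarrow> tjurina_set (antiderivs I) \<subseteq> I"
  unfolding tjurina_set_def genideal_germ_ring
  by (rule submodule_over_hull_least) (auto simp: antiderivs_def ideal_germ_ring_iff)

lemma const_poly_in_extended_tjurina: "c \<in> tjurina_set J \<Longrightarrow> const_poly c \<in> extended_tjurina q J"
proof -
  interpret cring "poly_ring q :: 'a germ mpoly ring" by (rule cring_poly_ring)
  assume "c \<in> tjurina_set J"
  then show ?thesis unfolding extended_tjurina_def
    using genideal_self[of "const_poly ` tjurina_set J"] const_poly_in_carrier by blast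
qed

lemma T_dependent_imp_tjurina:
  fixes I :: "('n::finite) germ set"
  assumes I: "ideal I germ_ring" and full: "T_full I" and dep: "T_dependent (antiderivs I)"
  shows "\<exists>f. I = tjurina f"
proof -
  from dep obtain q g P where J: "antiderivs I = genideal germ_ring (g ` {..<q})"
    and P: "P \<in> Proj q" "Proj_to_Spec P = max_ideal" "P \<notin> supp_F q g"
    unfolding T_dependent_def by blast
  have PI: "ideal P (poly_ring q)" using P(1) by (auto simp: Proj_def primeideal_def)
  then have Psub: "submodule_over (carrier (poly_ring q)) P" by (simp only: ideal_poly_ring_iff)
  from P obtain h where h: "h \<in> colon_ideal q (tjurina_sigma q g) (extended_tjurina q (antiderivs I))" "h \<notin> P"
    unfolding supp_F_def Proj_vanishing_def J by blast
  then have hc: "h \<in> carrier (poly_ring q)" by (simp add: colon_ideal_def)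
  \<comment> \<open>Since \<open>P\<close> lies over the maximal ideal, it contains every term whose
    coefficient vanishes at 0; a polynomial with only such terms would belong to
    \<open>P\<close>.\<close>
  have "\<exists>m\<in>Poly_Mapping.keys h. germ_value (Poly_Mapping.lookup h m) \<noteq> 0"
  proof (rule ccontr)
    assume n: "\<not> ?thesis"
    have "Poly_Mapping.single m (Poly_Mapping.lookup h m) \<in> P" if m: "m \<in> Poly_Mapping.keys h" for m
    proof -
      have "Poly_Mapping.lookup h m \<in> max_ideal" using n m by (auto simp: max_ideal_eq)
      then have "const_poly (Poly_Mapping.lookup h m) \<in> P" using P(2) by (auto simp: Proj_to_Spec_def)
      moreover have "Poly_Mapping.single m 1 \<in> carrier (poly_ring q :: 'n germ mpoly ring)"
        using hc m by (auto split: if_splits)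
      ultimately have "Poly_Mapping.single m 1 * const_poly (Poly_Mapping.lookup h m) \<in> P"
        using submodule_overD(3)[OF Psub] by blast
      then show ?thesis by (simp add: const_poly_def mult_single)
    qed
    then have "(\<Sum>m\<in>Poly_Mapping.keys h. Poly_Mapping.single m (Poly_Mapping.lookup h m)) \<in> P"
      by (rule submodule_over_sum[OF Psub])
    with h(2) show False using mpoly_eq_sum_single[of h] by simp
  qed
  then obtain b where b: "germ_value (mpoly_eval id (\<lambda>i. germ_const (b i)) h) \<noteq> 0"
    using exists_unit_specialization[OF hc] by blast
  interpret E: mpoly_evaluation "id :: 'n germ \<Rightarrow> 'n germ" "\<lambda>i. germ_const (b i)"
    by unfold_locales auto
  define f where "f = E.ev (sigma_poly q g)"
  have ev_sigma: "E.ev (sigma_poly q g) = (\<Sum>i<q. g i * germ_const (b i))" for g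
    by (simp add: sigma_poly_def)
  have f: "f = (\<Sum>i<q. g i * germ_const (b i))" by (simp only: f_def ev_sigma)
  have sum: "germ_pderiv j (sum F X) = (\<Sum>i\<in>X. germ_pderiv j (F i))" for j and F and X :: "nat set"
    by (induction X rule: infinite_finite_induct) (auto simp: germ_pderiv_0 germ_pderiv_add)
  have df: "germ_pderiv j f = E.ev (sigma_poly q (\<lambda>i. germ_pderiv j (g i)))" for j
    by (simp add: f ev_sigma sum germ_pderiv_mult germ_pderiv_const)
  have Tf: "submodule_over UNIV (tjurina f)" using ideal_tjurina by (simp add: ideal_germ_ring_iff)
  \<comment> \<open>The pullback of T(f) under the substitution is an ideal. By \<open>df\<close> it
    contains the generators of T(\<sigma>), since constants commute with the partial
    derivatives.\<close>
  have "ideal {p \<in> carrier (poly_ring q). E.ev p \<in> tjurina f} (poly_ring q)"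
    unfolding ideal_poly_ring_iff
  proof (intro conjI submodule_overI)
    show "0 \<in> {p \<in> carrier (poly_ring q). E.ev p \<in> tjurina f}"
      using submodule_overD(1)[OF Tf] by simp
    show "x + y \<in> {p \<in> carrier (poly_ring q). E.ev p \<in> tjurina f}"
      if "x \<in> {p \<in> carrier (poly_ring q). E.ev p \<in> tjurina f}" "y \<in> {p \<in> carrier (poly_ring q). E.ev p \<in> tjurina f}" for x y
      using that poly_ring_add_closed[of x q y] submodule_overD(2)[OF Tf] by (simp del: poly_ring_simps(1))
    show "c * x \<in> {p \<in> carrier (poly_ring q). E.ev p \<in> tjurina f}"
      if "c \<in> carrier (poly_ring q)" "x \<in> {p \<in> carrier (poly_ring q). E.ev p \<in> tjurina f}" for c x
      using that poly_ring_mult_closed[of c q x] submodule_overD(3)[OF Tf] by (simp del: poly_ring_simps(1))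
  qed blast
  then have "tjurina_sigma q g \<subseteq> {p \<in> carrier (poly_ring q). E.ev p \<in> tjurina f}"
    by (rule tjurina_sigma_least)
       (use sigma_poly_in_carrier tjurina_gens[where f=f] in \<open>simp_all del: poly_ring_simps(1) add: df flip: f_def\<close>)
  then have ev_ts: "E.ev p \<in> tjurina f" if "p \<in> tjurina_sigma q g" for p using that by blast
  from germ_unit[OF b] obtain v where v: "E.ev h * v = 1" by blast
  have "c \<in> tjurina f" if "c \<in> I" for c
  proof -
    have "c \<in> tjurina_set (antiderivs I)" using full that by (simp add: T_full_def)
    from const_poly_in_extended_tjurina[OF this, of q] have "h * const_poly c \<in> tjurina_sigma q g"
      using h(1) by (simp add: colon_ideal_def)
    from ev_ts[OF this] have "E.ev h * c \<in> tjurina f" by simp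
    from submodule_overD(3)[OF Tf UNIV_I[of v] this] have "(E.ev h * v) * c \<in> tjurina f" by (simp add: mult_ac)
    then show ?thesis by (simp add: v)
  qed
  moreover have "tjurina f \<subseteq> I"
  proof -
    have sJ: "submodule_over UNIV (antiderivs I)" using ideal_antiderivs[OF I] by (simp add: ideal_germ_ring_iff)
    have "g i \<in> antiderivs I" if "i < q" for i
      unfolding J genideal_germ_ring using that by (intro hull_inc) auto
    then have "f \<in> antiderivs I"
      unfolding f using submodule_overD(3)[OF sJ UNIV_I] by (intro submodule_over_sum[OF sJ]) (simp add: mult.commute)
    then show ?thesis by (simp add: antiderivs_def)
  qed
  ultimately show ?thesis by blast
qed

section \<open>The point (1 : 0 : ... : 0) of Proj over the maximal ideal\<close>

definition first_axis :: "nat \<Rightarrow> complex poly" where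
  "first_axis i = (if i = 0 then monom 1 1 else 0)"

lemma mon_eval_first_axis:
  "mon_eval first_axis m = (if Poly_Mapping.keys m \<subseteq> {0} then monom 1 (monomial_deg m) else 0)"
proof (cases "Poly_Mapping.keys m \<subseteq> {0}")
  case True
  then have "Poly_Mapping.keys m = {} \<or> Poly_Mapping.keys m = {0}" by blast
  then show ?thesis
    by (elim disjE) (simp_all add: mon_eval_def first_axis_def monomial_deg_def monom_power)
next
  case False
  then obtain i where "i \<in> Poly_Mapping.keys m" "i \<noteq> 0" by blast
  then have "mon_eval first_axis m = 0"
    unfolding mon_eval_def by (intro prod_zero bexI[of _ i]) (auto simp: first_axis_def in_keys_iff)
  with False show ?thesis by simp
qed

interpretation axis_eval: mpoly_evaluation "\<lambda>c :: ('n::finite) germ. [:germ_value c:]" first_axis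
  by unfold_locales (auto simp: one_pCons)

text \<open>For \<open>q \<ge> 1\<close> this is the ideal generated by \<open>max_ideal\<close> and
  all variables except the first. As a kernel with values in the domain \<open>complex poly\<close>
  it is visibly prime. The first variable goes to the indeterminate and not to 1, since evaluation
  at 1 would have an inhomogeneous kernel.\<close>

definition axis_prime :: "nat \<Rightarrow> ('n::finite) germ mpoly set" where
  "axis_prime q = {p \<in> carrier (poly_ring q). mpoly_eval (\<lambda>c. [:germ_value c:]) first_axis p = 0}"

lemma lookup_hom_component:
  "Poly_Mapping.lookup (hom_component d p) m = (if monomial_deg m = d then Poly_Mapping.lookup p m else 0)"
  by (simp add: hom_component_def mapp.rep_eq when_def in_keys_iff)

lemma keys_hom_component: "Poly_Mapping.keys (hom_component d p) \<subseteq> Poly_Mapping.keys p"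
  by (auto simp: in_keys_iff lookup_hom_component split: if_splits)

text \<open>The evaluation respects degrees: the component of degree \<open>d\<close> accounts
  exactly for the coefficient of the d-th power. Hence its kernel is homogeneous.\<close>

lemma coeff_axis_eval_hom_component:
  fixes p :: "('n::finite) germ mpoly"
  shows "coeff (mpoly_eval (\<lambda>c. [:germ_value c:]) first_axis (hom_component d p)) k
    = (if k = d then coeff (mpoly_eval (\<lambda>c. [:germ_value c:]) first_axis p) d else 0)"
proof -
  have c: "coeff ([:germ_value c:] * mon_eval first_axis m) k
      = (if Poly_Mapping.keys m \<subseteq> {0} \<and> monomial_deg m = k then germ_value c else 0)" for c :: "'n germ" and m k
    by (simp add: mon_eval_first_axis)
  have eq: "coeff (mpoly_eval (\<lambda>c. [:germ_value c:]) first_axis r) k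
      = (\<Sum>m\<in>Poly_Mapping.keys p. if Poly_Mapping.keys m \<subseteq> {0} \<and> monomial_deg m = k
            then germ_value (Poly_Mapping.lookup r m) else 0)"
    if "Poly_Mapping.keys r \<subseteq> Poly_Mapping.keys p" for r :: "'n germ mpoly" and k
    unfolding axis_eval.eval_superset[OF finite_keys that] coeff_sum c ..
  show ?thesis
    unfolding eq[OF keys_hom_component] eq[OF subset_refl]
    by (auto simp: lookup_hom_component intro!: sum.cong sum.neutral)
qed

lemma primeideal_axis_prime:
  assumes "q \<ge> 1"
  shows "primeideal (axis_prime q :: ('n::finite) germ mpoly set) (poly_ring q)"
proof (rule primeidealI)
  show "ideal (axis_prime q :: 'n germ mpoly set) (poly_ring q)"
    unfolding ideal_poly_ring_iff
  proof (intro conjI submodule_overI)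
    show "x + y \<in> axis_prime q" if "x \<in> axis_prime q" "y \<in> axis_prime q" for x y :: "'n germ mpoly"
      using that poly_ring_add_closed[of x q y] by (simp add: axis_prime_def del: poly_ring_simps(1))
    show "c * x \<in> axis_prime q" if "c \<in> carrier (poly_ring q)" "x \<in> axis_prime q" for c x :: "'n germ mpoly"
      using that poly_ring_mult_closed[of c q x] by (simp add: axis_prime_def del: poly_ring_simps(1))
  qed (auto simp: axis_prime_def)
  show "cring (poly_ring q :: 'n germ mpoly ring)" by (rule cring_poly_ring)
  have "1 \<in> carrier (poly_ring q)" "1 \<notin> (axis_prime q :: 'n germ mpoly set)"
    by (auto simp: axis_prime_def)
  then show "carrier (poly_ring q) \<noteq> (axis_prime q :: 'n germ mpoly set)" by blast
  fix x y :: "'n germ mpoly"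
  assume "x \<in> carrier (poly_ring q)" "y \<in> carrier (poly_ring q)" "x \<otimes>\<^bsub>poly_ring q\<^esub> y \<in> axis_prime q"
  then show "x \<in> axis_prime q \<or> y \<in> axis_prime q"
    by (simp add: axis_prime_def del: poly_ring_simps(1))
qed

lemma axis_prime_in_Proj:
  assumes "q \<ge> 1"
  shows "(axis_prime q :: ('n::finite) germ mpoly set) \<in> Proj q"
  unfolding Proj_def
proof (intro CollectI conjI)
  show "primeideal (axis_prime q :: 'n germ mpoly set) (poly_ring q)" using assms by (rule primeideal_axis_prime)
  show "homogeneous_set (axis_prime q :: 'n germ mpoly set)"
    unfolding homogeneous_set_def
  proof (intro ballI allI)
    fix p :: "'n germ mpoly" and d assume p: "p \<in> axis_prime q"
    then have "mpoly_eval (\<lambda>c. [:germ_value c:]) first_axis (hom_component d p) = 0"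
      by (intro poly_eqI) (simp add: coeff_axis_eval_hom_component axis_prime_def)
    moreover have "hom_component d p \<in> carrier (poly_ring q)"
      using p keys_hom_component[of d p] by (auto simp: axis_prime_def)
    ultimately show "hom_component d p \<in> axis_prime q" by (simp add: axis_prime_def)
  qed
  have "hom_component 0 (var_poly 0 :: 'n germ mpoly) = 0"
    by (rule poly_mapping_eqI) (auto simp: lookup_hom_component var_poly_def lookup_single when_def monomial_deg_def)
  then have "(var_poly 0 :: 'n germ mpoly) \<in> irrelevant_ideal q"
    using var_poly_in_carrier[of 0 q] assms by (simp add: irrelevant_ideal_def)
  moreover have "(var_poly 0 :: 'n germ mpoly) \<notin> axis_prime q"
    by (simp add: axis_prime_def first_axis_def)
  ultimately show "\<not> irrelevant_ideal q \<subseteq> (axis_prime q :: 'n germ mpoly set)" by blast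
qed

lemma Proj_to_Spec_axis_prime: "Proj_to_Spec (axis_prime q) = max_ideal"
  using const_poly_in_carrier by (auto simp: Proj_to_Spec_def axis_prime_def max_ideal_eq simp del: poly_ring_simps(1))

section \<open>From a Tjurina ideal to T-dependence\<close>

lemma hull_range_lincomb:
  fixes u :: "'k::finite \<Rightarrow> 'a::comm_ring_1"
  assumes "x \<in> submodule_over UNIV hull (range u)"
  shows "\<exists>c. x = (\<Sum>k\<in>UNIV. c k * u k)"
proof -
  let ?L = "{\<Sum>k\<in>UNIV. c k * u k | c. True}"
  have "submodule_over UNIV ?L"
  proof (rule submodule_overI)
    show "0 \<in> ?L" by (auto intro!: exI[of _ "\<lambda>_. 0"])
    fix x y assume "x \<in> ?L" "y \<in> ?L"
    then obtain c d where "x = (\<Sum>k\<in>UNIV. c k * u k)" "y = (\<Sum>k\<in>UNIV. d k * u k)" by blast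
    then have "x + y = (\<Sum>k\<in>UNIV. (c k + d k) * u k)" by (simp add: sum.distrib algebra_simps)
    then show "x + y \<in> ?L" by (auto intro!: exI[of _ "\<lambda>k. c k + d k"])
  next
    fix a x assume "x \<in> ?L"
    then obtain c where "x = (\<Sum>k\<in>UNIV. c k * u k)" by blast
    then have "a * x = (\<Sum>k\<in>UNIV. (a * c k) * u k)" by (simp add: sum_distrib_left mult.assoc)
    then show "a * x \<in> ?L" by (auto intro!: exI[of _ "\<lambda>k. a * c k"])
  qed
  moreover have "range u \<subseteq> ?L"
  proof
    fix x assume "x \<in> range u"
    then obtain k where "x = u k" by blast
    also have "u k = (\<Sum>l\<in>UNIV. (if l = k then 1 else 0) * u l)" by (simp add: if_distrib[of "\<lambda>c. c * _"] cong: if_cong)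
    finally show "x \<in> ?L" by (intro CollectI exI[of _ "\<lambda>l. if l = k then 1 else 0"]) simp
  qed
  ultimately have "submodule_over UNIV hull (range u) \<subseteq> ?L" by (intro submodule_over_hull_least)
  with assms show ?thesis by blast
qed

text \<open>Lists the germ (\<open>None\<close>) and its partial derivatives over one finite index
  type, so that the relations between the jets of \<open>g i\<close> and those of \<open>f\<close>
  form square matrices.\<close>

definition jet :: "'n option \<Rightarrow> ('n::finite) germ \<Rightarrow> 'n germ" where
  "jet k f = (case k of None \<Rightarrow> f | Some j \<Rightarrow> germ_pderiv j f)"

lemma tjurina_eq_hull_jet: "tjurina f = submodule_over UNIV hull (range (\<lambda>k. jet k f))"
proof -
  have "range (\<lambda>k. jet k f) = insert f (range (\<lambda>j. germ_pderiv j f))"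
    by (simp add: UNIV_option_conv jet_def image_image)
  then show ?thesis by (simp add: tjurina_def genideal_germ_ring)
qed

lemma tjurina_imp_T_dependent:
  fixes f :: "('n::finite) germ"
  shows "T_dependent (antiderivs (tjurina f))"
proof -
  let ?I = "tjurina f"
  let ?J = "antiderivs ?I"
  have idJ: "ideal ?J germ_ring" by (rule ideal_antiderivs[OF ideal_tjurina])
  have fJ: "f \<in> ?J" by (simp add: antiderivs_def)
  from ideal_germ_ring_finite_generators[OF idJ] obtain G where G: "finite G" "?J = genideal germ_ring G" .
  from finite_list[OF G(1)] obtain xs where xs: "set xs = G" by blast
  \<comment> \<open>Prepending \<open>f\<close> leaves the ideal unchanged, as \<open>f\<close> is
    one of its own antiderivatives, and \<open>T_dependent\<close> allows any finite system of
    generators.\<close>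
  define q where "q = length (f # xs)"
  define g where "g i = (f # xs) ! i" for i
  have gset: "g ` {..<q} = insert f G"
  proof -
    have "g ` {..<q} = set (f # xs)" unfolding set_conv_nth g_def q_def by blast
    then show ?thesis by (simp add: xs)
  qed
  have q: "q \<ge> 1" "g 0 = f" by (auto simp: q_def g_def)
  have Jg: "?J = genideal germ_ring (g ` {..<q})"
  proof
    show "?J \<subseteq> genideal germ_ring (g ` {..<q})"
      unfolding G(2) gset genideal_germ_ring by (rule hull_mono) blast
    show "genideal germ_ring (g ` {..<q}) \<subseteq> ?J"
      unfolding gset genideal_germ_ring
    proof (rule submodule_over_hull_least)
      show "insert f G \<subseteq> ?J" using fJ hull_subset[of G "submodule_over UNIV"] by (simp add: G(2) genideal_germ_ring)
      show "submodule_over UNIV ?J" using idJ by (simp add: ideal_germ_ring_iff)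
    qed
  qed
  have "jet k (g i) \<in> ?I" if "i < q" for k i
  proof -
    have "g i \<in> ?J" unfolding Jg genideal_germ_ring using that by (intro hull_inc) auto
    then have "tjurina (g i) \<subseteq> ?I" by (simp add: antiderivs_def)
    then show ?thesis using tjurina_gens[where f="g i"] by (auto simp: jet_def split: option.split)
  qed
  then have ex: "\<exists>c. jet k (g i) = (\<Sum>l\<in>UNIV. c l * jet l f)" if "i < q" for i k
    using hull_range_lincomb[of _ "\<lambda>k. jet k f"] tjurina_eq_hull_jet[of f] that by simp
  define c' where "c' i k = (SOME c. jet k (g i) = (\<Sum>l\<in>UNIV. c l * jet l f))" for i k
  have c': "jet k (g i) = (\<Sum>l\<in>UNIV. c' i k l * jet l f)" if "i < q" for i k
    unfolding c'_def by (rule someI_ex[OF ex[OF that]])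
  \<comment> \<open>The jets of \<open>f\<close> may satisfy linear relations, so the arbitrary
    choice \<open>c'\<close> need not give the identity matrix at \<open>i = 0\<close>; it is
    imposed there.\<close>
  define c where "c i k l = (if i = 0 then (if k = l then 1 else 0) else c' i k l)" for i k l
  have c: "jet k (g i) = (\<Sum>l\<in>UNIV. c i k l * jet l f)" if "i < q" for i k
  proof (cases "i = 0")
    case True
    have "(\<Sum>l\<in>UNIV. c i k l * jet l f) = (\<Sum>l\<in>UNIV. if l = k then jet l f else 0)"
      by (intro sum.cong) (auto simp: c_def True)
    then show ?thesis by (simp add: True q(2))
  next
    case False
    then show ?thesis unfolding c_def using c'[OF that] by simp
  qed
  \<comment> \<open>This matrix of linear forms maps the jets of \<open>f\<close> to \<sigma> and
    its partial derivatives, that is, to the generators of T(\<sigma>).\<close>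
  define M where "M k l = sigma_poly q (\<lambda>i. c i k l)" for k l
  let ?C = "carrier (poly_ring q :: 'n germ mpoly ring)"
  let ?A = "tjurina_sigma q g"
  let ?P = "axis_prime q :: 'n germ mpoly set"
  have A: "submodule_over ?C ?A" using ideal_tjurina_sigma ideal_poly_ring_iff by blast
  have prime: "primeideal ?P (poly_ring q)" using q(1) by (rule primeideal_axis_prime)
  have P: "submodule_over ?C ?P" using primeideal.axioms(1)[OF prime] ideal_poly_ring_iff by blast
  have "\<exists>s\<in>?C. s \<notin> ?P \<and> (\<forall>l\<in>UNIV. s * const_poly (jet l f) \<in> ?A)"
  proof (rule nakayama_elimination[OF _ _ _ _ A P])
    show "1 \<in> ?C" "-1 \<in> ?C" by auto
    show "x + y \<in> ?C" "x * y \<in> ?C" if "x \<in> ?C" "y \<in> ?C" for x y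
      using that poly_ring_add_closed poly_ring_mult_closed by blast+
    show "1 \<notin> ?P" by (simp add: axis_prime_def)
    show "x \<in> ?P \<or> y \<in> ?P" if "x \<in> ?C" "y \<in> ?C" "x * y \<in> ?P" for x y
      using primeideal.I_prime[OF prime that(1,2)] that(3) by simp
    show "M k l \<in> ?C" for k l unfolding M_def by (rule sigma_poly_in_carrier)
    show "M k l \<in> ?P \<longleftrightarrow> k \<noteq> l" for k l
    proof -
      \<comment> \<open>At the point only \<open>i = 0\<close> survives, so the matrix becomes the
        indeterminate times the identity; hence exactly the diagonal entries avoid the
        prime.\<close>
      have "mpoly_eval (\<lambda>c. [:germ_value c:]) first_axis (M k l) = (\<Sum>i<q. [:germ_value (c i k l):] * first_axis i)"
        unfolding M_def sigma_poly_def by simp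
      also have "\<dots> = (\<Sum>i\<in>{0}. [:germ_value (c i k l):] * first_axis i)"
        using q(1) by (intro sum.mono_neutral_right) (auto simp: first_axis_def)
      also have "\<dots> = (if k = l then monom 1 1 else 0)" by (simp add: c_def first_axis_def)
      finally show ?thesis
        using sigma_poly_in_carrier[of q "\<lambda>i. c i k l"] by (simp add: axis_prime_def M_def del: poly_ring_simps(1))
    qed
    fix k
    have "(\<Sum>l\<in>UNIV. M k l * const_poly (jet l f)) = sigma_poly q (\<lambda>i. \<Sum>l\<in>UNIV. c i k l * jet l f)"
      unfolding M_def by (rule sigma_poly_lincomb)
    also have "\<dots> = sigma_poly q (\<lambda>i. jet k (g i))"
      unfolding sigma_poly_def by (intro sum.cong) (simp_all add: c)
    also have "\<dots> \<in> ?A" using tjurina_sigma_gens[where q=q and g=g] by (cases k) (simp_all add: jet_def)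
    finally show "(\<Sum>l\<in>UNIV. M k l * const_poly (jet l f)) \<in> ?A" .
  qed auto
  then obtain s where s: "s \<in> ?C" "s \<notin> ?P" "\<And>l. s * const_poly (jet l f) \<in> ?A" by blast
  \<comment> \<open>The germs that \<open>s\<close> multiplies into T(\<sigma>) form an ideal, so it
    is enough that it contains the jets of \<open>f\<close>.\<close>
  have "?I \<subseteq> {x. s * const_poly x \<in> ?A}"
    unfolding tjurina_eq_hull_jet
  proof (rule submodule_over_hull_least)
    show "range (\<lambda>k. jet k f) \<subseteq> {x. s * const_poly x \<in> ?A}" using s(3) by blast
    show "submodule_over UNIV {x. s * const_poly x \<in> ?A}"
    proof (rule submodule_overI)
      show "0 \<in> {x. s * const_poly x \<in> ?A}" using submodule_overD(1)[OF A] by (simp add: const_poly_hom)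
      show "x + y \<in> {x. s * const_poly x \<in> ?A}"
        if "x \<in> {x. s * const_poly x \<in> ?A}" "y \<in> {x. s * const_poly x \<in> ?A}" for x y
        using that submodule_overD(2)[OF A] by (simp add: const_poly_hom distrib_left)
      show "a * x \<in> {x. s * const_poly x \<in> ?A}" if "x \<in> {x. s * const_poly x \<in> ?A}" for a x
        using that submodule_overD(3)[OF A const_poly_in_carrier[of a q], of "s * const_poly x"]
        by (simp add: const_poly_hom mult_ac)
    qed
  qed
  then have sI: "const_poly ` tjurina_set ?J \<subseteq> {b \<in> ?C. s * b \<in> ?A}"
    using tjurina_set_antiderivs_subset[OF ideal_tjurina] const_poly_in_carrier by blast
  interpret cring "poly_ring q :: 'n germ mpoly ring" by (rule cring_poly_ring)
  have "ideal {b \<in> ?C. s * b \<in> ?A} (poly_ring q)"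
    unfolding ideal_poly_ring_iff
  proof (intro conjI submodule_overI)
    show "0 \<in> {b \<in> ?C. s * b \<in> ?A}" using submodule_overD(1)[OF A] by simp
    show "x + y \<in> {b \<in> ?C. s * b \<in> ?A}" if "x \<in> {b \<in> ?C. s * b \<in> ?A}" "y \<in> {b \<in> ?C. s * b \<in> ?A}" for x y
      using that poly_ring_add_closed[of x q y] submodule_overD(2)[OF A]
      by (simp add: distrib_left del: poly_ring_simps(1))
    show "a * x \<in> {b \<in> ?C. s * b \<in> ?A}" if "a \<in> ?C" "x \<in> {b \<in> ?C. s * b \<in> ?A}" for a x
      using that poly_ring_mult_closed[of a q x] submodule_overD(3)[OF A, of a "s * x"]
      by (simp add: mult.left_commute del: poly_ring_simps(1))
  qed blast
  then have "extended_tjurina q ?J \<subseteq> {b \<in> ?C. s * b \<in> ?A}"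
    unfolding extended_tjurina_def using sI by (rule genideal_minimal)
  then have "s \<in> colon_ideal q ?A (extended_tjurina q ?J)"
    using s(1) by (auto simp: colon_ideal_def)
  then have "?P \<notin> supp_F q g"
    unfolding supp_F_def Proj_vanishing_def Jg[symmetric] using s(2) by blast
  then have "\<not> {P \<in> Proj q. Proj_to_Spec P = max_ideal} \<subseteq> supp_F q g"
    using axis_prime_in_Proj[OF q(1)] Proj_to_Spec_axis_prime by blast
  then show ?thesis unfolding T_dependent_def using q(1) Jg by blast
qed

theorem theorem3p12:
  fixes I :: "('n::finite) germ set"
  assumes "ideal I germ_ring"
  shows "(\<exists>f. I = tjurina f) \<longleftrightarrow> T_full I \<and> T_dependent (antiderivs I)"
proof
  assume "\<exists>f. I = tjurina f"
  then obtain f where f: "I = tjurina f" by blast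
  \<comment> \<open>T-fullness is formal: \<open>f\<close> is itself an antiderivative, so T(f) is
    one of the summands of T(\<Delta>(I)).\<close>
  have "f \<in> antiderivs I" by (simp add: antiderivs_def f)
  then have "I \<subseteq> tjurina_set (antiderivs I)" using tjurina_subset_tjurina_set f by blast
  then have "T_full I" unfolding T_full_def using tjurina_set_antiderivs_subset[OF assms] by blast
  with f show "T_full I \<and> T_dependent (antiderivs I)" using tjurina_imp_T_dependent by blast
next
  assume "T_full I \<and> T_dependent (antiderivs I)"
  then show "\<exists>f. I = tjurina f" using T_dependent_imp_tjurina[OF assms] by blast
qed

end
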